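(* For any integers $e\geq2$, $n\geq1$, one has $$Z_{NCP(1,1,n)}(X)=\prod_{k=2}^n\frac{k+n(X-1)}{k},\qquad Z_{NCP(e,1,n)}(X)=\prod_{k=1}^n\frac{k+n(X-1)}{k},$$ $$Z_{NCP(e,e,n+1)}(X)=\frac{n+1+en(X-1)}{n+1}\prod_{k=1}^n\frac{k+n(X-1)}{k}.$$
   Context: $\mu_d\subset\mathbb{C}$ is the group of $d$-th roots of unity. For partitions $u,v$ of the same set, $u\preccurlyeq v$ means every part of $u$ is contained in a part of $v$. For finite $x\subset\mathbb{C}$, $NCP_x$ is the set of partitions of $x$ such that any two parts whose convex hulls intersect are equal. $NCP(1,1,n):=NCP_{\mu_n}$. $NCP(e,1,n)$ is the set of elements of $NCP_{\mu_{en}}$ invariant under multiplication by $\mu_e$. $NCP(e,e,n+1)$ is the set of $u\in NCP_{\mu_{en}\cup\{0\}}$ whose restriction to $\mu_{en}$ (forgetting $0$) lies in $NCP(e,1,n)$. All are ordered by $\preccurlyeq$. A chain of length $N$ in a poset $P$ is a weakly increasing sequence $p_1\leq p_2\leq\dots\leq p_N$ of elements of $P$. For a finite poset $P$, the Zeta function $Z_P$ is the function whose value at a positive integer $N$ is the number of chains of length $N-1$ in $P$ (so $Z_P(1)=1$, $Z_P(2)=|P|$); the equalities are equalities of functions of a positive integer $X$ (equivalently of polynomials). *)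

theory Defs
  imports "HOL-Analysis.Analysis" "HOL-Library.Disjoint_Sets"
begin

definition mu :: "nat \<Rightarrow> complex set" where
  "mu d = {z. z ^ d = 1}"

definition refines :: "'a set set \<Rightarrow> 'a set set \<Rightarrow> bool" (infix \<open>\<preceq>\<close> 50) where
  "u \<preceq> v \<longleftrightarrow> (\<forall>p\<in>u. \<exists>q\<in>v. p \<subseteq> q)"

definition NCP :: "complex set \<Rightarrow> complex set set set" where
  "NCP x = {u. partition_on x u \<and>
               (\<forall>p\<in>u. \<forall>q\<in>u. convex hull p \<inter> convex hull q \<noteq> {} \<longrightarrow> p = q)}"

text \<open>Restriction of a partition to a subset; parts that become empty are dropped.\<close>

definition restrict_partition :: "'a set set \<Rightarrow> 'a set \<Rightarrow> 'a set set" where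
  "restrict_partition u y = {p \<inter> y | p. p \<in> u} - {{}}"

definition NCP_1_1 :: "nat \<Rightarrow> complex set set set" where
  "NCP_1_1 n = NCP (mu n)"

definition NCP_e_1 :: "nat \<Rightarrow> nat \<Rightarrow> complex set set set" where
  "NCP_e_1 e n = {u \<in> NCP (mu (e * n)). \<forall>\<zeta>\<in>mu e. (\<lambda>p. (\<lambda>z. \<zeta> * z) ` p) ` u = u}"

text \<open>\<open>NCP_e_e e n\<close> is $NCP(e,e,n+1)$: the third parameter is shifted by one.\<close>

definition NCP_e_e :: "nat \<Rightarrow> nat \<Rightarrow> complex set set set" where
  "NCP_e_e e n =
     {u \<in> NCP (mu (e * n) \<union> {0}). restrict_partition u (mu (e * n)) \<in> NCP_e_1 e n}"

text \<open>
  Chains are weakly increasing sequences, and \<open>zeta P le X\<close> counts those with \<open>X - 1\<close> terms.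
  It is meaningful for finite \<open>P\<close> and positive \<open>X\<close>; the subtraction truncates at \<open>X = 0\<close>.
\<close>

definition chains :: "'a set \<Rightarrow> ('a \<Rightarrow> 'a \<Rightarrow> bool) \<Rightarrow> nat \<Rightarrow> 'a list set" where
  "chains P le N = {ps. length ps = N \<and> set ps \<subseteq> P \<and> sorted_wrt le ps}"

definition zeta :: "'a set \<Rightarrow> ('a \<Rightarrow> 'a \<Rightarrow> bool) \<Rightarrow> nat \<Rightarrow> nat" where
  "zeta P le X = card (chains P le (X - 1))"

end

theory Submission
  imports Defs
begin

text \<open>
  Index the roots of unity by the integers. An invariant noncrossing partition of the $en$-th
  roots of unity becomes an $n$-periodic noncrossing equivalence relation on the integers, in
  which the central part, if any, is the only infinite class; this does not depend on $e$. Such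
  a relation is encoded by the $n$-periodic function $b$ whose value at the first element of a
  finite class is the size of that class, and $0$ elsewhere: reading $b_i$ as $b_i$ openers
  followed by one closer, the relation is recovered by matching parentheses, so the codes are
  exactly the periodic $b$ with at most $n$ openers per period, and the central class consists
  of the unmatched closers. Refining a partition means replacing the code on every finite class
  by a ballot sequence and on the central class by an arbitrary sequence with not too many
  openers. Hence the numbers of chains below the elements satisfy a recursion that factorizes
  over the classes, and is solved by Raney numbers and Vandermonde-type convolutions. For type
  $(e,e)$, attaching the centre to a visible class adds one opener to that class; by the cycle
  lemma, each code with $n+1$ openers arises in this way from exactly one class, up to rotation.
\<close>

text \<open>Every further link of a chain raises a level. The number of chains of length m below u
  is a product: each finite class, of size k and taken up to translation by n, contributes
  \<open>fuss (Suc m) k\<close>, and a central class with k elements per period contributes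
  \<open>Suc m * k choose k\<close>. Summing products of level \<open>Suc m\<close> over the
  refinements of one finite class, that is over ballot sequences, gives a Fuss-Catalan number of the
  next level. A class of size k joined to the origin counts like a class of size k + 1, so the same
  product is taken for the code with one more opener. Below an element whose origin is not joined to
  a finite class, the joined refinements bring in a second binomial coefficient; its factor e counts
  the translates of a class that give different parts. The condition e \<ge> 2 keeps each noncentral
  part on less than half of the circle, hence its hull away from the origin. With e = 1 this fails,
  and NCP(1,1,n) is obtained instead as the set of codes below the one whose classes are the windows
  of n consecutive integers.\<close>

section \<open>Raney numbers and ballot sequences\<close>

text \<open>\<open>raney t n r\<close> is the coefficient of $x^n$ in $B^r$, where $B = 1 + x B^t$.\<close>

fun raney :: "nat \<Rightarrow> nat \<Rightarrow> nat \<Rightarrow> nat" where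
  "raney t 0 r = 1"
| "raney t (Suc n) 0 = 0"
| "raney t (Suc n) (Suc r) = raney t (Suc n) r + raney t n (r + t)"

lemma raney_0_right: "raney t n 0 = (if n = 0 then 1 else 0)"
  by (cases n) auto

text \<open>Fuss-Catalan numbers. For positive n, \<open>fuss (Suc m) n\<close> turns out to be the
  number of chains of length m in NCP(1,1,n).\<close>

definition fuss :: "nat \<Rightarrow> nat \<Rightarrow> nat" where
  "fuss t k = raney t k 1"

lemma fuss_0 [simp]: "fuss t 0 = 1" and fuss_1 [simp]: "fuss t (Suc 0) = 1"
  by (simp_all add: fuss_def)

text \<open>Coefficients of B^r B^s = B^(r+s). The recursion of \<open>raney\<close> reads B^(r+1) =
  B^r + x B^(r+t), which is why an induction on r runs inside the one on n, here and in the
  following convolutions.\<close>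

lemma raney_convolution:
  "(\<Sum>k\<le>n. raney t k r * raney t (n - k) s) = raney t n (r + s)"
proof (induction n arbitrary: r)
  case 0
  show ?case by simp
next
  case (Suc n)
  show ?case
  proof (induction r)
    case 0
    show ?case by (simp add: sum.atMost_Suc_shift raney_0_right del: sum.atMost_Suc)
  next
    case (Suc r)
    have "(\<Sum>k\<le>Suc n. raney t k (Suc r) * raney t (Suc n - k) s)
        = (\<Sum>k\<le>Suc n. raney t k r * raney t (Suc n - k) s)
        + (\<Sum>k\<le>n. raney t k (r + t) * raney t (n - k) s)"
      by (simp add: sum.atMost_Suc_shift sum.distrib algebra_simps del: sum.atMost_Suc)
    also have "\<dots> = raney t (Suc n) (r + s) + raney t n (r + t + s)"
      by (simp only: Suc.IH \<open>\<And>r. (\<Sum>k\<le>n. raney t k r * raney t (n - k) s) = raney t n (r + s)\<close>)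
    finally show ?case by (simp add: add_ac)
  qed
qed

text \<open>Let C be the series of level t + 1. From C = 1 + (x C) C^t follows C(x) = B(x C(x)), and
  the sum is the coefficient of x^n in C^j B(x C)^r = C^(j+r). This identity carries all passages
  from level t to level t + 1.\<close>

lemma raney_convolution_level:
  "(\<Sum>k\<le>n. raney t k r * raney (Suc t) (n - k) (j + k)) = raney (Suc t) n (j + r)"
proof (induction n arbitrary: r j)
  case 0
  show ?case by simp
next
  case (Suc n)
  note IH = Suc.IH
  show ?case
  proof (induction r)
    case 0
    show ?case by (simp add: sum.atMost_Suc_shift raney_0_right del: sum.atMost_Suc)
  next
    case (Suc r)
    have "(\<Sum>k\<le>Suc n. raney t k (Suc r) * raney (Suc t) (Suc n - k) (j + k))
        = (\<Sum>k\<le>Suc n. raney t k r * raney (Suc t) (Suc n - k) (j + k))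
        + (\<Sum>k\<le>n. raney t k (r + t) * raney (Suc t) (n - k) (Suc j + k))"
      by (simp add: sum.atMost_Suc_shift sum.distrib algebra_simps del: sum.atMost_Suc)
    also have "\<dots> = raney (Suc t) (Suc n) (j + r) + raney (Suc t) n (Suc j + (r + t))"
      by (simp only: Suc.IH IH)
    finally show ?case by (simp add: add_ac)
  qed
qed

text \<open>Both sides satisfy the same recursion in r: Pascal's rule for
  \<open>t * Suc n + Suc r choose Suc n\<close> has the shape of the recursion of
  \<open>raney\<close>. It will sum over the number of openers placed on a central class.\<close>

lemma raney_binomial_convolution:
  "(\<Sum>k\<le>n. raney t k r * (t * (n - k) choose (n - k))) = (t * n + r choose n)"
proof (induction n arbitrary: r)
  case 0
  show ?case by simp
next
  case (Suc n)
  note IH = Suc.IH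
  show ?case
  proof (induction r)
    case 0
    show ?case by (simp add: sum.atMost_Suc_shift raney_0_right del: sum.atMost_Suc)
  next
    case (Suc r)
    have "(\<Sum>k\<le>Suc n. raney t k (Suc r) * (t * (Suc n - k) choose (Suc n - k)))
        = (\<Sum>k\<le>Suc n. raney t k r * (t * (Suc n - k) choose (Suc n - k)))
        + (\<Sum>k\<le>n. raney t k (r + t) * (t * (n - k) choose (n - k)))"
      by (simp add: sum.atMost_Suc_shift sum.distrib algebra_simps del: sum.atMost_Suc)
    also have "\<dots> = (t * Suc n + r choose Suc n) + (t * n + (r + t) choose n)"
      by (simp only: Suc.IH IH)
    also have "\<dots> = (t * Suc n + Suc r choose Suc n)"
      by (simp add: add_ac)
    finally show ?case .
  qed
qed

text \<open>The separate summand is the term k = n + 1, in which the lower index reaches 0 and the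
  upper one would be -t. In type (e,e) it is supplied by the partitions whose origin is joined to a
  noncentral part.\<close>

lemma raney_binomial_convolution':
  "(\<Sum>k\<le>n. raney t k r * (t * (n - k) choose Suc (n - k))) + raney t (Suc n) r
   = (t * n + r choose Suc n)"
proof (induction n arbitrary: r)
  case 0
  show ?case by (induction r) auto
next
  case (Suc n)
  note IH = Suc.IH
  show ?case
  proof (induction r)
    case 0
    show ?case by (simp add: sum.atMost_Suc_shift raney_0_right del: sum.atMost_Suc)
  next
    case (Suc r)
    have "(\<Sum>k\<le>Suc n. raney t k (Suc r) * (t * (Suc n - k) choose Suc (Suc n - k)))
           + raney t (Suc (Suc n)) (Suc r)
        = ((\<Sum>k\<le>Suc n. raney t k r * (t * (Suc n - k) choose Suc (Suc n - k))) + raney t (Suc (Suc n)) r)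
        + ((\<Sum>k\<le>n. raney t k (r + t) * (t * (n - k) choose Suc (n - k))) + raney t (Suc n) (r + t))"
      by (simp add: sum.atMost_Suc_shift sum.distrib algebra_simps del: sum.atMost_Suc binomial_Suc_Suc)
    also have "\<dots> = (t * Suc n + r choose Suc (Suc n)) + (t * n + (r + t) choose Suc n)"
      by (simp only: Suc.IH IH)
    also have "\<dots> = (t * Suc n + Suc r choose Suc (Suc n))"
      by (simp add: add_ac)
    finally show ?case .
  qed
qed

text \<open>With T = t + 1 and N = n + 1 this is the closed form r / (T N + r) * (T N + r choose N),
  freed of division and subtraction: the coefficient with both indices lowered by 1 is N / (T N + r)
  times the one on the right.\<close>

lemma raney_Suc_binomial:
  "raney (Suc t) (Suc n) r + Suc t * (Suc t * n + t + r choose n) = (Suc t * Suc n + r choose Suc n)"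
proof (induction n arbitrary: r)
  case 0
  show ?case by (induction r) auto
next
  case (Suc n)
  note IH = Suc.IH
  show ?case
  proof (induction r)
    case 0
    have "Suc (Suc n) * (Suc t * Suc (Suc n) choose Suc (Suc n))
        = Suc (Suc n) * (Suc t * (Suc t * Suc n + t choose Suc n))"
    proof -
      have M: "Suc t * Suc (Suc n) = Suc (Suc t * Suc n + t)" by simp
      have "Suc (Suc n) * (Suc t * Suc (Suc n) choose Suc (Suc n))
          = (Suc t * Suc (Suc n)) * (Suc t * Suc n + t choose Suc n)"
        using Suc_times_binomial_eq[of "Suc t * Suc n + t" "Suc n"] unfolding M[symmetric]
        by (metis mult.commute)
      then show ?thesis by (metis mult.assoc mult.commute)
    qed
    then show ?case by (simp only: mult_cancel1 raney.simps add_0_right add_0_left) simp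
  next
    case (Suc r)
    define M where "M = Suc t * Suc n + t + r"
    have M: "Suc t * Suc n + t + Suc r = Suc M" "Suc t * n + t + (r + Suc t) = M"
      "Suc t * Suc (Suc n) + Suc r = Suc (Suc M)" "Suc t * Suc (Suc n) + r = Suc M"
      "Suc t * Suc n + (r + Suc t) = Suc M"
      by (simp_all add: M_def)
    have 1: "raney (Suc t) (Suc (Suc n)) r + Suc t * (M choose Suc n) = (Suc M choose Suc (Suc n))"
      using Suc.IH unfolding M M_def[symmetric] .
    have 2: "raney (Suc t) (Suc n) (r + Suc t) + Suc t * (M choose n) = (Suc M choose Suc n)"
      using IH[of "r + Suc t"] unfolding M .
    have "Suc t * (Suc M choose Suc n) = Suc t * (M choose n) + Suc t * (M choose Suc n)"
      by (simp only: binomial_Suc_Suc distrib_left)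
    moreover have "(Suc (Suc M) choose Suc (Suc n)) = (Suc M choose Suc n) + (Suc M choose Suc (Suc n))"
      by (rule binomial_Suc_Suc)
    ultimately show ?case
      unfolding M raney.simps(3) using 1 2 by linarith
  qed
qed

text \<open>The case r = 1 of the closed form; the coefficient c with lower index n - 1 is
  eliminated through the absorption identity n * (Suc m * n choose n) = (m * n + 1) * c.\<close>

lemma fuss_closed_form: "(m * n + 1) * fuss (Suc m) n = (Suc m * n choose n)"
proof (cases n)
  case (Suc k)
  define c where "c = (Suc m * n choose k)"
  have 1: "fuss (Suc m) n + Suc m * c = (Suc m * n choose n) + c"
  proof -
    have "Suc m * k + m + 1 = Suc m * n" "Suc m * n + 1 = Suc (Suc m * n)" by (simp_all add: Suc)
    then have "fuss (Suc m) n + Suc m * c = (Suc (Suc m * n) choose Suc k)"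
      using raney_Suc_binomial[of m k 1] by (simp only: fuss_def Suc c_def)
    then show ?thesis by (simp only: binomial_Suc_Suc c_def Suc add.commute)
  qed
  have "n * (Suc m * n choose n) = (Suc m * n - k) * c"
    unfolding Suc c_def binomial_absorption binomial_absorb_comp ..
  then have 2: "n * (Suc m * n choose n) = (m * n + 1) * c"
  proof -
    have "Suc m * n - k = m * n + 1" by (simp add: Suc)
    then show ?thesis using \<open>n * (Suc m * n choose n) = (Suc m * n - k) * c\<close> by (simp only:)
  qed
  have "(m * n + 1) * fuss (Suc m) n + (m * n + 1) * (Suc m * c) = (m * n + 1) * (Suc m * n choose n) + n * (Suc m * n choose n)"
    unfolding 2 distrib_left[symmetric] 1 ..
  moreover have "(m * n + 1) * (Suc m * c) = Suc m * (n * (Suc m * n choose n))"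
    unfolding 2 by (simp only: ac_simps)
  ultimately show ?thesis by (simp only: distrib_right distrib_left Suc_eq_plus1 mult_1 mult_1_right)
qed simp

section \<open>Compositions and ballot sequences, weighted by Fuss-Catalan numbers\<close>

definition comps :: "nat \<Rightarrow> nat \<Rightarrow> nat list set" where
  "comps k j = {ws. length ws = k \<and> sum_list ws = j}"

text \<open>For j = k every opener finds its closer, and these are codes of noncrossing partitions
  of k points. For j = k + 1 one opener is left over; it serves a class that is joined to the
  origin.\<close>

definition ballots :: "nat \<Rightarrow> nat \<Rightarrow> nat list set" where
  "ballots k j = {ws \<in> comps k j. \<forall>i\<le>k. i \<le> sum_list (take i ws)}"

definition weight :: "(nat \<Rightarrow> nat) \<Rightarrow> nat list \<Rightarrow> nat" where
  "weight f ws = prod_list (map f ws)"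

lemma weight_simps [simp]: "weight f [] = 1" "weight f (w # ws) = f w * weight f ws"
  "weight f (us @ ws) = weight f us * weight f ws"
  by (simp_all add: weight_def)

lemma finite_comps [simp]: "finite (comps k j)"
proof (rule finite_subset)
  show "comps k j \<subseteq> {ws. set ws \<subseteq> {..j} \<and> length ws = k}"
    using member_le_sum_list by (fastforce simp: comps_def)
qed (simp add: finite_lists_length_eq)

lemma finite_ballots [simp]: "finite (ballots k j)"
  by (simp add: ballots_def)

lemma comps_Suc: "comps (Suc k) j = (\<Union>w\<le>j. (#) w ` comps k (j - w))"
proof (intro set_eqI iffI)
  fix ws assume "ws \<in> comps (Suc k) j"
  then obtain w us where "ws = w # us" "length us = k" "w + sum_list us = j"
    by (auto simp: comps_def length_Suc_conv)
  then show "ws \<in> (\<Union>w\<le>j. (#) w ` comps k (j - w))"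
    by (auto simp: comps_def intro!: bexI[of _ w])
qed (auto simp: comps_def)

text \<open>The coefficient of x^j in B^k, expanded as a product of k factors B.\<close>

lemma comps_weight: "(\<Sum>ws\<in>comps k j. weight (fuss t) ws) = raney t j k"
proof (induction k arbitrary: j)
  case 0
  have "comps 0 j = (if j = 0 then {[]} else {})" by (auto simp: comps_def)
  then show ?case by (cases j) auto
next
  case (Suc k)
  have "(\<Sum>ws\<in>comps (Suc k) j. weight (fuss t) ws)
      = (\<Sum>w\<le>j. \<Sum>ws\<in>(#) w ` comps k (j - w). weight (fuss t) ws)"
    unfolding comps_Suc by (rule sum.UNION_disjoint) auto
  also have "\<dots> = (\<Sum>w\<le>j. fuss t w * raney t (j - w) k)"
    by (simp add: sum.reindex sum_distrib_left[symmetric] Suc.IH)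
  also have "\<dots> = raney t j (Suc k)"
    using raney_convolution[where r=1 and s=k and n=j] by (simp add: fuss_def)
  finally show ?case .
qed

text \<open>The parameter \<open>h\<close> is the height at which the walk starts.\<close>

definition ballots_from :: "nat \<Rightarrow> nat \<Rightarrow> nat list set" where
  "ballots_from h k = {ws. length ws = k \<and> h + sum_list ws = k \<and> (\<forall>i\<le>k. i \<le> h + sum_list (take i ws))}"

lemma finite_ballots_from [simp]: "finite (ballots_from h k)"
  by (rule finite_subset[OF _ finite_comps[of k "k - h"]]) (auto simp: ballots_from_def comps_def)

lemma ballots_from_Suc:
  "ballots_from h (Suc k) = (\<Union>w\<in>{w. w \<le> Suc k - h \<and> h \<le> Suc k \<and> 1 \<le> h + w}. (#) w ` ballots_from (h + w - 1) k)"
proof (intro set_eqI iffI)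
  fix ws assume ws: "ws \<in> ballots_from h (Suc k)"
  then obtain w us where wu: "ws = w # us" "length us = k" "h + w + sum_list us = Suc k"
    by (auto simp: ballots_from_def length_Suc_conv)
  have p: "i \<le> h + sum_list (take i ws)" if "i \<le> Suc k" for i
    using ws that by (auto simp: ballots_from_def)
  have "1 \<le> h + w" using p[of 1] wu by simp
  moreover have "i \<le> h + w - 1 + sum_list (take i us)" if "i \<le> k" for i
    using p[of "Suc i"] that wu \<open>1 \<le> h + w\<close> by simp
  ultimately have "us \<in> ballots_from (h + w - 1) k" "w \<le> Suc k - h" "h \<le> Suc k" "1 \<le> h + w"
    using wu by (auto simp: ballots_from_def)
  then show "ws \<in> (\<Union>w\<in>{w. w \<le> Suc k - h \<and> h \<le> Suc k \<and> 1 \<le> h + w}. (#) w ` ballots_from (h + w - 1) k)"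
    using wu(1) by blast
next
  fix ws assume "ws \<in> (\<Union>w\<in>{w. w \<le> Suc k - h \<and> h \<le> Suc k \<and> 1 \<le> h + w}. (#) w ` ballots_from (h + w - 1) k)"
  then obtain w us where w: "ws = w # us" "us \<in> ballots_from (h + w - 1) k" "1 \<le> h + w" by auto
  then have "i \<le> h + sum_list (take i ws)" if "i \<le> Suc k" for i
  proof (cases i)
    case (Suc i')
    then have "i' \<le> h + w - 1 + sum_list (take i' us)" using that w by (auto simp: ballots_from_def)
    then show ?thesis using Suc w by simp
  qed simp
  then show "ws \<in> ballots_from h (Suc k)"
    using w by (auto simp: ballots_from_def)
qed

text \<open>Splitting off the first entry w leaves a walk from height h + w - 1, and the sum over w
  is \<open>raney_convolution_level\<close> with r = 1 and j = h.\<close>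

lemma ballots_from_weight:
  "(\<Sum>ws\<in>ballots_from h k. weight (fuss t) ws)
   = (if h \<le> k then raney (Suc t) (k - h) (Suc h) else 0)"
proof (induction k arbitrary: h)
  case 0
  have "ballots_from h 0 = (if h = 0 then {[]} else {})" by (auto simp: ballots_from_def)
  then show ?case by auto
next
  case (Suc k)
  let ?F = "fuss t"
  let ?I = "{w. w \<le> Suc k - h \<and> h \<le> Suc k \<and> 1 \<le> h + w}"
  have fin: "finite ?I" by (rule finite_subset[of _ "{..Suc k}"]) auto
  have "(\<Sum>ws\<in>ballots_from h (Suc k). weight ?F ws)
      = (\<Sum>w\<in>?I. \<Sum>ws\<in>(#) w ` ballots_from (h + w - 1) k. weight ?F ws)"
    unfolding ballots_from_Suc by (rule sum.UNION_disjoint) (use fin in auto)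
  also have "\<dots> = (\<Sum>w\<in>?I. ?F w * (\<Sum>ws\<in>ballots_from (h + w - 1) k. weight ?F ws))"
    by (simp add: sum.reindex sum_distrib_left[symmetric])
  also have "\<dots> = (\<Sum>w\<in>?I. ?F w * raney (Suc t) (Suc k - h - w) (h + w))"
  proof (rule sum.cong, goal_cases)
    case (2 w)
    then obtain y where "h + w = Suc y" by (cases "h + w") auto
    moreover from this 2 have "Suc k - h - w = k - y" by auto
    ultimately show ?case using 2 by (auto simp: Suc.IH simp del: raney.simps)
  qed simp
  also have "\<dots> = (if h \<le> Suc k then raney (Suc t) (Suc k - h) (Suc h) else 0)"
  proof (cases "h \<le> Suc k")
    case True
    have "(\<Sum>w\<in>?I. ?F w * raney (Suc t) (Suc k - h - w) (h + w))
        = (\<Sum>w\<le>Suc k - h. ?F w * raney (Suc t) (Suc k - h - w) (h + w))"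
    \<comment> \<open>The only index missing from \<open>?I\<close> has h + w = 0. It may be added
      because \<open>raney\<close> with a positive second and a zero third argument is 0.\<close>
    proof (rule sum.mono_neutral_left)
      show "\<forall>w\<in>{..Suc k - h} - ?I. ?F w * raney (Suc t) (Suc k - h - w) (h + w) = 0"
      proof
        fix w assume "w \<in> {..Suc k - h} - ?I"
        then have "h + w = 0" using True by auto
        then show "?F w * raney (Suc t) (Suc k - h - w) (h + w) = 0" by simp
      qed
    qed (use True in auto)
    also have "\<dots> = raney (Suc t) (Suc k - h) (h + 1)"
      unfolding fuss_def by (rule raney_convolution_level)
    finally show ?thesis using True by simp
  qed auto
  finally show ?case .
qed

text \<open>The rise of the level for one finite class of size k: its refinements correspond to
  \<open>ballots k k\<close>.\<close>

lemma ballots_weight: "(\<Sum>ws\<in>ballots k k. weight (fuss t) ws) = fuss (Suc t) k"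
proof -
  have "ballots k k = ballots_from 0 k" by (auto simp: ballots_def ballots_from_def comps_def)
  then show ?thesis by (simp add: ballots_from_weight fuss_def)
qed

text \<open>In a ballot sequence of length and sum k + 1 the first k entries already sum to at least
  k, so the last entry is 1 or 0; removing it gives the two sums. Hence a class of size k that may
  be joined to the origin counts like a class of size k + 1.\<close>

lemma ballots_Suc_weight:
  "(\<Sum>ws\<in>ballots k k. weight (fuss t) ws) + (\<Sum>ws\<in>ballots k (Suc k). weight (fuss t) ws)
   = fuss (Suc t) (Suc k)"
proof -
  let ?F = "fuss t"
  have "ballots (Suc k) (Suc k) = (\<lambda>ws. ws @ [1]) ` ballots k k \<union> (\<lambda>ws. ws @ [0]) ` ballots k (Suc k)"
  proof (intro set_eqI iffI)
    fix ws assume ws: "ws \<in> ballots (Suc k) (Suc k)"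
    then obtain us w where uw: "ws = us @ [w]" "length us = k"
      by (auto simp: ballots_def comps_def length_Suc_conv_rev)
    have p: "i \<le> sum_list (take i us)" if "i \<le> k" for i
      using ws uw that unfolding ballots_def by (auto dest: spec[of _ i])
    have "sum_list us + w = Suc k" using ws uw by (auto simp: ballots_def comps_def)
    moreover have "k \<le> sum_list us" using p[of k] uw by simp
    ultimately show "ws \<in> (\<lambda>ws. ws @ [1]) ` ballots k k \<union> (\<lambda>ws. ws @ [0]) ` ballots k (Suc k)"
      using p uw by (cases "w = 0") (auto simp: ballots_def comps_def)
  qed (auto simp: ballots_def comps_def le_Suc_eq)
  moreover have "(\<lambda>ws. ws @ [1]) ` ballots k k \<inter> (\<lambda>ws. ws @ [0]) ` ballots k (Suc k) = {}" by auto
  ultimately have "(\<Sum>ws\<in>ballots (Suc k) (Suc k). weight ?F ws)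
      = (\<Sum>ws\<in>(\<lambda>ws. ws @ [1]) ` ballots k k. weight ?F ws)
      + (\<Sum>ws\<in>(\<lambda>ws. ws @ [0]) ` ballots k (Suc k). weight ?F ws)"
    by (simp add: sum.union_disjoint)
  also have "\<dots> = (\<Sum>ws\<in>ballots k k. weight ?F ws) + (\<Sum>ws\<in>ballots k (Suc k). weight ?F ws)"
    by (simp add: sum.reindex inj_on_def)
  finally show ?thesis by (simp add: ballots_weight)
qed

section \<open>Periodic walks and periodic noncrossing relations\<close>

text \<open>Openers minus closers at the positions from i to j - 1: the height gained by the walk
  there.\<close>

definition drift :: "(int \<Rightarrow> nat) \<Rightarrow> int \<Rightarrow> int \<Rightarrow> int" where
  "drift b i j = (\<Sum>t\<in>{i..<j}. int (b t) - 1)"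

lemma drift_self [simp]: "drift b i i = 0"
  by (simp add: drift_def)

lemma drift_add: "i \<le> j \<Longrightarrow> j \<le> k \<Longrightarrow> drift b i k = drift b i j + drift b j k"
  unfolding drift_def
  by (subst sum.union_disjoint[symmetric]) (auto simp: ivl_disj_un)

lemma drift_step [simp]: "drift b i (i + 1) = int (b i) - 1"
proof -
  have "{i..<i + 1} = {i}" by auto
  then show ?thesis by (simp add: drift_def)
qed

lemma drift_Suc: "i \<le> j \<Longrightarrow> drift b i (j + 1) = drift b i j + int (b j) - 1"
  using drift_add[of i j "j + 1" b] by simp

lemma drift_eq_sum: "t \<le> i + 1 \<Longrightarrow> drift b t (i + 1) = int (\<Sum>x\<in>{t..i}. b x) - (i + 1 - t)"
proof -
  assume "t \<le> i + 1"
  moreover have "{t..<i + 1} = {t..i}" by auto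
  ultimately show ?thesis by (simp add: drift_def sum_subtractf)
qed

definition periodic :: "nat \<Rightarrow> (int \<Rightarrow> nat) \<Rightarrow> bool" where
  "periodic n b \<longleftrightarrow> (\<forall>i. b (i + int n) = b i)"

lemma periodic_mult: 
  assumes "periodic n b" shows "b (i + int n * k) = b i"
proof (induction k rule: int_induct[of _ 0])
  case (step1 k)
  then show ?case using assms by (metis add.assoc distrib_left mult.right_neutral periodic_def)
next
  case (step2 k)
  have "b (i + int n * (k - 1)) = b (i + int n * (k - 1) + int n)"
    using assms by (simp add: periodic_def)
  then show ?case using step2 by (simp add: algebra_simps)
qed simp

lemma periodic_cong: "periodic n b \<Longrightarrow> i mod int n = j mod int n \<Longrightarrow> b i = b j"
  by (metis mod_eqE periodic_mult)

lemma drift_shift: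
  assumes "periodic n b" shows "drift b (i + int n * k) (j + int n * k) = drift b i j"
  unfolding drift_def
proof (rule sum.reindex_bij_witness[of _ "\<lambda>t. t + int n * k" "\<lambda>t. t - int n * k"])
  show "int (b (t - int n * k)) - 1 = int (b t) - 1" for t
    using periodic_mult[OF assms, of "t - int n * k" k] by simp
qed auto

definition mass :: "nat \<Rightarrow> (int \<Rightarrow> nat) \<Rightarrow> nat" where
  "mass n b = (\<Sum>i\<in>{0..<int n}. b i)"

lemma drift_0_period: "drift b 0 (int n) = int (mass n b) - int n"
  by (simp add: drift_def mass_def sum_subtractf)

lemma drift_period:
  assumes "periodic n b" "n > 0" shows "drift b i (i + int n) = int (mass n b) - int n"
proof -
  define r where "r = i mod int n"
  have r: "0 \<le> r" "r < int n" using assms(2) by (simp_all add: r_def)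
  have i: "i = r + int n * (i div int n)" by (simp add: r_def)
  have "drift b i (i + int n) = drift b r (r + int n)"
    using drift_shift[OF assms(1), of r "i div int n" "r + int n"] i
    by (metis add.assoc add.commute)
  also have "\<dots> = drift b r (int n) + drift b (int n) (r + int n)"
    using r by (intro drift_add) auto
  also have "drift b (int n) (r + int n) = drift b 0 r"
    using drift_shift[OF assms(1), of 0 1 r] by simp
  also have "drift b r (int n) + drift b 0 r = drift b 0 (int n)"
    using r drift_add[of 0 r "int n" b] by simp
  finally show ?thesis by (simp add: drift_0_period)
qed

text \<open>The closer at i belongs to an opener at s: going left from i, s is the first position
  from which the openers suffice for the closers. The end point is i + 1 because the openers at a
  position precede its closer.\<close>

definition matched :: "(int \<Rightarrow> nat) \<Rightarrow> int \<Rightarrow> int \<Rightarrow> bool" where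
  "matched b s i \<longleftrightarrow> s \<le> i \<and> 0 \<le> drift b s (i + 1) \<and> (\<forall>t. s < t \<longrightarrow> t \<le> i \<longrightarrow> drift b t (i + 1) < 0)"

lemma matched_le: "matched b s i \<Longrightarrow> s \<le> i"
  by (simp add: matched_def)

lemma matched_unique: "matched b s i \<Longrightarrow> matched b s' i \<Longrightarrow> s = s'"
  unfolding matched_def by (meson linorder_neqE not_le)

lemma matched_exists:
  assumes "t \<le> i" "0 \<le> drift b t (i + 1)" shows "\<exists>s\<ge>t. matched b s i"
proof -
  let ?A = "{s\<in>{t..i}. 0 \<le> drift b s (i + 1)}"
  have A: "finite ?A" "t \<in> ?A" using assms by (auto intro: finite_subset[of _ "{t..i}"])
  then have M: "Max ?A \<in> ?A" by (intro Max_in) auto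
  have "drift b s (i + 1) < 0" if "Max ?A < s" "s \<le> i" for s
  proof (rule ccontr)
    assume "\<not> drift b s (i + 1) < 0"
    then have "s \<in> ?A" using that M by auto
    then show False using A that Max_ge[of ?A s] by linarith
  qed
  then have "matched b (Max ?A) i" using M by (auto simp: matched_def)
  then show ?thesis using M by (intro exI[of _ "Max ?A"]) auto
qed

lemma matched_refl_iff: "matched b s s \<longleftrightarrow> b s \<ge> 1"
  by (auto simp: matched_def)

text \<open>The walk from s + 1 ends below its starting level while the walk from s does not, so
  there are openers at s. Thus s itself is the first element of the class of i.\<close>

lemma matched_start: "matched b s i \<Longrightarrow> matched b s s"
proof -
  assume m: "matched b s i"
  then have "s \<le> i" by (simp add: matched_def)
  then consider "s = i" | "s < i" by linarith
  then show ?thesis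
  proof cases
    case 2
    then have "drift b (s + 1) (i + 1) < 0" "drift b s (i + 1) \<ge> 0" using m by (auto simp: matched_def)
    moreover have "drift b s (i + 1) = drift b s (s + 1) + drift b (s + 1) (i + 1)"
      using 2 by (intro drift_add) auto
    ultimately show ?thesis by (simp add: matched_refl_iff)
  qed (use m in simp)
qed

lemma matched_shift:
  assumes "periodic n b" shows "matched b (s + int n * k) (i + int n * k) \<longleftrightarrow> matched b s i"
proof -
  have d: "drift b (t + int n * k) (i + int n * k + 1) = drift b t (i + 1)" for t
    using drift_shift[OF assms, of t k "i + 1"] by (simp add: algebra_simps)
  show ?thesis
    unfolding matched_def
  proof (intro conj_cong)
    show "(\<forall>t. s + int n * k < t \<longrightarrow> t \<le> i + int n * k \<longrightarrow> drift b t (i + int n * k + 1) < 0) \<longleftrightarrow>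
          (\<forall>t. s < t \<longrightarrow> t \<le> i \<longrightarrow> drift b t (i + 1) < 0)"
    proof safe
      fix t assume "\<forall>t. s + int n * k < t \<longrightarrow> t \<le> i + int n * k \<longrightarrow> drift b t (i + int n * k + 1) < 0" "s < t" "t \<le> i"
      then show "drift b t (i + 1) < 0" by (metis d add_less_cancel_right add_le_cancel_right)
    next
      fix t assume "\<forall>t. s < t \<longrightarrow> t \<le> i \<longrightarrow> drift b t (i + 1) < 0" "s + int n * k < t" "t \<le> i + int n * k"
      then show "drift b t (i + int n * k + 1) < 0" using d[of "t - int n * k"] by auto
    qed
  qed (simp_all add: d)
qed

text \<open>Positions with unmatched closers are related to each other as well; they make up the
  central class.\<close>

definition rel :: "(int \<Rightarrow> nat) \<Rightarrow> int \<Rightarrow> int \<Rightarrow> bool" where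
  "rel b i j \<longleftrightarrow> (\<forall>s. matched b s i \<longleftrightarrow> matched b s j)"

definition central :: "(int \<Rightarrow> nat) \<Rightarrow> int \<Rightarrow> bool" where
  "central b i \<longleftrightarrow> (\<forall>s. \<not> matched b s i)"

lemma central_drift: "central b i \<Longrightarrow> t \<le> i \<Longrightarrow> drift b t (i + 1) < 0"
  using matched_exists[of t i b] by (force simp: central_def)

lemma rel_matched: "matched b s i \<Longrightarrow> rel b i j \<longleftrightarrow> matched b s j"
  unfolding rel_def using matched_unique by blast

lemma rel_central: "central b i \<Longrightarrow> rel b i j \<longleftrightarrow> central b j"
  unfolding rel_def central_def by blast

lemma central_shift: "periodic n b \<Longrightarrow> central b (i + int n * k) \<longleftrightarrow> central b i"
  unfolding central_def
  by (metis matched_shift diff_add_cancel)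

text \<open>If s' < s, then the walk would descend from s to j + 1 and again from j + 1 to i + 1,
  although it does not descend from s to i + 1.\<close>

lemma matched_nested:
  assumes "matched b s i" "matched b s' j" "s < j" "j < i"  shows "s \<le> s'"
proof (rule ccontr)
  assume "\<not> s \<le> s'"
  then have "drift b s (j + 1) < 0" using assms by (auto simp: matched_def)
  moreover have "drift b s (i + 1) = drift b s (j + 1) + drift b (j + 1) (i + 1)"
    using assms by (intro drift_add) auto
  moreover have "drift b (j + 1) (i + 1) < 0" "0 \<le> drift b s (i + 1)" using assms by (auto simp: matched_def)
  ultimately show False by linarith
qed

lemma central_not_nested: "matched b s i \<Longrightarrow> central b j \<Longrightarrow> s < j \<Longrightarrow> \<not> j < i"
proof
  assume a: "matched b s i" "central b j" "s < j" "j < i"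
  have "drift b s (i + 1) = drift b s (j + 1) + drift b (j + 1) (i + 1)"
    using a by (intro drift_add) auto
  moreover have "drift b (j + 1) (i + 1) < 0" "0 \<le> drift b s (i + 1)" using a by (auto simp: matched_def)
  moreover have "drift b s (j + 1) < 0" using a by (intro central_drift) auto
  ultimately show False by linarith
qed

definition ncrel :: "nat \<Rightarrow> (int \<Rightarrow> int \<Rightarrow> bool) \<Rightarrow> bool" where
  "ncrel n R \<longleftrightarrow> equivp R \<and> (\<forall>i j. R (i + int n) (j + int n) \<longleftrightarrow> R i j) \<and>
     (\<forall>i j k l. i < j \<longrightarrow> j < k \<longrightarrow> k < l \<longrightarrow> R i k \<longrightarrow> R j l \<longrightarrow> R i j)"

lemma ncrel_rel:
  assumes "periodic n b" shows "ncrel n (rel b)"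
  unfolding ncrel_def
proof (intro conjI allI impI)
  show "equivp (rel b)" by (rule equivpI) (auto simp: rel_def reflp_def symp_def transp_def)
  show "rel b (i + int n) (j + int n) \<longleftrightarrow> rel b i j" for i j
    unfolding rel_def using matched_shift[OF assms, of _ 1] by (metis diff_add_cancel mult.right_neutral)
next
  fix i j k l assume *: "i < j" "j < k" "k < l" "rel b i k" "rel b j l"
  show "rel b i j"
  proof (cases "central b i")
    case True
    then have "central b k" using * rel_central by blast
    have "central b j"
    proof (rule ccontr)
      assume "\<not> central b j"
      then obtain s where s: "matched b s j" by (auto simp: central_def)
      then have "matched b s l" using * rel_matched by blast
      then show False using central_not_nested[of b s l k] \<open>central b k\<close> s * by (auto simp: matched_def)
    qed
    then show ?thesis using True rel_central by blast
  next
    case False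
    then obtain s where s: "matched b s i" by (auto simp: central_def)
    then have sk: "matched b s k" using * rel_matched by blast
    show ?thesis
    proof (cases "central b j")
      case True
      then show ?thesis using central_not_nested[of b s k j] s sk * by (auto simp: matched_def)
    next
      case False
      then obtain s' where s': "matched b s' j" by (auto simp: central_def)
      then have s'l: "matched b s' l" using * rel_matched by blast
      have "s \<le> s'" using matched_nested[OF sk s'] s * by (auto simp: matched_def)
      moreover have "s' \<le> s" using matched_nested[OF s'l sk] s' * by (auto simp: matched_def)
      ultimately have "s' = s" by simp
      then show ?thesis using s s' rel_matched by blast
    qed
  qed
qed

definition codes :: "nat \<Rightarrow> (int \<Rightarrow> nat) set" where
  "codes n = {b. periodic n b \<and> mass n b \<le> n}"

text \<open>Over the period from s to s + n the walk does not rise, and an element i \<ge> s + n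
  would require a strict descent after it, against the nonnegative total. So finite classes fit in
  windows of length n.\<close>

lemma matched_less:
  assumes "b \<in> codes n" "n > 0" "matched b s i" shows "i < s + int n"
proof (rule ccontr)
  assume c: "\<not> i < s + int n"
  have p: "periodic n b" "mass n b \<le> n" using assms by (auto simp: codes_def)
  have "drift b s (i + 1) = drift b s (s + int n) + drift b (s + int n) (i + 1)"
    using c by (intro drift_add) auto
  moreover have "drift b s (s + int n) \<le> 0" using drift_period[OF p(1) assms(2)] p by simp
  moreover have "drift b (s + int n) (i + 1) < 0" "0 \<le> drift b s (i + 1)"
    using assms c by (auto simp: matched_def)
  ultimately show False by linarith
qed

lemma finite_matched: "b \<in> codes n \<Longrightarrow> n > 0 \<Longrightarrow> finite {i. matched b s i}"
  by (rule finite_subset[of _ "{s..s + int n}"]) (use matched_less[of b n s] matched_le[of b s] in \<open>force+\<close>)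

text \<open>Along the class of s the height after the closer, measured from s, runs through b s - 1,
  ..., 1, 0, each value once.\<close>

lemma card_matched:
  assumes "b \<in> codes n" "n > 0" shows "card {i. matched b s i} = b s"
proof -
  have p: "periodic n b" "mass n b \<le> n" using assms by (auto simp: codes_def)
  have dec: "drift b s (j + 1) < drift b s (i + 1)" if "matched b s i" "matched b s j" "i < j" for i j
  proof -
    have "drift b s (j + 1) = drift b s (i + 1) + drift b (i + 1) (j + 1)"
      using that by (intro drift_add) (auto simp: matched_def)
    moreover have "drift b (i + 1) (j + 1) < 0" using that by (auto simp: matched_def)
    ultimately show ?thesis by linarith
  qed
  have "bij_betw (\<lambda>i. drift b s (i + 1)) {i. matched b s i} {0..<int (b s)}"
    unfolding bij_betw_def
  proof
    show "inj_on (\<lambda>i. drift b s (i + 1)) {i. matched b s i}"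
      by (rule inj_onI) (metis dec less_irrefl linorder_neqE mem_Collect_eq)
    show "(\<lambda>i. drift b s (i + 1)) ` {i. matched b s i} = {0..<int (b s)}"
    proof safe
      fix i assume m: "matched b s i"
      then have "i = s \<or> drift b s (i + 1) < drift b s (s + 1)"
        using dec[OF matched_start[OF m] m] matched_le[OF m] by linarith
      then show "drift b s (i + 1) \<in> {0..<int (b s)}" using m by (auto simp: matched_def)
    next
      fix v assume v: "v \<in> {0..<int (b s)}"
      \<comment> \<open>The element of height v is the first position at which the walk from s has
        come down to v; one period suffices, since its total drift is at most 0.\<close>
      let ?A = "{i\<in>{s..s + int n - 1}. drift b s (i + 1) \<le> v}"
      have "drift b s (s + int n - 1 + 1) \<le> 0" using drift_period[OF p(1) assms(2)] p by simp
      then have "s + int n - 1 \<in> ?A" using v assms(2) by auto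
      moreover have "finite ?A" by (rule finite_subset[of _ "{s..s + int n - 1}"]) auto
      ultimately have M: "Min ?A \<in> ?A" by (metis (no_types, lifting) Min_in emptyE)
      define i where "i = Min ?A"
      have below: "v < drift b s t" if "s < t" "t \<le> i" for t
      proof (rule ccontr)
        assume "\<not> v < drift b s t"
        then have "t - 1 \<in> ?A" using that M by (auto simp: i_def)
        then have "i \<le> t - 1" unfolding i_def using \<open>finite ?A\<close> by (intro Min_le) auto
        then show False using that by simp
      qed
      have i: "s \<le> i" "drift b s (i + 1) \<le> v" using M by (auto simp: i_def)
      \<comment> \<open>A single position lowers the height by at most 1, so at the first descent to
        at most v the value is exactly v. At i = s the height b s - 1 is already at least v.\<close>
      have eq: "drift b s (i + 1) = v"
      proof (cases "i = s")
        case True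
        then show ?thesis using i v by auto
      next
        case False
        then show ?thesis using below[of i] i drift_Suc[of s i b] by auto
      qed
      have "drift b t (i + 1) < 0" if "s < t" "t \<le> i" for t
        using below[OF that] eq drift_add[of s t "i + 1" b] that by auto
      then have "matched b s i" using i eq v by (auto simp: matched_def)
      then show "v \<in> (\<lambda>i. drift b s (i + 1)) ` {i. matched b s i}" using eq by blast
    qed
  qed
  then show ?thesis using bij_betw_same_card by fastforce
qed

definition startof :: "nat \<Rightarrow> (int \<Rightarrow> int \<Rightarrow> bool) \<Rightarrow> int \<Rightarrow> bool" where
  "startof n R s \<longleftrightarrow> \<not> R s (s + int n) \<and> (\<forall>i. R s i \<longrightarrow> s \<le> i)"

definition code :: "nat \<Rightarrow> (int \<Rightarrow> int \<Rightarrow> bool) \<Rightarrow> int \<Rightarrow> nat" where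
  "code n R s = (if startof n R s then card {i. R s i} else 0)"

text \<open>A matched class has one first element and spans less than n, whereas being unmatched is
  invariant under translation by n.\<close>

lemma central_iff: 
  assumes "b \<in> codes n" "n > 0" shows "central b i \<longleftrightarrow> rel b i (i + int n)"
proof
  assume "central b i"
  then show "rel b i (i + int n)"
    using central_shift[of n b i 1] assms by (simp add: rel_central codes_def)
next
  assume r: "rel b i (i + int n)"
  show "central b i"
    unfolding central_def
  proof (intro allI notI)
    fix s assume m: "matched b s i"
    then have "matched b s (i + int n)" using r rel_matched by blast
    then show False using matched_less[OF assms] m by (fastforce simp: matched_def)
  qed
qed

lemma code_rel:
  assumes "b \<in> codes n" "n > 0" shows "code n (rel b) = b"
proof
  fix s
  show "code n (rel b) s = b s"
  proof (cases "matched b s s")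
    case True
    then have "startof n (rel b) s"
      unfolding startof_def central_iff[OF assms, symmetric]
      by (auto simp: central_def rel_matched dest: matched_le)
    moreover have "{i. rel b s i} = {i. matched b s i}" using rel_matched[OF True] by blast
    ultimately show ?thesis using card_matched[OF assms] by (simp add: code_def)
  next
    case False
    have "\<not> startof n (rel b) s"
    proof
      assume st: "startof n (rel b) s"
      then obtain s' where s': "matched b s' s"
        using central_iff[OF assms] by (auto simp: startof_def central_def)
      then have "rel b s s'" using rel_matched matched_start by blast
      then have "s \<le> s'" using st by (auto simp: startof_def)
      then have "s = s'" using s' matched_le by fastforce
      then show False using s' False by simp
    qed
    then show ?thesis using False by (simp add: code_def matched_refl_iff)
  qed
qed

lemma ncrel_shift:
  assumes "ncrel n R" shows "R (i + int n * k) (j + int n * k) \<longleftrightarrow> R i j"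
proof (induction k rule: int_induct[of _ 0])
  case (step1 k)
  have "R (i + int n * k + int n) (j + int n * k + int n) \<longleftrightarrow> R (i + int n * k) (j + int n * k)"
    using assms unfolding ncrel_def by blast
  then show ?case using step1 by (simp add: algebra_simps)
next
  case (step2 k)
  have "R (i + int n * (k - 1) + int n) (j + int n * (k - 1) + int n) \<longleftrightarrow> R (i + int n * (k - 1)) (j + int n * (k - 1))"
    using assms unfolding ncrel_def by blast
  then show ?case using step2 by (simp add: algebra_simps)
qed simp

section \<open>From periodic noncrossing relations back to codes\<close>

locale noncrossing =
  fixes n :: nat and R :: "int \<Rightarrow> int \<Rightarrow> bool"
  assumes n: "n > 0" and nc: "ncrel n R"
begin

lemma refl: "R i i" and sym: "R i j \<Longrightarrow> R j i" and trans: "R i j \<Longrightarrow> R j k \<Longrightarrow> R i k"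
  using nc unfolding ncrel_def by (meson equivp_reflp equivp_symp equivp_transp)+

lemma cross: "i < j \<Longrightarrow> j < k \<Longrightarrow> k < l \<Longrightarrow> R i k \<Longrightarrow> R j l \<Longrightarrow> R i j"
  using nc unfolding ncrel_def by blast

lemmas shift = ncrel_shift[OF nc]

lemma shift1: "R (i + int n) (j + int n) \<longleftrightarrow> R i j"
  using shift[of i 1 j] by simp

abbreviation cen where "cen i \<equiv> R i (i + int n)"

lemma cen_cong: "R i j \<Longrightarrow> cen i \<longleftrightarrow> cen j"
  using shift1 sym trans by meson

lemma cen_shift: "cen i \<Longrightarrow> R i (i + int n * k)"
proof (induction k rule: int_induct[of _ 0])
  case base show ?case by (simp add: refl)
next
  case (step1 k)
  then show ?case using shift[of i k "i + int n"] trans[of i "i + int n * k" "i + int n * (k + 1)"]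
    by (simp add: algebra_simps)
next
  case (step2 k)
  then show ?case using shift[of i "k - 1" "i + int n"] trans[of i "i + int n * k" "i + int n * (k - 1)"] sym
    by (simp add: algebra_simps)
qed

text \<open>The pair (i, j) crosses its own translate (i + n, j + n), which forces i and i + n
  together.\<close>

lemma long_cen: "R i j \<Longrightarrow> i + int n \<le> j \<Longrightarrow> cen i"
  using cross[of i "i + int n" j "j + int n"] n shift1[of i j] by (cases "i + int n = j") auto

text \<open>Some translate i + n c satisfies i + n c \<le> j < i + n c + n. Unless it equals j, the
  pair made of it and its translate by n crosses the pair (j, j + n).\<close>

lemma cen_cen:
  assumes "cen i" "cen j" shows "R i j"
proof -
  define c where "c = (j - i) div int n"
  have "j - i = int n * c + (j - i) mod int n" by (simp add: c_def)
  moreover have "0 \<le> (j - i) mod int n" "(j - i) mod int n < int n" using n by auto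
  ultimately have c: "i + int n * c \<le> j" "j < i + int n * c + int n" by auto
  have "R i (i + int n * c)" by (rule cen_shift[OF assms(1)])
  moreover have "R (i + int n * c) j"
  proof (cases "i + int n * c = j")
    case False
    have "R (i + int n * c) (i + int n * c + int n)" using shift[of i c "i + int n"] assms by (simp add: algebra_simps)
    then show ?thesis using cross[of "i + int n * c" j "i + int n * c + int n" "j + int n"] c False assms by auto
  qed (simp add: refl)
  ultimately show ?thesis by (rule trans)
qed

lemma noncen_dist: "\<not> cen i \<Longrightarrow> R i j \<Longrightarrow> \<bar>i - j\<bar> < int n"
  using long_cen[of i j] long_cen[of j i] sym cen_cong by (smt (verit))

lemma finite_class: "\<not> cen i \<Longrightarrow> finite {j. R i j}"
  by (rule finite_subset[of _ "{i - int n..i + int n}"]) (auto dest!: noncen_dist)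

lemma start_exists:
  assumes "\<not> cen i" obtains s where "startof n R s" "R s i" "s \<le> i"
proof -
  let ?s = "Min {j. R i j}"
  have ne: "{j. R i j} \<noteq> {}" using refl by blast
  then have s: "R i ?s" using Min_in[OF finite_class[OF assms]] by blast
  have "?s \<le> j" if "R ?s j" for j
    using Min_le[OF finite_class[OF assms], of j] trans[OF s that] by simp
  then have "startof n R ?s" using cen_cong[OF s] assms by (auto simp: startof_def)
  moreover have "?s \<le> i" using Min_le[OF finite_class[OF assms], of i] refl by simp
  ultimately show ?thesis using that s sym by blast
qed

lemma start_unique: "startof n R s \<Longrightarrow> startof n R s' \<Longrightarrow> R s s' \<Longrightarrow> s = s'"
  unfolding startof_def using sym by (meson order_antisym)

lemma start_shift: "startof n R s \<Longrightarrow> startof n R (s + int n * k)"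
proof -
  assume s: "startof n R s"
  have "\<not> R (s + int n * k) (s + int n * k + int n)"
    using s shift[of s k "s + int n"] by (simp add: startof_def algebra_simps)
  moreover have "s + int n * k \<le> j" if "R (s + int n * k) j" for j
    using s shift[of s k "j - int n * k"] that by (fastforce simp: startof_def)
  ultimately show ?thesis by (simp add: startof_def)
qed

lemma periodic_code: "periodic n (code n R)"
  unfolding periodic_def
proof
  fix s
  have "startof n R (s + int n) \<longleftrightarrow> startof n R s"
    using start_shift[of s 1] start_shift[of "s + int n" "- 1"] by (auto simp: algebra_simps)
  moreover have "card {i. R (s + int n) i} = card {i. R s i}"
  proof (rule bij_betw_same_card[of "\<lambda>i. i - int n"], rule bij_betw_byWitness[where f' = "\<lambda>i. i + int n"])
    show "(\<lambda>i. i - int n) ` {i. R (s + int n) i} \<subseteq> {i. R s i}"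
    proof
      fix y assume "y \<in> (\<lambda>i. i - int n) ` {i. R (s + int n) i}"
      then have "R (s + int n) (y + int n)" by auto
      then show "y \<in> {i. R s i}" using shift1 by simp
    qed
    show "(\<lambda>i. i + int n) ` {i. R s i} \<subseteq> {i. R (s + int n) i}"
      using shift1[of s] by auto
  qed auto
  ultimately show "code n R (s + int n) = code n R s" by (simp add: code_def)
qed

lemma sum_code:
  assumes "finite I"
  shows "(\<Sum>x\<in>I. code n R x) = card (\<Union>x\<in>{x\<in>I. startof n R x}. {y. R x y})"
proof -
  have "(\<Sum>x\<in>I. code n R x) = (\<Sum>x\<in>{x\<in>I. startof n R x}. card {y. R x y})"
    by (rule sum.mono_neutral_cong_right) (use assms in \<open>auto simp: code_def\<close>)
  also have "\<dots> = card (\<Union>x\<in>{x\<in>I. startof n R x}. {y. R x y})"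
  proof (rule card_UN_disjoint[symmetric])
    show "\<forall>i\<in>{x\<in>I. startof n R x}. \<forall>j\<in>{x\<in>I. startof n R x}. i \<noteq> j \<longrightarrow> {y. R i y} \<inter> {y. R j y} = {}"
      using start_unique sym trans by blast
  qed (use assms in \<open>auto intro: finite_class simp: startof_def\<close>)
  finally show ?thesis .
qed

lemma finite_classes: "finite I \<Longrightarrow> finite (\<Union>x\<in>{x\<in>I. startof n R x}. {y. R x y})"
  by (auto intro: finite_class simp: startof_def)

text \<open>By \<open>sum_code\<close>, the drift of the code is the number of elements in classes
  starting in \<open>{t..i}\<close> minus the number of positions in \<open>{t..i}\<close>. Here
  these classes stay inside and miss i; in the next lemma they cover everything.\<close>

lemma drift_code_neg:
  assumes "t \<le> i" "(\<Union>x\<in>{x\<in>{t..i}. startof n R x}. {y. R x y}) \<subseteq> {t..i} - {i}"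
  shows "drift (code n R) t (i + 1) < 0"
proof -
  have "card (\<Union>x\<in>{x\<in>{t..i}. startof n R x}. {y. R x y}) \<le> card ({t..i} - {i})"
    by (rule card_mono) (use assms in auto)
  then show ?thesis using assms(1) by (simp add: drift_eq_sum sum_code)
qed

lemma drift_code_nonneg:
  assumes "t \<le> i" "{t..i} \<subseteq> (\<Union>x\<in>{x\<in>{t..i}. startof n R x}. {y. R x y})"
  shows "drift (code n R) t (i + 1) \<ge> 0"
proof -
  have "card {t..i} \<le> card (\<Union>x\<in>{x\<in>{t..i}. startof n R x}. {y. R x y})"
    by (rule card_mono[OF finite_classes assms(2)]) simp
  then show ?thesis using assms(1) by (simp add: drift_eq_sum sum_code)
qed

lemma noncen_between:
  assumes "i < j" "j < k" "R i k" "\<not> cen i" shows "\<not> cen j"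
proof
  assume c: "cen j"
  have "R j (j + int n)" using c .
  moreover have "k < j + int n" using noncen_dist[OF assms(4,3)] assms(1,2) by auto
  ultimately have "R i j" using cross[of i j k "j + int n"] assms by auto
  then show False using assms c cen_cong by blast
qed

text \<open>Let s be the start of the class of i. Each position of \<open>{s..i}\<close> lies in a
  class starting in \<open>{s..i}\<close>, while for s < t \<le> i the classes starting in
  \<open>{t..i}\<close> end before i; otherwise they would cross the class of s and i. If i is
  central, all classes that start up to i end before i.\<close>

lemma matched_code:
  "matched (code n R) s i \<longleftrightarrow> startof n R s \<and> R s i"
proof -
  have main: "matched (code n R) s i" if s: "startof n R s" "R s i" for s
  proof -
    have si: "s \<le> i" using s by (auto simp: startof_def)
    have ncs: "\<not> cen s" using s by (simp add: startof_def)
    have "drift (code n R) s (i + 1) \<ge> 0"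
    proof (rule drift_code_nonneg[OF si], rule subsetI)
      fix x assume x: "x \<in> {s..i}"
      have ncx: "\<not> cen x"
        using noncen_between[of s x i] ncs s x cen_cong[of s i] by (cases "x = s \<or> x = i") auto
      then obtain s' where s': "startof n R s'" "R s' x" "s' \<le> x" by (rule start_exists)
      have "s \<le> s'"
      proof (rule ccontr)
        assume c: "\<not> s \<le> s'"
        have "R s' s"
        proof (cases "x = s \<or> x = i")
          case True
          then show ?thesis using s s' sym trans by blast
        next
          case False
          then show ?thesis using cross[of s' s x i] c s s' x by auto
        qed
        then have "s' = s" using start_unique s s' by blast
        then show False using c by simp
      qed
      then show "x \<in> (\<Union>x\<in>{x\<in>{s..i}. startof n R x}. {y. R x y})" using s' x by auto
    qed
    moreover have "drift (code n R) t (i + 1) < 0" if t: "s < t" "t \<le> i" for t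
    proof (rule drift_code_neg[OF t(2)], rule subsetI)
      fix y assume "y \<in> (\<Union>x\<in>{x\<in>{t..i}. startof n R x}. {y. R x y})"
      then obtain x where x: "t \<le> x" "x \<le> i" "startof n R x" "R x y" by auto
      have "\<not> R s x" using start_unique[OF s(1) x(3)] x t by auto
      then have "x < i" using x s by (cases "x = i") auto
      moreover have "x \<le> y" using x by (auto simp: startof_def)
      moreover have "y < i"
      proof (rule ccontr)
        assume "\<not> y < i"
        then consider "y = i" | "i < y" by linarith
        then have "R s x"
        proof cases
          case 1 then show ?thesis using s x sym trans by blast
        next
          case 2 then show ?thesis using cross[of s x i y] s x t \<open>x < i\<close> by auto
        qed
        then show False using \<open>\<not> R s x\<close> by simp
      qed
      ultimately show "y \<in> {t..i} - {i}" using x by auto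
    qed
    ultimately show ?thesis using si by (auto simp: matched_def)
  qed
  have cen: "\<not> matched (code n R) s i" if c: "cen i"
  proof -
    have "drift (code n R) t (i + 1) < 0" if t: "t \<le> i" for t
    proof (rule drift_code_neg[OF t], rule subsetI)
      fix y assume "y \<in> (\<Union>x\<in>{x\<in>{t..i}. startof n R x}. {y. R x y})"
      then obtain x where x: "t \<le> x" "x \<le> i" "startof n R x" "R x y" by auto
      then have nx: "\<not> cen x" "x \<le> y" by (auto simp: startof_def)
      then have "x \<noteq> i" "y \<noteq> i" using c x cen_cong by blast+
      moreover have "\<not> i < y" using noncen_between[of x i y] x nx c \<open>x \<noteq> i\<close> by auto
      ultimately show "y \<in> {t..i} - {i}" using x nx by auto
    qed
    then show ?thesis by (force simp: matched_def)
  qed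
  show ?thesis
  proof (cases "cen i")
    case True
    then show ?thesis using cen cen_cong by (auto simp: startof_def)
  next
    case False
    then obtain s' where "startof n R s'" "R s' i" by (rule start_exists)
    then show ?thesis using main matched_unique by blast
  qed
qed

text \<open>The classes that start in one period contain each residue modulo n at most once: a
  translation taking one element to another also takes one start to the other.\<close>

lemma code_in_codes: "code n R \<in> codes n"
proof -
  let ?U = "\<Union>x\<in>{x\<in>{0..<int n}. startof n R x}. {y. R x y}"
  have "inj_on (\<lambda>y. y mod int n) ?U"
  proof (rule inj_onI)
    fix y y' assume "y \<in> ?U" "y' \<in> ?U" and eq: "y mod int n = y' mod int n"
    then obtain x x' where x: "0 \<le> x" "x < int n" "startof n R x" "R x y"
      and x': "0 \<le> x'" "x' < int n" "startof n R x'" "R x' y'" by auto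
    obtain c where c: "y' = y + int n * c" using eq by (metis mod_eqE)
    have "R (x + int n * c) y'" using x shift c by simp
    then have "x + int n * c = x'" using start_unique[OF start_shift[OF x(3)] x'(3)] x'(4) sym trans by blast
    then have "x' mod int n = x mod int n" by auto
    then have "x' = x" using x x' by simp
    then have "int n * c = 0" using \<open>x + int n * c = x'\<close> by simp
    then show "y = y'" using c by simp
  qed
  then have "card ?U = card ((\<lambda>y. y mod int n) ` ?U)" by (simp add: card_image)
  also have "\<dots> \<le> card {0..<int n}" by (rule card_mono) (use n in auto)
  finally have "mass n (code n R) \<le> n" by (simp add: mass_def sum_code)
  then show ?thesis using periodic_code by (simp add: codes_def)
qed

lemma rel_code: "rel (code n R) = R"
proof (intro ext)
  fix i j
  show "rel (code n R) i j = R i j"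
  proof (cases "cen i")
    case True
    then have "central (code n R) i" using matched_code cen_cong by (auto simp: central_def startof_def)
    moreover have "central (code n R) j \<longleftrightarrow> cen j"
    proof
      assume "central (code n R) j"
      then show "cen j" using start_exists[of j] by (metis central_def matched_code)
    next
      assume "cen j"
      then show "central (code n R) j" using matched_code cen_cong by (auto simp: central_def startof_def)
    qed
    ultimately show ?thesis using rel_central True cen_cen cen_cong by blast
  next
    case False
    then obtain s where s: "startof n R s" "R s i" by (rule start_exists)
    then have "matched (code n R) s i" by (simp add: matched_code)
    then have "rel (code n R) i j \<longleftrightarrow> matched (code n R) s j" by (rule rel_matched)
    also have "\<dots> \<longleftrightarrow> R i j" using s matched_code sym trans by blast
    finally show ?thesis .
  qed
qed

end

section \<open>Refinement in terms of codes\<close>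

definition block :: "(int \<Rightarrow> nat) \<Rightarrow> int \<Rightarrow> int set" where
  "block u s = {x. matched u s x}"

definition excess :: "(int \<Rightarrow> nat) \<Rightarrow> int set \<Rightarrow> int" where
  "excess b A = (\<Sum>y\<in>A. int (b y) - 1)"

definition ballot_on :: "(int \<Rightarrow> nat) \<Rightarrow> int set \<Rightarrow> bool" where
  "ballot_on b B \<longleftrightarrow> (\<forall>x\<in>B. 0 \<le> excess b {y\<in>B. y \<le> x})"

lemma excess_eq: "finite A \<Longrightarrow> excess b A = int (\<Sum>y\<in>A. b y) - int (card A)"
  by (simp add: excess_def sum_subtractf)

lemma excess_Un: "finite A \<Longrightarrow> finite B \<Longrightarrow> A \<inter> B = {} \<Longrightarrow> excess b (A \<union> B) = excess b A + excess b B"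
  by (simp add: excess_def sum.union_disjoint)

lemma drift_excess: "drift b t (x + 1) = excess b {t..x}"
proof -
  have "{t..<x + 1} = {t..x}" by auto
  then show ?thesis by (simp add: drift_def excess_def)
qed

lemma ballot_on_prefix:
  assumes "ballot_on b B" "finite B" shows "0 \<le> excess b {y\<in>B. y < t}"
proof (cases "{y\<in>B. y < t} = {}")
  case False
  then have M: "Max {y\<in>B. y < t} \<in> {y\<in>B. y < t}" using assms(2) by (intro Max_in) auto
  have "finite {y\<in>B. y < t}" using assms(2) by simp
  then have eq: "{y\<in>B. y < t} = {y\<in>B. y \<le> Max {y\<in>B. y < t}}"
    using M Max_ge by fastforce
  have "Max {y\<in>B. y < t} \<in> B" using M by simp
  then have "0 \<le> excess b {y\<in>B. y \<le> Max {y\<in>B. y < t}}"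
    using assms(1) unfolding ballot_on_def by blast
  then show ?thesis by (subst eq)
next
  case True
  then show ?thesis by (simp only: True excess_def sum.empty)
qed

lemma ballot_on_suffix:
  assumes "ballot_on b B" "finite B" shows "excess b {y\<in>B. t \<le> y} \<le> excess b B"
proof -
  have "excess b ({y\<in>B. y < t} \<union> {y\<in>B. t \<le> y}) = excess b {y\<in>B. y < t} + excess b {y\<in>B. t \<le> y}"
    using assms(2) by (intro excess_Un) auto
  moreover have "{y\<in>B. y < t} \<union> {y\<in>B. t \<le> y} = B" by auto
  ultimately show ?thesis using ballot_on_prefix[OF assms, of t] by simp
qed

text \<open>Blocks of \<open>u\<close> other than the one of \<open>x\<close> meet \<open>{t..x}\<close> in terminal segments, and in
  whole blocks if \<open>t\<close> and \<open>x\<close> are equivalent.\<close>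

lemma drift_le_excess:
  assumes u: "u \<in> codes n" "n > 0"
    and others: "\<And>y s. y \<in> {t..x} \<Longrightarrow> \<not> rel u x y \<Longrightarrow> matched u s y \<Longrightarrow> ballot_on b (block u s) \<and> excess b (block u s) = 0"
    and tx: "t \<le> x" and st: "\<And>s. matched u s x \<Longrightarrow> s \<le> t"
  shows "drift b t (x + 1) \<le> excess b {y\<in>{t..x}. rel u x y}"
    and "rel u x t \<Longrightarrow> drift b t (x + 1) = excess b {y\<in>{t..x}. rel u x y}"
proof -
  let ?I = "{y\<in>{t..x}. \<not> rel u x y}"
  let ?K = "{y\<in>{t..x}. rel u x y}"
  have finI: "finite ?I" and finK: "finite ?K"
    by (rule finite_subset[of _ "{t..x}"]; auto)+
  define st where "st y = (THE s. matched u s y)" for y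
  have st_eq: "st y = s" if "matched u s y" for s y
    unfolding st_def using that matched_unique by blast
  have relx: "rel u x x" by (simp add: rel_def)
  have fin [simp]: "finite (block u s)" for s using finite_matched[OF u] by (simp add: block_def)
  have noncen: "matched u (st y) y" if y: "y \<in> ?I" for y
  proof -
    have "\<not> central u y"
    proof
      assume c: "central u y"
      show False
      proof (cases "central u x")
        case True
        then show ?thesis using c y rel_central by blast
      next
        case False
        then obtain s where s: "matched u s x" by (auto simp: central_def)
        then have "s \<noteq> y" using matched_start c by (auto simp: central_def)
        moreover have "s \<le> y" "y < x" using y \<open>\<And>s. matched u s x \<Longrightarrow> s \<le> t\<close>[OF s] relx by (auto simp: order_less_le)
        ultimately show ?thesis using central_not_nested[OF s c] by simp
      qed
    qed
    then show ?thesis using st_eq by (auto simp: central_def)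
  qed
  \<comment> \<open>A block other than that of x which has an element in \<open>{t..x}\<close>
    cannot continue beyond x, since it would cross the class of x.\<close>
  have below: "z \<le> x" if y: "y \<in> ?I" and z: "matched u (st y) z" for y z
  proof (rule ccontr)
    assume "\<not> z \<le> x"
    have yx: "y < x" using y relx by (auto simp: order_less_le)
    have sy: "st y \<le> y" using noncen[OF y] by (rule matched_le)
    show False
    proof (cases "central u x")
      case True
      then show ?thesis using central_not_nested[OF z True] yx sy \<open>\<not> z \<le> x\<close> by simp
    next
      case False
      then obtain s where s: "matched u s x" by (auto simp: central_def)
      have "s \<noteq> y" using matched_start[OF s] s y rel_matched[OF s] rel_matched[OF matched_start[OF s]] by (auto simp: rel_def)
      then have "s < y" using \<open>\<And>s. matched u s x \<Longrightarrow> s \<le> t\<close>[OF s] y by auto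
      then have "s \<le> st y" using matched_nested[OF s noncen[OF y]] yx by simp
      moreover have "st y \<le> s" using matched_nested[OF z s] sy yx \<open>\<not> z \<le> x\<close> by simp
      ultimately have "st y = s" by simp
      then show False using y s noncen[OF y] rel_matched by auto
    qed
  qed
  have inner: "{y\<in>?I. st y = s} = {y\<in>block u s. t \<le> y}" if sI: "s \<in> st ` ?I" for s
  proof safe
    fix y assume y: "t \<le> y" "y \<in> block u s"
    obtain y0 where y0: "y0 \<in> ?I" "s = st y0" using sI by blast
    have m: "matched u s y0" "matched u s y" using noncen[OF y0(1)] y0 y by (auto simp: block_def)
    show "y \<in> {t..x}" using below[OF y0(1)] m y0 y by auto
    show "st y = s" using m st_eq by blast
    assume "rel u x y"
    then have "rel u x y0" using m rel_matched[OF m(1)] unfolding rel_def by blast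
    then show False using y0 by blast
  qed (use noncen in \<open>auto simp: block_def\<close>)
  have "drift b t (x + 1) = excess b {t..x}" by (rule drift_excess)
  also have "\<dots> = excess b (?I \<union> ?K)" by (rule arg_cong[of _ _ "excess b"]) auto
  also have "\<dots> = excess b ?I + excess b ?K" by (rule excess_Un[OF finI finK]) auto
  \<comment> \<open>The positions not equivalent to x are grouped by blocks; by \<open>inner\<close>
    each block contributes all of its elements from t on.\<close>
  also have "excess b ?I = (\<Sum>s\<in>st ` ?I. excess b {y\<in>?I. st y = s})"
    unfolding excess_def by (rule sum.group[symmetric]) (use finI in auto)
  also have "\<dots> = (\<Sum>s\<in>st ` ?I. excess b {y\<in>block u s. t \<le> y})"
    by (rule sum.cong[OF HOL.refl], rule arg_cong[of _ _ "excess b"], rule inner)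
  finally have eq: "drift b t (x + 1) = (\<Sum>s\<in>st ` ?I. excess b {y\<in>block u s. t \<le> y}) + excess b ?K" .
  have oth: "ballot_on b (block u s)" "excess b (block u s) = 0" if sI: "s \<in> st ` ?I" for s
  proof -
    obtain y0 where y0: "y0 \<in> ?I" "s = st y0" using sI by blast
    then show "ballot_on b (block u s)" "excess b (block u s) = 0"
      using others[of y0 s] noncen[OF y0(1)] by blast+
  qed
  have "(\<Sum>s\<in>st ` ?I. excess b {y\<in>block u s. t \<le> y}) \<le> 0"
    by (rule sum_nonpos) (metis ballot_on_suffix[OF oth(1) fin] oth(2))
  then show "drift b t (x + 1) \<le> excess b ?K" using eq by simp
  assume rt: "rel u x t"
  have "excess b {y\<in>block u s. t \<le> y} = 0" if s: "s \<in> st ` ?I" for s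
  proof -
    obtain y0 where y0: "y0 \<in> ?I" "s = st y0" using s by blast
    have m: "matched u s y0" using noncen[OF y0(1)] y0 by simp
    \<comment> \<open>A block that has already started before t would have elements on both sides of
      t, the later one before x, and so cross the class of t and x.\<close>
    have "t \<le> s"
    proof (rule ccontr)
      assume "\<not> t \<le> s"
      have ty: "t < y0" using y0 rt by (auto simp: order_less_le)
      have yx: "y0 < x" using y0 relx by (auto simp: order_less_le)
      have "\<not> central u t" using central_not_nested[OF m, of t] ty \<open>\<not> t \<le> s\<close> by auto
      then obtain s' where s': "matched u s' t" by (auto simp: central_def)
      then have s'x: "matched u s' x" using rt by (simp add: rel_def)
      have "s \<le> s'" using matched_nested[OF m s'] ty \<open>\<not> t \<le> s\<close> by simp
      moreover have "s' \<le> s" using matched_nested[OF s'x m] matched_le[OF s'] ty yx by simp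
      ultimately have "s = s'" by simp
      then have "rel u x y0" using s'x m rel_matched by blast
      then show False using y0 by blast
    qed
    then have "{y\<in>block u s. t \<le> y} = block u s" by (auto simp: block_def dest: matched_le)
    then show ?thesis using oth(2)[OF s] by simp
  qed
  then show "drift b t (x + 1) = excess b ?K" using eq by simp
qed

text \<open>The criterion for \<open>rel b \<le> rel u\<close>, by \<open>fits_rel\<close> and
  \<open>rel_fits\<close>: the finite classes of u carry ballot sequences, the central class carries
  no condition.\<close>

definition fits :: "(int \<Rightarrow> nat) \<Rightarrow> (int \<Rightarrow> nat) \<Rightarrow> bool" where
  "fits u b \<longleftrightarrow> (\<forall>s. ballot_on b (block u s) \<and> excess b (block u s) = 0)"

lemma block_prefix: "matched u s x \<Longrightarrow> {y\<in>{s..x}. rel u x y} = {y\<in>block u s. y \<le> x}"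
  by (auto simp: block_def rel_matched dest: matched_le)

text \<open>On the way from s to x all other blocks balance out, and the remaining prefix of the
  block of x has nonnegative excess.\<close>

lemma fits_matched_exists:
  assumes u: "u \<in> codes n" "n > 0" and f: "fits u b" and m: "matched u s x"
  obtains t where "matched b t x" "s \<le> t"
proof -
  have xs: "rel u x s" using m matched_start rel_matched by blast
  have "drift b s (x + 1) = excess b {y\<in>{s..x}. rel u x y}"
  proof (rule drift_le_excess(2)[OF u])
    show "\<And>t. matched u t x \<Longrightarrow> t \<le> s" using matched_unique[OF m] by blast
  qed (use f xs matched_le[OF m] in \<open>simp_all add: fits_def\<close>)
  also have "\<dots> \<ge> 0"
    unfolding block_prefix[OF m] using f m by (auto simp: fits_def ballot_on_def block_def)
  finally show ?thesis using matched_exists[OF matched_le[OF m]] that by blast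
qed

text \<open>Let t' be the first element of the class of x in \<open>{t..x}\<close>. If t is not in
  this class, moving the left end from t to t' does not lower the drift, because the other blocks
  contribute at most 0 from t and exactly 0 from t'. This contradicts the choice of t as the last
  position of nonnegative drift.\<close>

lemma fits_matched_rel:
  assumes u: "u \<in> codes n" "n > 0" and f: "fits u b" and m: "matched b t x"
  shows "rel u x t"
proof (rule ccontr)
  assume nr: "\<not> rel u x t"
  have tx: "t \<le> x" using m by (rule matched_le)
  have st: "s \<le> t" if s: "matched u s x" for s
    using fits_matched_exists[OF u f s] m matched_unique by metis
  let ?A = "{y\<in>{t..x}. rel u x y}"
  have A: "finite ?A" "x \<in> ?A" using tx by (auto simp: rel_def intro: finite_subset[of _ "{t..x}"])
  then have M: "Min ?A \<in> ?A" by (intro Min_in) auto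
  define t' where "t' = Min ?A"
  have t': "t \<le> t'" "t' \<le> x" "rel u x t'" "t' \<noteq> t" using M nr by (auto simp: t'_def)
  have "?A = {y\<in>{t'..x}. rel u x y}"
    using Min_le[OF A(1)] t' by (auto simp: t'_def)
  then have "excess b {y\<in>{t'..x}. rel u x y} \<ge> drift b t (x + 1)"
    using drift_le_excess(1)[OF u, of t x b] f tx st by (auto simp: fits_def)
  also have "excess b {y\<in>{t'..x}. rel u x y} = drift b t' (x + 1)"
    using drift_le_excess(2)[OF u, of t' x b] f t' st by (force simp: fits_def)
  finally have "drift b t (x + 1) \<le> drift b t' (x + 1)" .
  moreover have "t < t'" using t' by simp
  ultimately show False using m t' by (force simp: matched_def)
qed

lemma fits_rel:
  assumes u: "u \<in> codes n" "n > 0" and f: "fits u b" and r: "rel b x y"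
  shows "rel u x y"
proof (cases "central b x")
  case True
  then have "central b y" using r rel_central by blast
  then have "central u x" "central u y"
    using True fits_matched_exists[OF u f] unfolding central_def by metis+
  then show ?thesis using rel_central by blast
next
  case False
  then obtain t where "matched b t x" by (auto simp: central_def)
  then have "rel u x t" "rel u y t" using r fits_matched_rel[OF u f] by (auto simp: rel_def)
  then show ?thesis by (simp add: rel_def)
qed

text \<open>Each element of a block of u lies in a b-class that starts in the same block and not
  later, so the b-classes starting in a prefix of the block cover that prefix. As b-classes stay
  inside the block, the total excess is 0.\<close>

lemma rel_fits:
  assumes u: "u \<in> codes n" "n > 0" and b: "b \<in> codes n" and le: "rel b \<le> rel u"
  shows "fits u b"
  unfolding fits_def
proof
  fix s
  have fin [simp]: "finite (block u s)" using finite_matched[OF u] by (simp add: block_def)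
  have finb [simp]: "finite {y. matched b t y}" for t using finite_matched[OF b u(2)] .
  have start: "\<exists>t\<in>block u s. t \<le> y \<and> matched b t y" if y: "y \<in> block u s" for y
  proof -
    have "\<not> central b y"
      unfolding central_iff[OF b u(2)] using le central_iff[OF u, of y] y
      by (auto simp: central_def block_def)
    then obtain t where t: "matched b t y" by (auto simp: central_def)
    then have "rel b y t" using matched_start rel_matched by (auto simp: rel_def)
    then have "rel u y t" using le by blast
    then have "t \<in> block u s" using y by (auto simp: block_def rel_def)
    then show ?thesis using t matched_le by blast
  qed
  have card: "(\<Sum>t\<in>A. b t) = card (\<Union>t\<in>A. {y. matched b t y})" if "finite A" for A
    by (subst card_UN_disjoint) (use that matched_unique card_matched[OF b u(2)] in auto)
  have pre: "0 \<le> excess b {y\<in>block u s. y \<le> x}" for x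
  proof -
    have "card {y\<in>block u s. y \<le> x} \<le> card (\<Union>t\<in>{y\<in>block u s. y \<le> x}. {y. matched b t y})"
    proof (rule card_mono)
      show "{y\<in>block u s. y \<le> x} \<subseteq> (\<Union>t\<in>{y\<in>block u s. y \<le> x}. {y. matched b t y})"
        using start by fastforce
    qed auto
    then show ?thesis by (simp add: excess_eq card)
  qed
  have "card (\<Union>t\<in>block u s. {y. matched b t y}) \<le> card (block u s)"
  proof (rule card_mono)
    show "(\<Union>t\<in>block u s. {y. matched b t y}) \<subseteq> block u s"
    proof safe
      fix t y assume t: "t \<in> block u s" "matched b t y"
      then have "rel b t y" using matched_start rel_matched by blast
      then have "rel u t y" using le by blast
      then show "y \<in> block u s" using t by (auto simp: block_def rel_def)
    qed
  qed auto
  then have "excess b (block u s) \<le> 0" by (simp add: excess_eq card)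
  moreover have "excess b (block u s) \<ge> 0"
  proof (cases "block u s = {}")
    case False
    then have "{y\<in>block u s. y \<le> Max (block u s)} = block u s" by auto
    then show ?thesis using pre[of "Max (block u s)"] by simp
  qed (simp add: excess_def)
  ultimately show "ballot_on b (block u s) \<and> excess b (block u s) = 0"
    using pre by (simp add: ballot_on_def)
qed

lemma sum_list_take_sorted:
  fixes B :: "int set"
  assumes "finite B" "i < card B"
  shows "sum_list (take (Suc i) (map b (sorted_list_of_set B)))
    = (\<Sum>y\<in>{y\<in>B. y \<le> sorted_list_of_set B ! i}. b y)"
proof -
  let ?xs = "sorted_list_of_set B"
  have d: "distinct ?xs" "sorted ?xs" "set ?xs = B" "length ?xs = card B" using assms by auto
  have "set (take (Suc i) ?xs) = {y\<in>B. y \<le> ?xs ! i}"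
  proof safe
    fix y assume "y \<in> set (take (Suc i) ?xs)"
    then obtain j where "j \<le> i" "y = ?xs ! j" "j < card B"
      using assms d by (auto simp: in_set_conv_nth less_Suc_eq_le)
    then show "y \<in> B" "y \<le> ?xs ! i"
      using d assms nth_mem[of j ?xs] by (auto simp: sorted_iff_nth_mono)
  next
    fix y assume "y \<in> B" "y \<le> ?xs ! i"
    then obtain j where j: "j < card B" "y = ?xs ! j" using d by (metis in_set_conv_nth)
    have "j \<le> i"
    proof (rule ccontr)
      assume "\<not> j \<le> i"
      then have "?xs ! i < ?xs ! j"
        using d j assms sorted_wrt_nth_less[of "(<)" ?xs i j] by simp
      then show False using \<open>y \<le> ?xs ! i\<close> j by simp
    qed
    then show "y \<in> set (take (Suc i) ?xs)" using j d by (auto simp: in_set_conv_nth intro!: exI[of _ j])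
  qed
  moreover have "sum_list (map b (take (Suc i) ?xs)) = (\<Sum>y\<in>set (take (Suc i) ?xs). b y)"
    by (rule sum_list_distinct_conv_sum_set) (use d in simp)
  ultimately show ?thesis by (simp add: take_map)
qed

lemma ballots_iff:
  assumes "finite B"
  shows "map b (sorted_list_of_set B) \<in> ballots (card B) j \<longleftrightarrow> ballot_on b B \<and> (\<Sum>y\<in>B. b y) = j"
proof -
  let ?xs = "sorted_list_of_set B"
  have d: "distinct ?xs" "sorted ?xs" "set ?xs = B" "length ?xs = card B" using assms by auto
  have tot: "sum_list (map b ?xs) = (\<Sum>y\<in>B. b y)"
    using d by (simp add: sum_list_distinct_conv_sum_set)
  have card: "card {y\<in>B. y \<le> ?xs ! i} = Suc i" if "i < card B" for i
  proof -
    have "sum_list (take (Suc i) (map (\<lambda>_. 1::nat) ?xs)) = Suc i"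
      using that d by (simp add: map_replicate_const sum_list_replicate)
    then show ?thesis using sum_list_take_sorted[OF assms that, of "\<lambda>_. 1"] by (metis card_eq_sum)
  qed
  have ex: "excess b {y\<in>B. y \<le> ?xs ! i} = int (sum_list (take (Suc i) (map b ?xs))) - int (Suc i)" if "i < card B" for i
  proof -
    have "finite {y\<in>B. y \<le> ?xs ! i}" using assms by simp
    from excess_eq[OF this, of b] show ?thesis
      unfolding sum_list_take_sorted[OF assms that] card[OF that] .
  qed
  have "(\<forall>i\<le>card B. i \<le> sum_list (take i (map b ?xs))) \<longleftrightarrow> (\<forall>i<card B. Suc i \<le> sum_list (take (Suc i) (map b ?xs)))"
    by (metis Suc_le_eq Suc_le_D le0 not0_implies_Suc)
  also have "\<dots> \<longleftrightarrow> (\<forall>i<card B. 0 \<le> excess b {y\<in>B. y \<le> ?xs ! i})"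
  proof (intro all_cong1 imp_cong refl)
    fix i assume "i < card B"
    then show "Suc i \<le> sum_list (take (Suc i) (map b ?xs)) \<longleftrightarrow> 0 \<le> excess b {y\<in>B. y \<le> ?xs ! i}"
      using ex[of i] by linarith
  qed
  also have "\<dots> \<longleftrightarrow> ballot_on b B"
    unfolding ballot_on_def using d all_set_conv_all_nth[of ?xs "\<lambda>x. 0 \<le> excess b {y\<in>B. y \<le> x}"]
    by (simp only: d(3,4))
  finally show ?thesis using tot d by (auto simp: ballots_def comps_def)
qed

lemma block_shift:
  assumes "periodic n u" shows "block u (s + int n * k) = (\<lambda>y. y + int n * k) ` block u s"
proof safe
  fix y assume "y \<in> block u (s + int n * k)"
  then have "y - int n * k \<in> block u s"
    using matched_shift[OF assms, of s k "y - int n * k"] by (simp add: block_def)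
  then show "y \<in> (\<lambda>y. y + int n * k) ` block u s" by force
qed (simp add: block_def matched_shift[OF assms])

lemma excess_shift:
  assumes "periodic n b" shows "excess b ((\<lambda>y. y + int n * k) ` A) = excess b A"
  unfolding excess_def by (simp add: sum.reindex periodic_mult[OF assms])

lemma ballot_on_shift:
  assumes "periodic n b" shows "ballot_on b ((\<lambda>y. y + int n * k) ` A) \<longleftrightarrow> ballot_on b A"
proof -
  have "{y \<in> (\<lambda>y. y + int n * k) ` A. y \<le> x + int n * k} = (\<lambda>y. y + int n * k) ` {y \<in> A. y \<le> x}" for x
    by auto
  then show ?thesis by (simp add: ballot_on_def excess_shift[OF assms])
qed

text \<open>The cells of \<open>u\<close> form a system of representatives of the residues modulo \<open>n\<close>: the central
  ones get index \<open>-1\<close>, the others are indexed by the first element of their block.\<close>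

definition cell :: "nat \<Rightarrow> (int \<Rightarrow> nat) \<Rightarrow> int \<Rightarrow> int set" where
  "cell n u j = (if j < 0 then {i\<in>{0..<int n}. central u i} else block u j)"

definition cells :: "nat \<Rightarrow> (int \<Rightarrow> nat) \<Rightarrow> int set" where
  "cells n u = (\<Union>j\<in>{- 1..<int n}. cell n u j)"

lemma finite_block [simp]: "u \<in> codes n \<Longrightarrow> n > 0 \<Longrightarrow> finite (block u s)"
  by (simp add: block_def finite_matched)

lemma finite_cell [simp]: "u \<in> codes n \<Longrightarrow> n > 0 \<Longrightarrow> finite (cell n u s)"
  by (auto simp: cell_def intro: finite_subset[of _ "{0..<int n}"])

lemma codes_periodic: "u \<in> codes n \<Longrightarrow> periodic n u"
  by (simp add: codes_def)

lemma cell_mod_inj: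
  assumes u: "u \<in> codes n" "n > 0" and j: "j \<in> {- 1..<int n}" "j' \<in> {- 1..<int n}"
    and y: "y \<in> cell n u j" "y' \<in> cell n u j'" and eq: "y mod int n = y' mod int n"
  shows "j = j'" "y = y'"
proof -
  obtain c where c: "y' = y + int n * c" using eq by (metis mod_eqE)
  note per = codes_periodic[OF u(1)]
  have "j = j' \<and> y = y'"
  proof (cases "j < 0")
    case True
    then have y1: "central u y" "0 \<le> y" "y < int n" using y by (auto simp: cell_def)
    then have "central u y'" using central_shift[OF per] c by simp
    then have "j' < 0" using y by (auto simp: cell_def block_def central_def split: if_splits)
    then have "0 \<le> y'" "y' < int n" using y by (auto simp: cell_def)
    then show ?thesis using True \<open>j' < 0\<close> j y1 eq by auto
  next
    case False
    then have m: "matched u j y" using y by (simp add: cell_def block_def)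
    then have m': "matched u (j + int n * c) y'" using matched_shift[OF per] c by simp
    then have "\<not> j' < 0" using y by (auto simp: cell_def central_def)
    then have "matched u j' y'" using y by (simp add: cell_def block_def)
    then have jj: "j' = j + int n * c" using m' matched_unique by blast
    then have "j' mod int n = j mod int n" by simp
    then have "j' = j" using False \<open>\<not> j' < 0\<close> j by simp
    then show ?thesis using jj c by simp
  qed
  then show "j = j'" "y = y'" by blast+
qed

lemma cells_mod:
  assumes u: "u \<in> codes n" "n > 0" shows "bij_betw (\<lambda>y. y mod int n) (cells n u) {0..<int n}"
  unfolding bij_betw_def
proof
  show "inj_on (\<lambda>y. y mod int n) (cells n u)"
    using cell_mod_inj(2)[OF u] by (auto simp: cells_def inj_on_def)
  show "(\<lambda>y. y mod int n) ` cells n u = {0..<int n}"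
  proof safe
    fix i assume i: "i \<in> {0..<int n}"
    show "i \<in> (\<lambda>y. y mod int n) ` cells n u"
    proof (cases "central u i")
      case True
      then have "i \<in> cell n u (- 1)" using i by (simp add: cell_def)
      then have "i \<in> cells n u" using u(2) by (auto simp: cells_def intro!: bexI[of _ "- 1"])
      then show ?thesis using i by (force intro: image_eqI[of _ _ i])
    next
      case False
      then obtain s where s: "matched u s i" by (auto simp: central_def)
      define c where "c = - (s div int n)"
      have sc: "s + int n * c = s mod int n" by (simp add: c_def minus_div_mult_eq_mod algebra_simps)
      have "0 \<le> s mod int n" "s mod int n < int n" using u(2) by auto
      moreover have "i + int n * c \<in> cell n u (s + int n * c)"
        using s matched_shift[OF codes_periodic[OF u(1)], of s c i] sc calculation
        by (simp add: cell_def block_def)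
      ultimately have "i + int n * c \<in> cells n u" using sc
        unfolding cells_def by (intro UN_I[of "s + int n * c"]) auto
      moreover have "i = (i + int n * c) mod int n" using i by simp
      ultimately show ?thesis by blast
    qed
  qed (use u(2) in auto)
qed

lemma prod_cells:
  fixes g :: "int \<Rightarrow> nat"
  assumes u: "u \<in> codes n" "n > 0" and g: "\<And>i. g (i mod int n) = g i"
  shows "(\<Prod>i\<in>{0..<int n}. g i) = (\<Prod>j\<in>{- 1..<int n}. \<Prod>y\<in>cell n u j. g y)"
proof -
  have "(\<Prod>i\<in>{0..<int n}. g i) = (\<Prod>y\<in>cells n u. g (y mod int n))"
    by (rule prod.reindex_bij_betw[OF cells_mod[OF u], symmetric])
  also have "\<dots> = (\<Prod>j\<in>{- 1..<int n}. \<Prod>y\<in>cell n u j. g (y mod int n))"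
    unfolding cells_def
    by (rule prod.UNION_disjoint) (use u cell_mod_inj(1)[OF u] in auto)
  finally show ?thesis by (simp add: g)
qed

lemma sum_cells:
  fixes g :: "int \<Rightarrow> nat"
  assumes u: "u \<in> codes n" "n > 0" and g: "\<And>i. g (i mod int n) = g i"
  shows "(\<Sum>i\<in>{0..<int n}. g i) = (\<Sum>j\<in>{- 1..<int n}. \<Sum>y\<in>cell n u j. g y)"
proof -
  have "(\<Sum>i\<in>{0..<int n}. g i) = (\<Sum>y\<in>cells n u. g (y mod int n))"
    by (rule sum.reindex_bij_betw[OF cells_mod[OF u], symmetric])
  also have "\<dots> = (\<Sum>j\<in>{- 1..<int n}. \<Sum>y\<in>cell n u j. g (y mod int n))"
    unfolding cells_def
    by (rule sum.UNION_disjoint) (use u cell_mod_inj(1)[OF u] in auto)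
  finally show ?thesis by (simp add: g)
qed

lemma card_block: "u \<in> codes n \<Longrightarrow> n > 0 \<Longrightarrow> card (block u s) = u s"
  by (simp add: block_def card_matched)

lemma cell_index_split: "n > 0 \<Longrightarrow> {- 1..<int n} = insert (- 1) {0..<int n}"
  by auto

lemma card_center:
  assumes u: "u \<in> codes n" "n > 0" shows "card (cell n u (- 1)) + mass n u = n"
proof -
  have "n = (\<Sum>j\<in>{- 1..<int n}. card (cell n u j))"
    using sum_cells[OF u, of "\<lambda>_. 1"] by simp
  also have "\<dots> = card (cell n u (- 1)) + (\<Sum>j\<in>{0..<int n}. card (cell n u j))"
    using u(2) by (simp add: cell_index_split)
  also have "(\<Sum>j\<in>{0..<int n}. card (cell n u j)) = mass n u"
    unfolding mass_def by (rule sum.cong) (auto simp: cell_def card_block[OF u])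
  finally show ?thesis by simp
qed

section \<open>Sums over codes prescribed cell by cell\<close>

definition pweight :: "nat \<Rightarrow> (nat \<Rightarrow> nat) \<Rightarrow> (int \<Rightarrow> nat) \<Rightarrow> nat" where
  "pweight n f b = (\<Prod>i\<in>{0..<int n}. f (b i))"

text \<open>Since the cells represent the residues, the lists on different cells can be chosen
  independently and determine b. This turns sums of weights into products over the cells.\<close>

definition patterns :: "nat \<Rightarrow> (int \<Rightarrow> nat) \<Rightarrow> (int \<Rightarrow> nat list set) \<Rightarrow> (int \<Rightarrow> nat) set" where
  "patterns n u L = {b. periodic n b \<and> (\<forall>j\<in>{- 1..<int n}. map b (sorted_list_of_set (cell n u j)) \<in> L j)}"

lemma periodic_mod: "periodic n b \<Longrightarrow> b (i mod int n) = b i"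
  by (rule periodic_cong) auto

lemma patterns_bij:
  assumes u: "u \<in> codes n" "n > 0"
    and L: "\<And>j ws. j \<in> {- 1..<int n} \<Longrightarrow> ws \<in> L j \<Longrightarrow> length ws = card (cell n u j)"
  shows "bij_betw (\<lambda>b. \<lambda>j\<in>{- 1..<int n}. map b (sorted_list_of_set (cell n u j)))
           (patterns n u L) (PiE {- 1..<int n} L)"
  unfolding bij_betw_def
proof
  let ?J = "{- 1..<int n}"
  let ?el = "\<lambda>j. sorted_list_of_set (cell n u j)"
  have el [simp]: "set (?el j) = cell n u j" "distinct (?el j)" "length (?el j) = card (cell n u j)" for j
    using u by auto
  show "inj_on (\<lambda>b. \<lambda>j\<in>?J. map b (?el j)) (patterns n u L)"
  proof (rule inj_onI, rule ext)
    fix b b' i assume b: "b \<in> patterns n u L" "b' \<in> patterns n u L"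
      and eq: "(\<lambda>j\<in>?J. map b (?el j)) = (\<lambda>j\<in>?J. map b' (?el j))"
    have "i mod int n \<in> (\<lambda>y. y mod int n) ` cells n u"
      using cells_mod[OF u] u(2) by (simp add: bij_betw_def)
    then obtain j y where y: "j \<in> ?J" "y \<in> cell n u j" "i mod int n = y mod int n"
      by (auto simp: cells_def)
    have "map b (?el j) = map b' (?el j)" using fun_cong[OF eq, of j] y by simp
    then have "b y = b' y" using y(2) by (simp del: sorted_list_of_set_eq_Nil_iff)
    then show "b i = b' i"
      using b periodic_cong[OF _ y(3), of b] periodic_cong[OF _ y(3), of b'] by (simp add: patterns_def)
  qed
  show "(\<lambda>b. \<lambda>j\<in>?J. map b (?el j)) ` patterns n u L = PiE ?J L"
  proof (intro equalityI subsetI)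
    fix g assume "g \<in> (\<lambda>b. \<lambda>j\<in>?J. map b (?el j)) ` patterns n u L"
    then show "g \<in> PiE ?J L" by (auto simp: patterns_def)
  next
    fix g assume g: "g \<in> PiE ?J L"
    \<comment> \<open>A position takes the entry of the list element congruent to it modulo n;
      \<open>cell_mod_inj\<close> makes this choice unique.\<close>
    define val where "val i = (SOME v. \<exists>j\<in>?J. \<exists>k<card (cell n u j). i mod int n = (?el j ! k) mod int n \<and> v = g j ! k)" for i
    have val: "val i = g j ! k" if jk: "j \<in> ?J" "k < card (cell n u j)" "i mod int n = (?el j ! k) mod int n" for i j k
      unfolding val_def
    proof (rule some_equality)
      show "\<exists>j'\<in>?J. \<exists>k'<card (cell n u j'). i mod int n = (?el j' ! k') mod int n \<and> g j ! k = g j' ! k'"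
        using jk by blast
      fix v assume "\<exists>j\<in>?J. \<exists>k<card (cell n u j). i mod int n = (?el j ! k) mod int n \<and> v = g j ! k"
      then obtain j' k' where jk': "j' \<in> ?J" "k' < card (cell n u j')" "i mod int n = (?el j' ! k') mod int n" "v = g j' ! k'"
        by blast
      have "?el j ! k \<in> cell n u j" "?el j' ! k' \<in> cell n u j'"
        using nth_mem[of k "?el j"] nth_mem[of k' "?el j'"] jk jk' by auto
      then have "j = j'" "?el j ! k = ?el j' ! k'"
        using cell_mod_inj[OF u jk(1) jk'(1)] jk(3) jk'(3) by auto
      then show "v = g j ! k" using jk jk' nth_eq_iff_index_eq[of "?el j" k k'] by simp
    qed
    have "periodic n val" by (simp add: periodic_def val_def)
    moreover have mp: "map val (?el j) = g j" if j: "j \<in> ?J" for j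
    proof (rule nth_equalityI)
      show "length (map val (?el j)) = length (g j)" using L[OF j] g j by (auto simp: PiE_iff)
      show "map val (?el j) ! k = g j ! k" if "k < length (map val (?el j))" for k
        using that val[OF j, of k "?el j ! k"] by simp
    qed
    ultimately have "val \<in> patterns n u L" using g by (auto simp: patterns_def PiE_iff)
    moreover have "(\<lambda>j\<in>?J. map val (?el j)) = g"
      using mp g by (auto simp: fun_eq_iff PiE_iff extensional_def)
    ultimately show "g \<in> (\<lambda>b. \<lambda>j\<in>?J. map b (?el j)) ` patterns n u L" by blast
  qed
qed

lemma patterns_weight:
  assumes u: "u \<in> codes n" "n > 0"
    and L: "\<And>j ws. j \<in> {- 1..<int n} \<Longrightarrow> ws \<in> L j \<Longrightarrow> length ws = card (cell n u j)"
    and fin: "\<And>j. j \<in> {- 1..<int n} \<Longrightarrow> finite (L j)"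
  shows "(\<Sum>b\<in>patterns n u L. pweight n f b) = (\<Prod>j\<in>{- 1..<int n}. \<Sum>ws\<in>L j. weight f ws)"
    and "finite (patterns n u L)"
proof -
  let ?J = "{- 1..<int n}"
  let ?el = "\<lambda>j. sorted_list_of_set (cell n u j)"
  note bij = patterns_bij[OF u L, of L]
  have pw: "pweight n f b = (\<Prod>j\<in>?J. weight f (map b (?el j)))" if b: "b \<in> patterns n u L" for b
  proof -
    have "pweight n f b = (\<Prod>j\<in>?J. \<Prod>y\<in>cell n u j. f (b y))"
      unfolding pweight_def using b periodic_mod[of n b] by (intro prod_cells[OF u]) (auto simp: patterns_def)
    moreover have "(\<Prod>y\<in>cell n u j. f (b y)) = weight f (map b (?el j))" for j
      using prod.distinct_set_conv_list[of "?el j" "\<lambda>y. f (b y)"] u by (simp add: weight_def comp_def)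
    ultimately show ?thesis by simp
  qed
  have "(\<Sum>b\<in>patterns n u L. pweight n f b)
      = (\<Sum>b\<in>patterns n u L. \<Prod>j\<in>?J. weight f ((\<lambda>j\<in>?J. map b (?el j)) j))"
    by (rule sum.cong) (auto simp: pw intro!: prod.cong)
  also have "\<dots> = (\<Sum>g\<in>PiE ?J L. \<Prod>j\<in>?J. weight f (g j))"
    by (rule sum.reindex_bij_betw) (rule bij)
  also have "\<dots> = (\<Prod>j\<in>?J. \<Sum>ws\<in>L j. weight f ws)"
    by (rule prod_sum_PiE[symmetric]) (use fin in auto)
  finally show "(\<Sum>b\<in>patterns n u L. pweight n f b) = (\<Prod>j\<in>?J. \<Sum>ws\<in>L j. weight f ws)" .
  show "finite (patterns n u L)"
    using bij_betw_finite[OF bij] finite_PiE[of ?J L] fin by auto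
qed

section \<open>Codes below a given code\<close>

definition local_lists :: "nat \<Rightarrow> (int \<Rightarrow> nat) \<Rightarrow> nat \<Rightarrow> int \<Rightarrow> nat list set" where
  "local_lists n u k j = (if j < 0 then comps (card (cell n u j)) k else ballots (u j) (u j))"

lemma mass_cells:
  assumes u: "u \<in> codes n" "n > 0" and b: "periodic n b"
  shows "mass n b = (\<Sum>y\<in>cell n u (- 1). b y) + (\<Sum>j\<in>{0..<int n}. \<Sum>y\<in>block u j. b y)"
proof -
  have "mass n b = (\<Sum>y\<in>cell n u (- 1). b y) + (\<Sum>j\<in>{0..<int n}. \<Sum>y\<in>cell n u j. b y)"
    unfolding mass_def using sum_cells[OF u, of b] periodic_mod[OF b] u(2) by (simp add: cell_index_split)
  also have "(\<Sum>j\<in>{0..<int n}. \<Sum>y\<in>cell n u j. b y) = (\<Sum>j\<in>{0..<int n}. \<Sum>y\<in>block u j. b y)"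
    by (rule sum.cong) (auto simp: cell_def)
  finally show ?thesis .
qed

lemma block_ballots_iff:
  assumes u: "u \<in> codes n" "n > 0"
  shows "map b (sorted_list_of_set (block u j)) \<in> ballots (u j) k \<longleftrightarrow>
         ballot_on b (block u j) \<and> excess b (block u j) = int k - int (u j)"
proof -
  have "excess b (block u j) = int (\<Sum>y\<in>block u j. b y) - int (u j)"
    using u by (simp add: excess_eq card_block)
  then have "(\<Sum>y\<in>block u j. b y) = k \<longleftrightarrow> excess b (block u j) = int k - int (u j)" by linarith
  then show ?thesis using ballots_iff[of "block u j" b k] u by (simp add: card_block)
qed

lemma fits_sum_block:
  assumes u: "u \<in> codes n" "n > 0" and f: "fits u b" shows "(\<Sum>y\<in>block u s. b y) = u s"
proof -
  have "excess b (block u s) = int (\<Sum>y\<in>block u s. b y) - int (u s)"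
    using u by (simp add: excess_eq card_block)
  moreover have "excess b (block u s) = 0" using f by (simp add: fits_def)
  ultimately show ?thesis by linarith
qed

lemma center_comps_iff:
  assumes u: "u \<in> codes n" "n > 0"
  shows "map b (sorted_list_of_set (cell n u (- 1))) \<in> comps (card (cell n u (- 1))) k \<longleftrightarrow>
         (\<Sum>y\<in>cell n u (- 1). b y) = k"
  using u by (simp add: comps_def sum_list_distinct_conv_sum_set)

text \<open>The set A allows the residue of one block to be exempted, namely of a block that carries
  an extra opener.\<close>

lemma fits_upto_period:
  assumes u: "u \<in> codes n" "n > 0" and b: "periodic n b"
    and "s mod int n \<in> A"
    and f: "\<And>j. j \<in> {0..<int n} \<inter> A \<Longrightarrow> ballot_on b (block u j) \<and> excess b (block u j) = 0"
  shows "ballot_on b (block u s) \<and> excess b (block u s) = 0"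
proof -
  have s: "s = s mod int n + int n * (s div int n)" by simp
  have "ballot_on b (block u (s mod int n)) \<and> excess b (block u (s mod int n)) = 0"
    using assms by (intro f) auto
  then show ?thesis
    by (subst (1 2) s) (simp only: block_shift[OF codes_periodic[OF u(1)]] ballot_on_shift[OF b] excess_shift[OF b])
qed

text \<open>The blocks keep their number of openers, so the j additional openers of b all stand on
  the central class of u, where they may be placed freely. The bound on j keeps the mass of b at
  most n.\<close>

lemma below_eq_patterns:
  assumes u: "u \<in> codes n" "n > 0" and j: "j \<le> n - mass n u"
  shows "{b\<in>codes n. rel b \<le> rel u \<and> mass n b = mass n u + j} = patterns n u (local_lists n u j)"
proof (intro set_eqI iffI)
  fix b assume "b \<in> {b\<in>codes n. rel b \<le> rel u \<and> mass n b = mass n u + j}"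
  then have b: "b \<in> codes n" "rel b \<le> rel u" "mass n b = mass n u + j" by auto
  have f: "fits u b" by (rule rel_fits[OF u b(1,2)])
  have "(\<Sum>i\<in>{0..<int n}. \<Sum>y\<in>block u i. b y) = mass n u"
    unfolding mass_def by (simp add: fits_sum_block[OF u f])
  then have "(\<Sum>y\<in>cell n u (- 1). b y) = j"
    using mass_cells[OF u codes_periodic[OF b(1)]] b(3) by simp
  then have "map b (sorted_list_of_set (cell n u i)) \<in> local_lists n u j i" if "i \<in> {- 1..<int n}" for i
    using f that center_comps_iff[OF u, of b j] block_ballots_iff[OF u, of b i "u i"]
    by (cases "i = - 1") (auto simp: local_lists_def fits_def cell_def)
  then show "b \<in> patterns n u (local_lists n u j)" using codes_periodic[OF b(1)] by (simp add: patterns_def)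
next
  fix b assume b: "b \<in> patterns n u (local_lists n u j)"
  then have per: "periodic n b" by (simp add: patterns_def)
  have loc: "map b (sorted_list_of_set (cell n u i)) \<in> local_lists n u j i" if "i \<in> {- 1..<int n}" for i
    using b that by (simp add: patterns_def)
  have bal: "ballot_on b (block u i) \<and> excess b (block u i) = 0" if "i \<in> {0..<int n}" for i
    using loc[of i] that block_ballots_iff[OF u, of b i "u i"] by (simp add: local_lists_def cell_def)
  have f: "fits u b"
    unfolding fits_def using fits_upto_period[OF u per, of _ UNIV] bal by simp
  have "(\<Sum>i\<in>{0..<int n}. \<Sum>y\<in>block u i. b y) = mass n u"
    unfolding mass_def by (simp add: fits_sum_block[OF u f])
  moreover have "(\<Sum>y\<in>cell n u (- 1). b y) = j"
    using loc[of "- 1"] u(2) center_comps_iff[OF u, of b j] by (simp add: local_lists_def)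
  ultimately have t: "mass n b = mass n u + j" using mass_cells[OF u per] by simp
  moreover have "mass n u \<le> n" using u by (simp add: codes_def)
  ultimately have "b \<in> codes n" using per j by (simp add: codes_def)
  moreover have "rel b \<le> rel u" using fits_rel[OF u f] by blast
  ultimately show "b \<in> {b\<in>codes n. rel b \<le> rel u \<and> mass n b = mass n u + j}" using t by simp
qed

lemma local_lists_props:
  assumes u: "u \<in> codes n" "n > 0"
  shows "\<And>j ws. ws \<in> local_lists n u k j \<Longrightarrow> length ws = card (cell n u j)"
    and "finite (local_lists n u k j)"
proof -
  show "\<And>j ws. ws \<in> local_lists n u k j \<Longrightarrow> length ws = card (cell n u j)"
    by (auto simp: local_lists_def comps_def ballots_def cell_def card_block[OF u] split: if_splits)
qed (simp add: local_lists_def)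

text \<open>The recursion for chain counts. If j openers are placed on the central class of size k =
  n - \<open>mass n u\<close>, then b has a central class of size k - j, the argument of h. The
  placements contribute \<open>raney t j k\<close>, and each block passes from level t to
  \<open>Suc t\<close>.\<close>

lemma below_weight:
  assumes u: "u \<in> codes n" "n > 0"
  shows "(\<Sum>b\<in>{b\<in>codes n. rel b \<le> rel u}. h (n - mass n b) * pweight n (fuss t) b)
    = (\<Sum>j\<le>n - mass n u. raney t j (n - mass n u) * h (n - mass n u - j)) * pweight n (fuss (Suc t)) u"
    and "finite {b\<in>codes n. rel b \<le> rel u}"
proof -
  let ?k = "n - mass n u"
  have tu: "mass n u \<le> n" using u by (simp add: codes_def)
  have k: "card (cell n u (- 1)) = ?k" using card_center[OF u] by simp
  let ?B = "\<lambda>j. {b\<in>codes n. rel b \<le> rel u \<and> mass n b = mass n u + j}"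
  have mono: "mass n u \<le> mass n b" if "b \<in> codes n" "rel b \<le> rel u" for b
  proof -
    have "fits u b" by (rule rel_fits[OF u that])
    then have "(\<Sum>i\<in>{0..<int n}. \<Sum>y\<in>block u i. b y) = mass n u"
      unfolding mass_def by (simp add: fits_sum_block[OF u])
    then show ?thesis using mass_cells[OF u codes_periodic[OF that(1)]] by simp
  qed
  have Un: "{b\<in>codes n. rel b \<le> rel u} = (\<Union>j\<le>?k. ?B j)"
  proof safe
    fix b assume b: "b \<in> codes n" "rel b \<le> rel u"
    then have "mass n b - mass n u \<le> ?k" "mass n b = mass n u + (mass n b - mass n u)"
      using mono[OF b] by (auto simp: codes_def)
    then show "b \<in> (\<Union>j\<le>?k. ?B j)" using b by blast
  qed
  have fin: "finite (?B j)" if "j \<le> ?k" for j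
    unfolding below_eq_patterns[OF u that]
    by (rule patterns_weight(2)[OF u]) (use local_lists_props[OF u] in auto)
  have w: "(\<Sum>b\<in>?B j. pweight n (fuss t) b) = raney t j ?k * pweight n (fuss (Suc t)) u" if "j \<le> ?k" for j
  proof -
    have "(\<Sum>b\<in>?B j. pweight n (fuss t) b) = (\<Prod>i\<in>{- 1..<int n}. \<Sum>ws\<in>local_lists n u j i. weight (fuss t) ws)"
      unfolding below_eq_patterns[OF u that]
      by (rule patterns_weight(1)[OF u]) (use local_lists_props[OF u] in auto)
    also have "\<dots> = raney t j ?k * (\<Prod>i\<in>{0..<int n}. \<Sum>ws\<in>local_lists n u j i. weight (fuss t) ws)"
      using u(2) by (simp add: cell_index_split local_lists_def comps_weight k)
    also have "(\<Prod>i\<in>{0..<int n}. \<Sum>ws\<in>local_lists n u j i. weight (fuss t) ws) = pweight n (fuss (Suc t)) u"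
      unfolding pweight_def by (rule prod.cong) (auto simp: local_lists_def ballots_weight)
    finally show ?thesis .
  qed
  show "finite {b\<in>codes n. rel b \<le> rel u}" unfolding Un using fin by blast
  have "(\<Sum>b\<in>{b\<in>codes n. rel b \<le> rel u}. h (n - mass n b) * pweight n (fuss t) b)
      = (\<Sum>j\<le>?k. \<Sum>b\<in>?B j. h (n - mass n b) * pweight n (fuss t) b)"
    unfolding Un by (rule sum.UNION_disjoint) (use fin in auto)
  also have "\<dots> = (\<Sum>j\<le>?k. \<Sum>b\<in>?B j. h (?k - j) * pweight n (fuss t) b)"
    by (intro sum.cong) auto
  also have "\<dots> = (\<Sum>j\<le>?k. h (?k - j) * (raney t j ?k * pweight n (fuss (Suc t)) u))"
    by (rule sum.cong) (auto simp: sum_distrib_left[symmetric] w)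
  also have "\<dots> = (\<Sum>j\<le>?k. raney t j ?k * h (?k - j)) * pweight n (fuss (Suc t)) u"
    unfolding sum_distrib_right by (rule sum.cong) (simp_all add: mult_ac)
  finally show "(\<Sum>b\<in>{b\<in>codes n. rel b \<le> rel u}. h (n - mass n b) * pweight n (fuss t) b)
    = (\<Sum>j\<le>?k. raney t j ?k * h (?k - j)) * pweight n (fuss (Suc t)) u" .
qed

section \<open>Codes with one excess opener\<close>

text \<open>For a code without central class: the block starting at \<open>s\<close> is not enclosed by another
  block, so that it can be joined to the origin.\<close>

definition vis :: "(int \<Rightarrow> nat) \<Rightarrow> int \<Rightarrow> bool" where
  "vis b s \<longleftrightarrow> 1 \<le> b s \<and> (\<forall>t\<ge>s. 0 \<le> drift b s t)"

text \<open>The opener added at s and its translates stands for the origin as one more element of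
  the class.\<close>

definition bump :: "nat \<Rightarrow> (int \<Rightarrow> nat) \<Rightarrow> int \<Rightarrow> int \<Rightarrow> nat" where
  "bump n b s i = (if int n dvd i - s then b i + 1 else b i)"

text \<open>The walk is at the height of r for the last time. For codes of mass n + 1 the walk rises
  by 1 per period, and the cycle lemma gives exactly one such r modulo n.\<close>

definition last_low :: "(int \<Rightarrow> nat) \<Rightarrow> int \<Rightarrow> bool" where
  "last_low b r \<longleftrightarrow> (\<forall>t>r. 0 < drift b r t)"

lemma dvd_shift: "int n dvd i + int n * k - s \<longleftrightarrow> int n dvd i - s"
proof -
  have "i + int n * k - s = (i - s) + int n * k" by simp
  then show ?thesis by (simp only: dvd_add_left_iff dvd_triv_left)
qed

lemma periodic_bump: "periodic n b \<Longrightarrow> periodic n (bump n b s)"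
proof -
  assume "periodic n b"
  moreover have "int n dvd i + int n - s \<longleftrightarrow> int n dvd i - s" for i
    using dvd_shift[of n i 1 s] by (simp only: mult_1_right)
  ultimately show ?thesis by (simp add: periodic_def bump_def)
qed

lemma mass_bump:
  assumes "n > 0" shows "mass n (bump n b s) = mass n b + 1"
proof -
  have "(\<Sum>i\<in>{0..<int n}. if int n dvd i - s then 1 else 0) = (\<Sum>i\<in>{s mod int n}. 1::nat)"
  proof (rule sum.mono_neutral_cong_right)
    show "\<forall>i\<in>{0..<int n} - {s mod int n}. (if int n dvd i - s then 1 else (0::nat)) = 0"
    proof
      fix i assume i: "i \<in> {0..<int n} - {s mod int n}"
      have "i mod int n = i" using i by simp
      then show "(if int n dvd i - s then 1 else (0::nat)) = 0"
        using i by (auto simp flip: mod_eq_dvd_iff)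
    qed
    show "\<And>i. i \<in> {s mod int n} \<Longrightarrow> (if int n dvd i - s then 1 else 0) = (1::nat)"
      by (simp flip: mod_eq_dvd_iff)
  qed (use assms in auto)
  then have "mass n b + 1 = (\<Sum>i\<in>{0..<int n}. b i + (if int n dvd i - s then 1 else 0))"
    by (simp add: mass_def sum.distrib)
  also have "\<dots> = mass n (bump n b s)" unfolding mass_def by (rule sum.cong) (auto simp: bump_def)
  finally show ?thesis by simp
qed

lemma last_low_bump: 
  assumes "vis b s" "n > 0" shows "last_low (bump n b s) s"
  unfolding last_low_def
proof (intro allI impI)
  fix t assume t: "s < t"
  have "drift b s t < drift (bump n b s) s t"
    unfolding drift_def by (rule sum_strict_mono_ex1) (use t in \<open>auto simp: bump_def intro!: bexI[of _ s]\<close>)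
  moreover have "0 \<le> drift b s t" using assms t by (simp add: vis_def)
  ultimately show "0 < drift (bump n b s) s t" by simp
qed

section \<open>The cycle lemma\<close>

lemma drift_periods:
  assumes "periodic n b" "n > 0" "0 \<le> d"
  shows "drift b x (x + d + int n * int c) = drift b x (x + d) + int c * (int (mass n b) - int n)"
proof (induction c)
  case (Suc c)
  have "x + d + int n * int (Suc c) = x + d + int n * int c + int n" by (simp add: algebra_simps)
  then have "drift b x (x + d + int n * int (Suc c))
      = drift b x (x + d + int n * int c) + drift b (x + d + int n * int c) (x + d + int n * int c + int n)"
    using assms by (simp only:, intro drift_add) auto
  then have "drift b x (x + d + int n * int (Suc c))
      = drift b x (x + d) + int c * (int (mass n b) - int n) + (int (mass n b) - int n)"
    by (simp only: Suc drift_period[OF assms(1,2)])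
  then show ?case by (simp only: of_nat_Suc distrib_right mult_1 add.commute add.left_commute)
qed simp

lemma decompose_above:
  assumes "n > 0" "x \<le> t" obtains d c where "0 \<le> d" "d < int n" "t = x + d + int n * int c"
proof -
  have "t - x = (t - x) mod int n + int n * ((t - x) div int n)" by simp
  moreover have "0 \<le> (t - x) div int n" using assms by (simp add: pos_imp_zdiv_nonneg_iff)
  ultimately have "t = x + (t - x) mod int n + int n * int (nat ((t - x) div int n))" by simp
  then show ?thesis using that[of "(t - x) mod int n" "nat ((t - x) div int n)"] assms(1) by simp
qed

text \<open>The last position of minimal height within one period works: in each further period the
  heights increase by 1.\<close>

lemma last_low_exists:
  assumes b: "periodic n b" "n > 0" "mass n b = n + 1"
  obtains r where "r \<in> {0..<int n}" "last_low b r"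
proof -
  let ?I = "{0..<int n}"
  define m where "m = Min ((\<lambda>t. drift b 0 t) ` ?I)"
  have ne: "?I \<noteq> {}" using b by simp
  have mle: "m \<le> drift b 0 t" if "t \<in> ?I" for t unfolding m_def using that by simp
  have "m \<in> (\<lambda>t. drift b 0 t) ` ?I" unfolding m_def using ne by (intro Min_in) auto
  then have M: "finite {t\<in>?I. drift b 0 t = m}" "{t\<in>?I. drift b 0 t = m} \<noteq> {}"
    by (auto intro: finite_subset[of _ ?I])
  define r where "r = Max {t\<in>?I. drift b 0 t = m}"
  have r: "r \<in> ?I" "drift b 0 r = m" using Max_in[OF M] by (auto simp: r_def)
  have "0 < drift b r t" if t: "r < t" for t
  proof -
    have "0 \<le> t" using t r by simp
    from decompose_above[OF b(2) this]
    obtain d c where dc: "0 \<le> d" "d < int n" "t = 0 + d + int n * int c" .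
    have t0: "drift b 0 t = drift b 0 d + int c"
      using drift_periods[OF b(1,2) dc(1), of 0 c] dc(3) b(3) by simp
    have "m < drift b 0 t"
    proof (cases "c = 0")
      case True
      then have "t \<in> ?I" using dc by simp
      then have "drift b 0 t \<noteq> m" using Max_ge[OF M(1), of t] t by (auto simp: r_def)
      then show ?thesis using mle \<open>t \<in> ?I\<close> by (simp add: order_less_le)
    next
      case False
      then show ?thesis using t0 mle[of d] dc by auto
    qed
    then show ?thesis using drift_add[of 0 r t b] r t by simp
  qed
  then show ?thesis using that r by (auto simp: last_low_def)
qed

lemma last_low_shift:
  assumes "periodic n b" shows "last_low b (r + int n * k) \<longleftrightarrow> last_low b r"
proof -
  have "last_low b (r + int n * k)" if "last_low b r" for r k
    unfolding last_low_def
  proof (intro allI impI)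
    fix t assume "r + int n * k < t"
    then show "0 < drift b (r + int n * k) t"
      using that drift_shift[OF assms, of r k "t - int n * k"] by (simp add: last_low_def)
  qed
  from this[of r k] this[of "r + int n * k" "- k"] show ?thesis by auto
qed

text \<open>Two such positions in one period would force a rise of at least 1 up to the second and
  at least 1 after it, but the rise per period is 1.\<close>

lemma last_low_unique:
  assumes b: "periodic n b" "n > 0" "mass n b = n + 1" and r: "last_low b r" "last_low b r'"
  shows "r mod int n = r' mod int n"
proof -
  define c where "c = - ((r' - r) div int n)"
  define r'' where "r'' = r' + int n * c"
  have "r'' - r = (r' - r) mod int n"
    unfolding r''_def c_def by (simp add: minus_div_mult_eq_mod[symmetric] algebra_simps)
  then have r'': "r \<le> r''" "r'' < r + int n" using b(2) pos_mod_bound[of "int n" "r' - r"] pos_mod_sign[of "int n" "r' - r"] by linarith+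
  have low: "last_low b r''" using r last_low_shift[OF b(1)] by (simp add: r''_def)
  have "r'' = r"
  proof (rule ccontr)
    assume "r'' \<noteq> r"
    then have "0 < drift b r r''" "0 < drift b r'' (r + int n)"
      using r low r'' by (auto simp: last_low_def)
    moreover have "drift b r (r + int n) = drift b r r'' + drift b r'' (r + int n)"
      using r'' by (intro drift_add) auto
    ultimately show False using drift_period[OF b(1,2), of r] b(3) by simp
  qed
  then show ?thesis unfolding r''_def by auto
qed

text \<open>With mass n the walk has drift 0 over a period, so heights repeat and one period is
  enough to check.\<close>

lemma visI:
  assumes b: "periodic n b" "n > 0" "mass n b = n" and "1 \<le> b s"
    and w: "\<And>t. s < t \<Longrightarrow> t < s + int n \<Longrightarrow> 0 \<le> drift b s t"
  shows "vis b s"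
  unfolding vis_def
proof (intro conjI allI impI)
  fix t assume "s \<le> t"
  then obtain d c where dc: "0 \<le> d" "d < int n" "t = s + d + int n * int c"
    using decompose_above[OF b(2)] by metis
  have "drift b s t = drift b s (s + d)" using drift_periods[OF b(1,2) dc(1), of s c] dc(3) b(3) by simp
  then show "0 \<le> drift b s t" using w[of "s + d"] dc by (cases "d = 0") auto
qed fact

lemma vis_shift: "periodic n b \<Longrightarrow> vis b (s + int n * k) \<longleftrightarrow> vis b s"
proof -
  assume per: "periodic n b"
  have "vis b (s + int n * k)" if "vis b s" for s k
    unfolding vis_def
  proof (intro conjI allI impI)
    show "1 \<le> b (s + int n * k)" using that periodic_mult[OF per] by (simp add: vis_def)
    fix t assume "s + int n * k \<le> t"
    then show "0 \<le> drift b (s + int n * k) t"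
      using that drift_shift[OF per, of s k "t - int n * k"] by (simp add: vis_def)
  qed
  from this[of s k] this[of "s + int n * k" "- k"] show ?thesis by auto
qed

lemma vis_not_nested:
  assumes "vis u s" "matched u j l" "j < s" shows "l < s"
proof (rule ccontr)
  assume "\<not> l < s"
  then have "drift u s (l + 1) < 0" using assms by (simp add: matched_def)
  then show False using assms \<open>\<not> l < s\<close> unfolding vis_def by (smt (verit))
qed

section \<open>Refinements of a code joined to the origin\<close>

abbreviation attached :: "nat \<Rightarrow> (int \<Rightarrow> nat) \<Rightarrow> int set \<Rightarrow> ((int \<Rightarrow> nat) \<times> int) set" where
  "attached n u A \<equiv> {(b, x). b \<in> codes n \<and> mass n b = n \<and> rel b \<le> rel u \<and> x \<in> A \<and> vis b x}"

text \<open>Local shape of a bumped code. The cell \<open>j\<^sub>0\<close> containing the joined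
  start gets one opener more than it has elements. The other cells are balanced, also the central
  one, because the refinement has mass n and hence no central class of its own.\<close>

definition attached_lists :: "nat \<Rightarrow> (int \<Rightarrow> nat) \<Rightarrow> int \<Rightarrow> int \<Rightarrow> nat list set" where
  "attached_lists n u j\<^sub>0 j = (if j < 0 then comps (card (cell n u j)) (if j = j\<^sub>0 then card (cell n u j) + 1 else card (cell n u j))
     else ballots (u j) (if j = j\<^sub>0 then u j + 1 else u j))"

lemma attached_lists_props:
  assumes u: "u \<in> codes n" "n > 0"
  shows "\<And>j ws. ws \<in> attached_lists n u j0 j \<Longrightarrow> length ws = card (cell n u j)"
    and "finite (attached_lists n u j0 j)"
proof -
  show "\<And>j ws. ws \<in> attached_lists n u j0 j \<Longrightarrow> length ws = card (cell n u j)"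
    by (auto simp: attached_lists_def comps_def ballots_def cell_def card_block[OF u] split: if_splits)
qed (simp add: attached_lists_def)

lemma ballot_on_mono:
  assumes "ballot_on b B" "\<And>y. y \<in> B \<Longrightarrow> b y \<le> b' y" shows "ballot_on b' B"
  unfolding ballot_on_def
proof
  fix x assume x: "x \<in> B"
  have "excess b {y\<in>B. y \<le> x} \<le> excess b' {y\<in>B. y \<le> x}"
    unfolding excess_def by (intro sum_mono diff_right_mono) (simp add: assms(2))
  then show "0 \<le> excess b' {y\<in>B. y \<le> x}" using assms(1) x by (force simp: ballot_on_def)
qed

lemma attached_cell_iff:
  assumes u: "u \<in> codes n" "n > 0" and j: "j \<in> {- 1..<int n}"
  shows "map b (sorted_list_of_set (cell n u j)) \<in> attached_lists n u j0 j \<longleftrightarrow>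
     (0 \<le> j \<longrightarrow> ballot_on b (cell n u j)) \<and> excess b (cell n u j) = (if j = j0 then 1 else 0)"
proof (cases "j < 0")
  case True
  then have j1: "j = - 1" using j by simp
  have "excess b (cell n u j) = int (\<Sum>y\<in>cell n u j. b y) - int (card (cell n u j))"
    using u by (simp add: excess_eq)
  moreover define k where "k = (if j = j0 then card (cell n u j) + 1 else card (cell n u j))"
  moreover have "int k = int (card (cell n u j)) + (if j = j0 then 1 else 0)" by (simp add: k_def)
  ultimately have "excess b (cell n u j) = (if j = j0 then 1 else 0) \<longleftrightarrow> (\<Sum>y\<in>cell n u j. b y) = k"
    by (intro iffI; linarith)
  moreover have "attached_lists n u j0 j = comps (card (cell n u j)) k"
    using True by (simp only: attached_lists_def k_def if_True)
  moreover have "map b (sorted_list_of_set (cell n u j)) \<in> comps (card (cell n u j)) k \<longleftrightarrow> (\<Sum>y\<in>cell n u j. b y) = k"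
    unfolding j1 by (rule center_comps_iff[OF u])
  ultimately show ?thesis using True by (simp only:) simp
next
  case False
  define k where "k = (if j = j0 then u j + 1 else u j)"
  have "attached_lists n u j0 j = ballots (u j) k"
    using False by (simp only: attached_lists_def k_def if_False)
  moreover have "cell n u j = block u j" using False by (simp add: cell_def)
  moreover have "int k - int (u j) = (if j = j0 then 1 else 0)" by (simp add: k_def)
  ultimately show ?thesis using False block_ballots_iff[OF u, of b j k] by simp
qed

lemma cells_mod_obtain:
  assumes u: "u \<in> codes n" "n > 0"
  obtains j y where "j \<in> {- 1..<int n}" "y \<in> cell n u j" "y mod int n = i mod int n"
proof -
  have "i mod int n \<in> (\<lambda>y. y mod int n) ` cells n u"
    using cells_mod[OF u] u(2) by (simp add: bij_betw_def)
  then show ?thesis using that by (force simp: cells_def)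
qed

lemma excess_split: "finite A \<Longrightarrow> excess b A = excess b {y\<in>A. y < x} + excess b {y\<in>A. x \<le> y}"
proof -
  assume f: "finite A"
  have "excess b A = excess b ({y\<in>A. y < x} \<union> {y\<in>A. x \<le> y})"
    by (rule arg_cong[of _ _ "excess b"]) auto
  then show ?thesis using f by (simp add: excess_Un disjoint_iff)
qed

lemma mass_excess:
  assumes u: "u \<in> codes n" "n > 0" and b: "periodic n b"
  shows "int (mass n b) = int n + (\<Sum>j\<in>{- 1..<int n}. excess b (cell n u j))"
proof -
  have "mass n b = (\<Sum>j\<in>{- 1..<int n}. \<Sum>y\<in>cell n u j. b y)"
    unfolding mass_def by (rule sum_cells[OF u]) (rule periodic_mod[OF b])
  moreover have "n = (\<Sum>j\<in>{- 1..<int n}. card (cell n u j))"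
    using sum_cells[OF u, of "\<lambda>_. 1"] by simp
  ultimately have "int (mass n b) - int n = (\<Sum>j\<in>{- 1..<int n}. int (\<Sum>y\<in>cell n u j. b y) - int (card (cell n u j)))"
  proof -
    have "int n = (\<Sum>j\<in>{- 1..<int n}. int (card (cell n u j)))"
      using \<open>n = (\<Sum>j\<in>{- 1..<int n}. card (cell n u j))\<close> by (metis of_nat_sum)
    moreover have "int (mass n b) = (\<Sum>j\<in>{- 1..<int n}. int (\<Sum>y\<in>cell n u j. b y))"
      using \<open>mass n b = _\<close> by (metis (no_types, lifting) of_nat_sum sum.cong)
    ultimately show ?thesis by (simp only: sum_subtractf)
  qed
  then show ?thesis using u by (simp add: excess_eq)
qed

text \<open>The cycle lemma in relative form. A pattern c has mass n + 1 and therefore one last low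
  residue; removing an opener there is the inverse map. It remains to see that this residue belongs
  to the cell j0 and that the block conditions survive the removal.\<close>

lemma attached_bij:
  assumes u: "u \<in> codes n" "n > 0" and j0: "j0 = - 1 \<or> j0 \<in> {0..<int n} \<and> mass n u = n \<and> vis u j0"
  shows "bij_betw (\<lambda>(b, x). bump n b x)
    (attached n u (cell n u j0))
    (patterns n u (attached_lists n u j0))"
  unfolding bij_betw_def
proof
  let ?S = "attached n u (cell n u j0)"
  let ?J = "{- 1..<int n}"
  have j0J: "j0 \<in> ?J" using j0 u(2) by auto
  note fin [simp] = finite_cell[OF u] finite_block[OF u]
  have dvd_cell: "int n dvd y - x \<longleftrightarrow> y = x" if "j \<in> ?J" "y \<in> cell n u j" "x \<in> cell n u j0" for x y j
    using cell_mod_inj(2)[OF u that(1) j0J that(2,3)] by (auto simp flip: mod_eq_dvd_iff)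
  have pat: "b \<in> patterns n u (attached_lists n u j0) \<longleftrightarrow> periodic n b \<and>
     (\<forall>j\<in>?J. (0 \<le> j \<longrightarrow> ballot_on b (cell n u j)) \<and> excess b (cell n u j) = (if j = j0 then 1 else 0))" for b
    unfolding patterns_def using attached_cell_iff[OF u] by auto
  have excess_bump: "excess (bump n b x) A = excess b A + (if x \<in> A then 1 else 0)"
    if "A \<subseteq> cell n u j" "j \<in> ?J" "x \<in> cell n u j0" for A b x j
  proof -
    have fA: "finite A" using finite_subset[OF that(1)] by simp
    have "excess (bump n b x) A = (\<Sum>y\<in>A. (int (b y) - 1) + (if y = x then 1 else 0))"
      unfolding excess_def by (rule sum.cong) (use dvd_cell[OF that(2) _ that(3)] that(1) in \<open>auto simp: bump_def\<close>)
    then show ?thesis using fA by (simp add: excess_def sum.distrib)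
  qed
  show "inj_on (\<lambda>(b, x). bump n b x) ?S"
  proof (rule inj_onI, clarify)
    fix b x b' x' assume b: "b \<in> codes n" "mass n b = n" "x \<in> cell n u j0" "vis b x"
      and b': "b' \<in> codes n" "x' \<in> cell n u j0" "vis b' x'"
      and eq: "bump n b x = bump n b' x'"
    \<comment> \<open>The joined start is recovered from the bumped code as its last low
      residue.\<close>
    have "x mod int n = x' mod int n"
    proof (rule last_low_unique)
      show "periodic n (bump n b x)" using codes_periodic[OF b(1)] by (rule periodic_bump)
      show "mass n (bump n b x) = n + 1" using mass_bump[OF u(2)] b(2) by simp
      show "last_low (bump n b x) x" using last_low_bump b u(2) by blast
      show "last_low (bump n b x) x'" unfolding eq using last_low_bump b' u(2) by blast
    qed (rule u(2))
    then have x: "x = x'" using cell_mod_inj(2)[OF u j0J j0J b(3) b'(2)] by simp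
    have "b i = b' i" for i using fun_cong[OF eq, of i] x by (simp add: bump_def split: if_splits)
    then show "b = b' \<and> x = x'" using x by auto
  qed
  show "(\<lambda>(b, x). bump n b x) ` ?S = patterns n u (attached_lists n u j0)"
  proof (intro equalityI subsetI)
    fix c assume "c \<in> (\<lambda>(b, x). bump n b x) ` ?S"
    then obtain b x where bx: "b \<in> codes n" "mass n b = n" "rel b \<le> rel u" "x \<in> cell n u j0" "c = bump n b x" by auto
    have per: "periodic n b" using bx(1) by (rule codes_periodic)
    have f: "fits u b" by (rule rel_fits[OF u bx(1,3)])
    have f0: "excess b (cell n u j) = 0" "ballot_on b (cell n u j)" if "j \<in> {0..<int n}" for j
      using f that by (auto simp: fits_def cell_def)
    have "excess b (cell n u (- 1)) = 0"
      using mass_excess[OF u per] bx(2) u(2) f0 by (simp add: cell_index_split)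
    then have ex: "excess b (cell n u j) = 0" if "j \<in> ?J" for j using f0 that by (cases "j = - 1") auto
    have "x \<in> cell n u j \<longleftrightarrow> j = j0" if "j \<in> ?J" for j
      using cell_mod_inj(1)[OF u that j0J _ bx(4)] bx(4) by auto
    then have "excess c (cell n u j) = (if j = j0 then 1 else 0)" if "j \<in> ?J" for j
      unfolding bx(5) using excess_bump[OF subset_refl that bx(4)] ex[OF that] that by simp
    moreover have "ballot_on c (cell n u j)" if "j \<in> ?J" "0 \<le> j" for j
      by (rule ballot_on_mono[OF f0(2)]) (use that in \<open>auto simp: bx(5) bump_def\<close>)
    ultimately show "c \<in> patterns n u (attached_lists n u j0)"
      unfolding pat using periodic_bump[OF per] bx(5) by blast
  next
    fix c assume "c \<in> patterns n u (attached_lists n u j0)"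
    then have per: "periodic n c" and bal: "\<And>j. j \<in> ?J \<Longrightarrow> 0 \<le> j \<Longrightarrow> ballot_on c (cell n u j)"
      and ex: "\<And>j. j \<in> ?J \<Longrightarrow> excess c (cell n u j) = (if j = j0 then 1 else 0)"
      unfolding pat by auto
    have "int (mass n c) = int n + 1"
      unfolding mass_excess[OF u per] using j0J by (simp add: ex)
    then have m: "mass n c = n + 1" by simp
    obtain r where r: "r \<in> {0..<int n}" "last_low c r" using last_low_exists[OF per u(2) m] .
    obtain j x where jx: "j \<in> ?J" "x \<in> cell n u j" "x mod int n = r mod int n"
      using cells_mod_obtain[OF u] .
    obtain k where "x = r + int n * k" using jx(3) by (metis mod_eqE)
    then have low: "last_low c x" using r last_low_shift[OF per] by simp
    have good: "ballot_on c (block u s) \<and> excess c (block u s) = 0" if "s mod int n \<noteq> j0" for s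
    proof (rule fits_upto_period[OF u per, of _ "- {j0}"])
      fix i assume "i \<in> {0..<int n} \<inter> - {j0}"
      then show "ballot_on c (block u i) \<and> excess c (block u i) = 0"
        using bal[of i] ex[of i] by (auto simp: cell_def)
    qed (use that in simp)
    \<comment> \<open>A translate of the block j0 with its extra opener cannot occur between x and
      l: being visible, it is not nested in the block j. So all other blocks met there are
      balanced.\<close>
    have others: "ballot_on c (block u s) \<and> excess c (block u s) = 0"
      if l: "0 \<le> j" "matched u j l" and y: "y \<in> {x..l}" "\<not> rel u l y" "matched u s y" for l y s
    proof (rule good, rule notI)
      assume "s mod int n = j0"
      then have "j0 \<noteq> - 1" using u(2) by (metis neg_0_le_iff_le not_one_le_zero of_nat_0_less_iff pos_mod_sign)
      then have v: "vis u j0" using j0 by simp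
      have "s = j0 + int n * (s div int n)" using \<open>s mod int n = j0\<close> by auto
      then have vs: "vis u s" using v vis_shift[OF codes_periodic[OF u(1)]] by metis
      have sj: "s \<noteq> j" using y l rel_matched[of u j l y] by auto
      have "matched u j x" using jx l by (simp add: cell_def block_def)
      then have "j \<le> x" by (rule matched_le)
      have "y \<noteq> l" using y by (auto simp: rel_def)
      have "j \<noteq> y" using y(3) l sj matched_unique matched_start by blast
      then have "j < y" using \<open>j \<le> x\<close> y by simp
      then have "j \<le> s" using matched_nested[OF l(2) y(3)] y \<open>y \<noteq> l\<close> by simp
      then have "l < s" using vis_not_nested[OF vs l(2)] sj by simp
      then show False using matched_le[OF y(3)] y by simp
    qed
    \<comment> \<open>The walk of c rises from x to l + 1, and blocks other than j contribute at
      most 0 to this rise.\<close>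
    have dle: "0 < excess c {y\<in>block u j. x \<le> y \<and> y \<le> l}" if l: "0 \<le> j" "matched u j l" "x \<le> l" for l
    proof -
      have jx': "matched u j x" using jx l by (simp add: cell_def block_def)
      have "drift c x (l + 1) \<le> excess c {y\<in>{x..l}. rel u l y}"
      proof (rule drift_le_excess(1)[OF u])
        show "\<And>s. matched u s l \<Longrightarrow> s \<le> x" using matched_unique[OF l(2)] matched_le[OF jx'] by blast
      qed (use others l in auto)
      also have "{y\<in>{x..l}. rel u l y} = {y\<in>block u j. x \<le> y \<and> y \<le> l}"
        using rel_matched[OF l(2)] by (auto simp: block_def)
      finally show ?thesis using low l(3) unfolding last_low_def by (smt (verit))
    qed
    \<comment> \<open>If j differs from j0, then either j = -1 and the central cell is empty, or the
      block j is balanced and its final segment from x on has excess at most 0, against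
      \<open>dle\<close>.\<close>
    have jj: "j = j0"
    proof (rule ccontr)
      assume ne: "j \<noteq> j0"
      show False
      proof (cases "j = - 1")
        case True
        then have "mass n u = n" using j0 ne by auto
        then have "card (cell n u (- 1)) = 0" using card_center[OF u] by simp
        then show False using True jx by simp
      next
        case False
        then have j: "0 \<le> j" using jx by simp
        let ?l = "Max (block u j)"
        have xB: "x \<in> block u j" using jx j by (simp add: cell_def)
        then have l: "matched u j ?l" "x \<le> ?l" using Max_in[of "block u j"] by (auto simp: block_def[symmetric])
            (metis block_def emptyE fin(2) mem_Collect_eq Max_in)
        have "{y\<in>block u j. x \<le> y \<and> y \<le> ?l} = {y\<in>block u j. x \<le> y}" by auto
        then have "0 < excess c {y\<in>block u j. x \<le> y}" using dle[OF j l] by simp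
        moreover have "ballot_on c (block u j)" "excess c (block u j) = 0"
          using bal[OF jx(1) j] ex[OF jx(1)] ne j by (auto simp: cell_def)
        ultimately show False using ballot_on_suffix[of c "block u j" x] by simp
      qed
    qed
    define b where "b = (\<lambda>i. if int n dvd i - x then c i - 1 else c i)"
    \<comment> \<open>This drift is c x - 1, so an opener remains at x after the removal, as
      visibility requires.\<close>
    have "0 < drift c x (x + 1)" using low unfolding last_low_def by (rule allE[of _ "x + 1"]) simp
    then have cx: "2 \<le> c x" by simp
    have bump: "bump n b x = c"
    proof
      fix i show "bump n b x i = c i"
      proof (cases "int n dvd i - x")
        case True
        then have "i mod int n = x mod int n" by (simp add: mod_eq_dvd_iff)
        then have "c i = c x" using periodic_cong[OF per, of i x] by simp
        then show ?thesis using cx True by (simp add: bump_def b_def)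
      qed (simp add: bump_def b_def)
    qed
    have perb: "periodic n b" using per dvd_shift[of n _ 1 x] by (simp add: periodic_def b_def)
    have mb: "mass n b = n" using mass_bump[OF u(2), of b x] bump m by simp
    have bc: "b \<in> codes n" using perb mb by (simp add: codes_def)
    have xj: "x \<in> cell n u j0" using jx jj by simp
    have exb: "excess b A = excess c A - (if x \<in> A then 1 else 0)" if "A \<subseteq> cell n u j" "j \<in> ?J" for A j
      using excess_bump[OF that xj, of b] bump by simp
    have xc: "x \<in> cell n u i \<longleftrightarrow> i = j0" if "i \<in> ?J" for i
      using cell_mod_inj(1)[OF u that j0J _ xj] xj by auto
    have "vis b x"
    proof (rule visI[OF perb u(2) mb])
      show "1 \<le> b x" using cx by (simp add: b_def)
      fix t assume t: "x < t" "t < x + int n"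
      have "drift c x t = (\<Sum>y\<in>{x..<t}. (int (b y) - 1) + (if y = x then 1 else 0))"
        unfolding drift_def
      proof (rule sum.cong)
        fix y assume y: "y \<in> {x..<t}"
        have "int n dvd y - x \<longleftrightarrow> y = x"
        proof (cases "y = x")
          case False
          then have "0 < y - x" "y - x < int n" using y t by auto
          then show ?thesis using zdvd_not_zless[of "y - x" "int n"] False by blast
        qed simp
        then show "int (c y) - 1 = (int (b y) - 1) + (if y = x then 1 else 0)"
          using cx by (cases "y = x") (simp_all add: b_def)
      qed simp
      also have "\<dots> = drift b x t + 1" using t by (simp add: sum.distrib drift_def)
      finally show "0 \<le> drift b x t" using low t by (force simp: last_low_def)
    qed
    moreover have "rel b \<le> rel u"
    proof -
      have "ballot_on b (block u i) \<and> excess b (block u i) = 0" if i: "i \<in> {0..<int n}" for i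
      proof (cases "i = j0")
        case False
        then have xi: "x \<notin> cell n u i" using xc i by auto
        have "excess b A = excess c A" if "A \<subseteq> cell n u i" for A
          using exb[OF that] i xi that by auto
        moreover have "ballot_on c (cell n u i)" "excess c (cell n u i) = 0" using bal[of i] ex[of i] i False by auto
        ultimately show ?thesis using i unfolding ballot_on_def cell_def by auto
      next
        case True
        have ci: "cell n u i = block u i" using i by (simp add: cell_def)
        have jx': "0 \<le> j" "j = i" using jj True i by auto
        have "0 \<le> excess b {y\<in>block u i. y \<le> z}" if z: "z \<in> block u i" for z
        proof -
          have e: "excess b {y\<in>block u i. y \<le> z} = excess c {y\<in>block u i. y \<le> z} - (if x \<in> {y\<in>block u i. y \<le> z} then 1 else 0)"
            by (rule exb[of _ i]) (use i ci in auto)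
          have balc: "ballot_on c (block u i)" using bal[of i] i ci by simp
          show ?thesis
          proof (cases "x \<le> z")
            case False
            then show ?thesis using e balc z by (auto simp: ballot_on_def)
          next
            \<comment> \<open>The removal costs 1 in this prefix. The part before x is a ballot
              prefix of excess at least 0, and the part from x on has excess at least 1 by
              \<open>dle\<close>.\<close>
            case le: True
            have "excess c {y\<in>block u i. y \<le> z} = excess c {y\<in>{y\<in>block u i. y \<le> z}. y < x} + excess c {y\<in>{y\<in>block u i. y \<le> z}. x \<le> y}"
              by (rule excess_split) simp
            also have "{y\<in>{y\<in>block u i. y \<le> z}. y < x} = {y\<in>block u i. y < x}" using le by auto
            also have "{y\<in>{y\<in>block u i. y \<le> z}. x \<le> y} = {y\<in>block u i. x \<le> y \<and> y \<le> z}" by auto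
            finally have "excess c {y\<in>block u i. y \<le> z} = excess c {y\<in>block u i. y < x} + excess c {y\<in>block u i. x \<le> y \<and> y \<le> z}" .
            moreover have "0 \<le> excess c {y\<in>block u i. y < x}" by (rule ballot_on_prefix[OF balc]) simp
            moreover have "0 < excess c {y\<in>block u i. x \<le> y \<and> y \<le> z}"
              using dle[of z] jx' z le by (simp add: block_def)
            ultimately have "1 \<le> excess c {y\<in>block u i. y \<le> z}" by linarith
            then show ?thesis unfolding e by (simp only: split: if_split) linarith
          qed
        qed
        moreover have "excess b (block u i) = 0"
        proof -
          have "x \<in> block u i" using xj True ci by simp
          moreover have "excess c (block u i) = 1" using ex[of i] i True ci by simp
          moreover have "excess b (block u i) = excess c (block u i) - (if x \<in> block u i then 1 else 0)"
            by (rule exb[of _ i]) (use i ci in auto)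
          ultimately show ?thesis by simp
        qed
        ultimately show ?thesis by (simp add: ballot_on_def)
      qed
      then have "ballot_on b (block u s) \<and> excess b (block u s) = 0" for s
        by (rule fits_upto_period[OF u perb UNIV_I]) blast
      then have "fits u b" unfolding fits_def by blast
      then show ?thesis using fits_rel[OF u] by blast
    qed
    ultimately have "(b, x) \<in> ?S" using bc mb xj by simp
    then show "c \<in> (\<lambda>(b, x). bump n b x) ` ?S" using bump by force
  qed
qed

lemma attached_weight_aux:
  assumes u: "u \<in> codes n" "n > 0" and j0: "j0 = - 1 \<or> j0 \<in> {0..<int n} \<and> mass n u = n \<and> vis u j0"
  shows "(\<Sum>(b, x)\<in>attached n u (cell n u j0).
      pweight n (fuss t) (bump n b x)) = (\<Prod>j\<in>{- 1..<int n}. \<Sum>ws\<in>attached_lists n u j0 j. weight (fuss t) ws)"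
    and "finite (attached n u (cell n u j0))"
proof -
  note pw = patterns_weight[OF u, of "attached_lists n u j0", OF attached_lists_props(1)[OF u] attached_lists_props(2)[OF u]]
  show "(\<Sum>(b, x)\<in>attached n u (cell n u j0).
      pweight n (fuss t) (bump n b x)) = (\<Prod>j\<in>{- 1..<int n}. \<Sum>ws\<in>attached_lists n u j0 j. weight (fuss t) ws)"
    using sum.reindex_bij_betw[OF attached_bij[OF u j0], of "pweight n (fuss t)"] pw(1)
    by (simp add: case_prod_unfold)
  show "finite (attached n u (cell n u j0))"
    using bij_betw_finite[OF attached_bij[OF u j0]] pw(2) by simp
qed

text \<open>On the central cell, of size k = n - \<open>mass n u\<close>, the bumped codes have
  arbitrary entries of sum k + 1; the blocks contribute as for plain refinements.\<close>

lemma attached_center_weight: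
  assumes u: "u \<in> codes n" "n > 0"
  shows "(\<Sum>(b, x)\<in>attached n u (cell n u (- 1)).
      pweight n (fuss t) (bump n b x)) = raney t (Suc (n - mass n u)) (n - mass n u) * pweight n (fuss (Suc t)) u"
proof -
  have k: "card (cell n u (- 1)) = n - mass n u" using card_center[OF u] by simp
  have "(\<Prod>j\<in>{0..<int n}. \<Sum>ws\<in>attached_lists n u (- 1) j. weight (fuss t) ws) = pweight n (fuss (Suc t)) u"
    unfolding pweight_def by (rule prod.cong) (auto simp: attached_lists_def ballots_weight)
  then show ?thesis
    using u(2) attached_weight_aux(1)[OF u, of "- 1" t]
    by (simp add: cell_index_split) (simp add: attached_lists_def comps_weight k)
qed

text \<open>The added summand accounts for the refinements of u whose origin is isolated. On the
  block j0 the two families combine by \<open>ballots_Suc_weight\<close> into a class with u j0 + 1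
  elements.\<close>

lemma attached_block_weight:
  assumes u: "u \<in> codes n" "n > 0" and j0: "j0 \<in> {0..<int n}" "mass n u = n" "vis u j0"
  shows "(\<Sum>(b, x)\<in>attached n u (block u j0).
      pweight n (fuss t) (bump n b x)) + pweight n (fuss (Suc t)) u = pweight n (fuss (Suc t)) (bump n u j0)"
proof -
  have k: "card (cell n u (- 1)) = 0" using card_center[OF u] j0 by simp
  let ?P = "\<Prod>j\<in>{0..<int n} - {j0}. fuss (Suc t) (u j)"
  have "(\<Prod>j\<in>{0..<int n}. \<Sum>ws\<in>attached_lists n u j0 j. weight (fuss t) ws)
     = (\<Sum>ws\<in>attached_lists n u j0 j0. weight (fuss t) ws) * (\<Prod>j\<in>{0..<int n} - {j0}. \<Sum>ws\<in>attached_lists n u j0 j. weight (fuss t) ws)"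
    using j0 by (intro prod.remove) auto
  also have "(\<Prod>j\<in>{0..<int n} - {j0}. \<Sum>ws\<in>attached_lists n u j0 j. weight (fuss t) ws) = ?P"
    by (rule prod.cong) (auto simp: attached_lists_def ballots_weight)
  also have "(\<Sum>ws\<in>attached_lists n u j0 j0. weight (fuss t) ws) = (\<Sum>ws\<in>ballots (u j0) (Suc (u j0)). weight (fuss t) ws)"
    using j0 by (simp add: attached_lists_def)
  finally have 1: "(\<Sum>(b, x)\<in>attached n u (block u j0).
      pweight n (fuss t) (bump n b x)) = (\<Sum>ws\<in>ballots (u j0) (Suc (u j0)). weight (fuss t) ws) * ?P"
    using u(2) attached_weight_aux(1)[OF u, of j0 t] j0 
    by (simp add: cell_index_split cell_def[of n u j0]) (simp add: attached_lists_def comps_weight k)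
  have 2: "pweight n (fuss (Suc t)) u = fuss (Suc t) (u j0) * ?P"
    unfolding pweight_def using j0 by (intro prod.remove) auto
  have "pweight n (fuss (Suc t)) (bump n u j0)
      = fuss (Suc t) (bump n u j0 j0) * (\<Prod>j\<in>{0..<int n} - {j0}. fuss (Suc t) (bump n u j0 j))"
    unfolding pweight_def using j0 by (intro prod.remove) auto
  also have "(\<Prod>j\<in>{0..<int n} - {j0}. fuss (Suc t) (bump n u j0 j)) = ?P"
  proof (rule prod.cong)
    fix j assume j: "j \<in> {0..<int n} - {j0}"
    have "\<not> int n dvd j - j0" using j j0 mod_eq_dvd_iff[of j "int n" j0] by auto
    then show "fuss (Suc t) (bump n u j0 j) = fuss (Suc t) (u j)" by (simp add: bump_def)
  qed simp
  also have "bump n u j0 j0 = Suc (u j0)" by (simp add: bump_def)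
  finally show ?thesis
    unfolding 1 2 using ballots_Suc_weight[where k = "u j0" and t = t] ballots_weight[where k = "u j0" and t = t]
    by (simp only: distrib_right[symmetric] add.commute)
qed

section \<open>Convex hulls of sets of roots of unity\<close>

definition pt :: "nat \<Rightarrow> int \<Rightarrow> complex" where
  "pt N j = cis (2 * pi * of_int j / of_nat N)"

lemma pt_0 [simp]: "pt N 0 = 1"
  by (simp add: pt_def)

lemma pt_add: "pt N (i + j) = pt N i * pt N j"
  by (simp add: pt_def cis_mult add_divide_distrib distrib_left)

lemma pt_self [simp]: "pt N (int N) = 1"
  by (cases "N = 0") (simp_all add: pt_def)

lemma pt_period [simp]: "pt N (i + int N * k) = pt N i"
proof -
  have "pt N (int N * k) = 1"
  proof (induction k rule: int_induct[of _ 0])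
    case (step1 k)
    then show ?case by (simp add: distrib_left pt_add)
  next
    case (step2 k)
    have "pt N (int N * (k - 1) + int N) = pt N (int N * k)" by (simp add: algebra_simps)
    then show ?case using step2 by (simp add: pt_add)
  qed simp
  then show ?thesis by (simp add: pt_add)
qed

lemma pt_mod: "pt N (i mod int N) = pt N i"
  using pt_period[of N "i mod int N" "i div int N"] by simp

lemma norm_pt [simp]: "norm (pt N i) = 1"
  by (simp add: pt_def)

lemma mu_eq_pt:
  assumes "N > 0" shows "bij_betw (pt N) {0..<int N} (mu N)"
proof -
  have "bij_betw nat {0..<int N} {..<N}"
    by (rule bij_betw_byWitness[where f' = int]) auto
  then have "bij_betw ((\<lambda>k. cis (2 * pi * real k / real N)) \<circ> nat) {0..<int N} {z. z ^ N = 1}"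
    using bij_betw_trans[OF _ Complex.bij_betw_roots_unity[OF assms]] by blast
  moreover have "((\<lambda>k. cis (2 * pi * real k / real N)) \<circ> nat) i = pt N i" if "i \<in> {0..<int N}" for i
    using that by (simp add: pt_def)
  ultimately show ?thesis unfolding mu_def using bij_betw_cong by blast
qed

lemma pt_in_mu: "N > 0 \<Longrightarrow> pt N i \<in> mu N"
  using mu_eq_pt[of N] pt_mod[of N i] by (metis atLeastLessThan_iff bij_betw_apply of_nat_0_less_iff pos_mod_bound pos_mod_sign)

lemma mu_obtain:
  assumes "N > 0" "z \<in> mu N" obtains j where "x \<le> j" "j < x + int N" "z = pt N j"
proof -
  obtain i where i: "z = pt N i" using mu_eq_pt[OF assms(1)] assms(2) by (auto simp: bij_betw_def)
  have "z = pt N (x + (i - x) mod int N)"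
    using pt_period[of N "x + (i - x) mod int N" "(i - x) div int N"] by (simp add: i)
  then show ?thesis using that[of "x + (i - x) mod int N"] assms(1) by simp
qed

lemma pt_eq_iff: "N > 0 \<Longrightarrow> pt N i = pt N j \<longleftrightarrow> i mod int N = j mod int N"
proof
  assume N: "N > 0" and "pt N i = pt N j"
  then have "pt N (i mod int N) = pt N (j mod int N)" by (simp add: pt_mod)
  then show "i mod int N = j mod int N"
    using mu_eq_pt[OF N] N by (auto simp: bij_betw_def inj_on_def)
qed (metis pt_mod)

lemma hull_disjoint:
  fixes w :: complex
  assumes "\<And>z. z \<in> A \<Longrightarrow> inner w z \<le> t" "\<And>z. z \<in> B \<Longrightarrow> inner w z > t"
  shows "convex hull A \<inter> convex hull B = {}"
proof -
  have "convex hull A \<subseteq> {z. inner w z \<le> t}"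
    by (rule hull_minimal) (use assms convex_halfspace_le in auto)
  moreover have "convex hull B \<subseteq> {z. inner w z > t}"
    by (rule hull_minimal) (use assms convex_halfspace_gt in auto)
  ultimately show ?thesis by fastforce
qed

lemma inner_cis: "inner (cis m) (cis x) = cos (x - m)"
  by (simp add: inner_complex_def cos_diff)

text \<open>The unit vector perpendicular to the chord from \<open>pt N a\<close> to \<open>pt N c\<close>, on the side of
  the arc between them; \<open>cos (half N a c)\<close> is the distance of that chord from the origin.\<close>

definition mid :: "nat \<Rightarrow> int \<Rightarrow> int \<Rightarrow> complex" where
  "mid N a c = cis (pi * (of_int a + of_int c) / of_nat N)"

definition half :: "nat \<Rightarrow> int \<Rightarrow> int \<Rightarrow> real" where
  "half N a c = pi * (of_int c - of_int a) / of_nat N"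

lemma half_bounds:
  assumes "N > 0" "a \<le> c" "c \<le> a + int N" shows "0 \<le> half N a c" "half N a c \<le> pi"
proof -
  have N: "real N > 0" using assms(1) by simp
  have ca: "0 \<le> real_of_int (c - a)" "real_of_int (c - a) \<le> real N" using assms by linarith+
  then show "0 \<le> half N a c" using N by (simp add: half_def)
  have "pi * real_of_int (c - a) / real N \<le> pi * real N / real N"
    using ca N by (intro divide_right_mono mult_left_mono) auto
  then show "half N a c \<le> pi" using N by (simp add: half_def)
qed

lemma inner_mid: "inner (mid N a c) (pt N j) = cos (pi * (2 * of_int j - of_int a - of_int c) / of_nat N)"
  unfolding mid_def pt_def inner_cis
  by (rule arg_cong[of _ _ cos]) (simp add: diff_divide_distrib[symmetric] algebra_simps)

lemma inner_mid_inside: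
  assumes "N > 0" "a < j" "j < c" "c \<le> a + int N"
  shows "cos (half N a c) < inner (mid N a c) (pt N j)"
proof -
  let ?x = "pi * (2 * of_int j - of_int a - of_int c) / of_nat N"
  have "\<bar>real_of_int (2 * j - a - c)\<bar> < real_of_int (c - a)" using assms by linarith
  then have "\<bar>?x\<bar> < half N a c"
    using assms(1) by (simp add: half_def abs_mult divide_strict_right_mono)
  moreover have "half N a c \<le> pi" using assms by (intro half_bounds) auto
  ultimately have "cos (half N a c) < cos \<bar>?x\<bar>" by (intro cos_monotone_0_pi) auto
  then show ?thesis by (simp only: inner_mid cos_abs_real)
qed

lemma cos_le_outside:
  assumes "0 \<le> h" "h \<le> pi" "h \<le> x" "x \<le> 2 * pi - h"
  shows "cos x \<le> cos h" and "h < x \<Longrightarrow> x < 2 * pi - h \<Longrightarrow> cos x < cos h"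
proof -
  have eq: "cos (2 * pi - x) = cos x" by (simp add: cos_diff)
  show "cos x \<le> cos h"
    using assms eq cos_monotone_0_pi_le[of h x] cos_monotone_0_pi_le[of h "2 * pi - x"] by (cases "x \<le> pi") auto
  show "h < x \<Longrightarrow> x < 2 * pi - h \<Longrightarrow> cos x < cos h"
    using assms eq cos_monotone_0_pi[of h x] cos_monotone_0_pi[of h "2 * pi - x"] by (cases "x \<le> pi") auto
qed

lemma inner_mid_outside:
  assumes "N > 0" "a \<le> c" "c \<le> j" "j \<le> a + int N"
  shows "inner (mid N a c) (pt N j) \<le> cos (half N a c)"
    and "c < j \<Longrightarrow> j < a + int N \<Longrightarrow> inner (mid N a c) (pt N j) < cos (half N a c)"
proof -
  let ?x = "pi * (2 * of_int j - of_int a - of_int c) / of_nat N"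
  have N: "real N > 0" using assms(1) by simp
  have h: "0 \<le> half N a c" "half N a c \<le> pi"
    using assms by (auto intro: half_bounds)
  have x: "half N a c \<le> ?x" "?x \<le> 2 * pi - half N a c"
  proof -
    have "real_of_int (c - a) \<le> of_int (2 * j - a - c)" using assms by linarith
    then have "pi * real_of_int (c - a) / N \<le> pi * of_int (2 * j - a - c) / N"
      using N by (intro divide_right_mono mult_left_mono) auto
    then show "half N a c \<le> ?x" by (simp add: half_def)
    have "of_int (2 * j - a - c) \<le> 2 * real N - real_of_int (c - a)" using assms by linarith
    then have "pi * of_int (2 * j - a - c) / N \<le> pi * (2 * real N - real_of_int (c - a)) / N"
      using N by (intro divide_right_mono mult_left_mono) auto
    also have "\<dots> = 2 * pi - half N a c" using N by (simp add: half_def field_simps)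
    finally show "?x \<le> 2 * pi - half N a c" by simp
  qed
  show "inner (mid N a c) (pt N j) \<le> cos (half N a c)"
    unfolding inner_mid by (rule cos_le_outside(1)[OF h x])
  assume j: "c < j" "j < a + int N"
  have "half N a c < ?x"
  proof -
    have "real_of_int (c - a) < of_int (2 * j - a - c)" using j by linarith
    then have "pi * real_of_int (c - a) / N < pi * of_int (2 * j - a - c) / N"
      using N by (intro divide_strict_right_mono mult_strict_left_mono) auto
    then show ?thesis by (simp add: half_def)
  qed
  moreover have "?x < 2 * pi - half N a c"
  proof -
    have "of_int (2 * j - a - c) < 2 * real N - real_of_int (c - a)" using j by linarith
    then have "pi * of_int (2 * j - a - c) / N < pi * (2 * real N - real_of_int (c - a)) / N"
      using N by (intro divide_strict_right_mono mult_strict_left_mono) auto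
    also have "\<dots> = 2 * pi - half N a c" using N by (simp add: half_def field_simps)
    finally show ?thesis by simp
  qed
  ultimately show "inner (mid N a c) (pt N j) < cos (half N a c)"
    unfolding inner_mid by (rule cos_le_outside(2)[OF h x])
qed

text \<open>After rotation by -m the line becomes Re w = cos h, and the disc bounds the imaginary
  part by sin h, the half length of the chord.\<close>

lemma disc_line_in_chord:
  assumes "norm z \<le> 1" "inner (cis m) z = cos h" "0 \<le> sin h"
  shows "z \<in> closed_segment (cis (m - h)) (cis (m + h))"
proof -
  define w where "w = z * cis (- m)"
  have z: "z = cis m * w" by (simp add: w_def cis_mult mult.left_commute)
  have re: "Re w = cos h" using assms(2) by (simp add: w_def inner_complex_def cis.ctr mult.commute)
  have "norm w \<le> 1" using assms(1) by (simp add: w_def norm_mult)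
  then have "(Re w)\<^sup>2 + (Im w)\<^sup>2 \<le> 1" by (simp add: cmod_def)
  then have "(Im w)\<^sup>2 \<le> (sin h)\<^sup>2" using sin_cos_squared_add[of h] unfolding re by linarith
  then have im: "\<bar>Im w\<bar> \<le> sin h" using assms(3) by (simp add: abs_le_square_iff[symmetric])
  \<comment> \<open>The affine parameter solving Im w = (2 v - 1) sin h. For sin h = 0 the chord is
    a single point and any value does.\<close>
  define v where "v = (if sin h = 0 then 0 else (Im w / sin h + 1) / 2)"
  have v: "0 \<le> v" "v \<le> 1" using im assms(3) by (auto simp: v_def field_simps abs_le_iff)
  have "Im w = (2 * v - 1) * sin h" using im by (auto simp: v_def field_simps)
  then have "w = (1 - v) *\<^sub>R cis (- h) + v *\<^sub>R cis h"
    using re by (simp add: complex_eq_iff algebra_simps)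
  then have "z = (1 - v) *\<^sub>R (cis m * cis (- h)) + v *\<^sub>R (cis m * cis h)"
    by (simp add: z distrib_left)
  then show ?thesis using v by (auto simp: in_segment cis_mult)
qed

text \<open>The segment from x to y passes from one side of the line through the chord to the other,
  and it meets that line inside the disc, hence on the chord.\<close>

lemma chord_meets:
  assumes N: "N > 0" "a \<le> c" "c \<le> a + int N"
    and x: "norm x \<le> 1" "inner (mid N a c) x \<le> cos (half N a c)"
    and y: "norm y \<le> 1" "cos (half N a c) \<le> inner (mid N a c) y"
  shows "closed_segment (pt N a) (pt N c) \<inter> closed_segment x y \<noteq> {}"
proof -
  obtain z where z: "z \<in> closed_segment x y" "inner (mid N a c) z = cos (half N a c)"
    using connected_ivt_hyperplane[OF connected_segment(1) ends_in_segment(1) ends_in_segment(2) x(2) y(2)] by blast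
  have "closed_segment x y \<subseteq> cball 0 1" using x y by (intro closed_segment_subset) auto
  then have "norm z \<le> 1" using z by auto
  moreover have "0 \<le> sin (half N a c)"
    using half_bounds[OF N] by (intro sin_ge_zero)
  ultimately have "z \<in> closed_segment (cis (pi * (of_int a + of_int c) / of_nat N - half N a c)) (cis (pi * (of_int a + of_int c) / of_nat N + half N a c))"
    using z(2) unfolding mid_def by (intro disc_line_in_chord)
  moreover have "pi * (of_int a + of_int c) / of_nat N - half N a c = 2 * pi * of_int a / of_nat N"
    "pi * (of_int a + of_int c) / of_nat N + half N a c = 2 * pi * of_int c / of_nat N"
    by (simp_all add: half_def diff_divide_distrib[symmetric] add_divide_distrib[symmetric] algebra_simps)
  ultimately show ?thesis using z(1) by (auto simp: pt_def)
qed

lemma segment_in_hull: "x \<in> A \<Longrightarrow> y \<in> A \<Longrightarrow> closed_segment x y \<subseteq> convex hull A"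
  by (simp add: closed_segment_subset hull_inc)

section \<open>Crossing criterion for hulls of sets of roots of unity\<close>

definition crossing :: "nat \<Rightarrow> complex set \<Rightarrow> complex set \<Rightarrow> bool" where
  "crossing N p q \<longleftrightarrow> (\<exists>a b c d. a < b \<and> b < c \<and> c < d \<and> d < a + int N \<and>
     pt N a \<in> p \<and> pt N b \<in> q \<and> pt N c \<in> p \<and> pt N d \<in> q)"

text \<open>A crossing gives two intersecting chords. Without one, let a and c be the neighbours in
  p, before and after, of some point j of q: then q lies strictly inside the arc from a to c, p lies
  outside, and the chord from a to c separates them.\<close>

lemma hull_disjoint_iff:
  assumes N: "N > 0" and p: "p \<subseteq> mu N" and q: "q \<subseteq> mu N" and pq: "p \<inter> q = {}"
  shows "convex hull p \<inter> convex hull q = {} \<longleftrightarrow> \<not> crossing N p q"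
proof
  assume dis: "convex hull p \<inter> convex hull q = {}"
  show "\<not> crossing N p q"
  proof
    assume "crossing N p q"
    then obtain a b c d where *: "a < b" "b < c" "c < d" "d < a + int N"
      "pt N a \<in> p" "pt N b \<in> q" "pt N c \<in> p" "pt N d \<in> q" by (auto simp: crossing_def)
    have "closed_segment (pt N a) (pt N c) \<inter> closed_segment (pt N d) (pt N b) \<noteq> {}"
      using inner_mid_inside[OF N, of a b c] inner_mid_outside(1)[OF N, of a c d] * N
      by (intro chord_meets) auto
    then show False using segment_in_hull[of _ p] segment_in_hull[of _ q] * dis by blast
  qed
next
  assume nc: "\<not> crossing N p q"
  show "convex hull p \<inter> convex hull q = {}"
  proof (cases "p = {} \<or> q = {}")
    case False
    then obtain zp zq where z: "zp \<in> p" "zq \<in> q" by blast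
    obtain j where j: "zq = pt N j" using mu_obtain[OF N, of zq 0] z q by blast
    obtain i where i: "j - int N \<le> i" "i < j - int N + int N" "zp = pt N i" using mu_obtain[OF N, of zp "j - int N"] z p by blast
    have pN: "pt N (k + int N) = pt N k" for k using pt_period[of N k 1] by simp
    have jp: "pt N j \<notin> p" using z j pq by blast
    let ?A = "{a\<in>{j - int N..<j}. pt N a \<in> p}"
    have finA: "finite ?A" by (rule finite_subset[of _ "{j - int N..<j}"]) auto
    have "i \<in> ?A" using i z by auto
    then have M: "Max ?A \<in> ?A" using Max_in[OF finA] by blast
    define a where "a = Max ?A"
    have a: "j - int N \<le> a" "a < j" "pt N a \<in> p" using M by (auto simp: a_def)
    have amax: "k \<le> a" if "k < j" "pt N k \<in> p" for k
      using Max_ge[OF finA, of k] that a by (cases "j - int N \<le> k") (auto simp: a_def)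
    have "a \<noteq> j - int N" using a(3) jp pN[of "j - int N"] by auto
    let ?C = "{c\<in>{j<..a + int N}. pt N c \<in> p}"
    have finC: "finite ?C" by (rule finite_subset[of _ "{j<..a + int N}"]) auto
    have "a + int N \<in> ?C" using a \<open>a \<noteq> j - int N\<close> pN by auto
    then have M: "Min ?C \<in> ?C" using Min_in[OF finC] by blast
    define c where "c = Min ?C"
    have c: "j < c" "c \<le> a + int N" "pt N c \<in> p" using M by (auto simp: c_def)
    have cmin: "c \<le> k" if "j < k" "pt N k \<in> p" for k
      using Min_le[OF finC, of k] that c by (cases "k \<le> a + int N") (auto simp: c_def)
    show ?thesis
    proof (rule hull_disjoint[of _ "mid N a c" "cos (half N a c)"])
      fix w assume w: "w \<in> p"
      obtain k where k: "a + 1 \<le> k" "k < a + 1 + int N" "w = pt N k" using mu_obtain[OF N] w p by blast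
      have "c \<le> k" using amax[of k] cmin[of k] k w jp by (cases k j rule: linorder_cases) auto
      then show "inner (mid N a c) w \<le> cos (half N a c)"
        unfolding k(3) using k a c by (intro inner_mid_outside(1)[OF N]) auto
    next
      fix w assume w: "w \<in> q"
      obtain k where k: "a \<le> k" "k < a + int N" "w = pt N k" using mu_obtain[OF N] w q by blast
      have "k \<noteq> a" "k \<noteq> c" using w k a c pq by auto
      moreover have "\<not> c < k"
      proof
        assume "c < k"
        then have "crossing N p q"
          unfolding crossing_def using a c k w z j
          by (intro exI[of _ a] exI[of _ j] exI[of _ c] exI[of _ k]) auto
        then show False using nc by simp
      qed
      ultimately show "cos (half N a c) < inner (mid N a c) w"
        unfolding k(3) using k c by (intro inner_mid_inside[OF N]) auto
    qed
  qed auto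
qed

text \<open>The e points of an orbit under a primitive e-th root of unity have average 0, because e
  \<ge> 2.\<close>

lemma zero_in_hull_invariant:
  assumes e: "e \<ge> 2" "n > 0" and z: "z \<in> p" and inv: "\<And>w. w \<in> p \<Longrightarrow> pt (e * n) (int n) * w \<in> p"
  shows "0 \<in> convex hull p"
proof -
  let ?\<zeta> = "pt (e * n) (int n)"
  have orb: "?\<zeta> ^ k * z \<in> p" for k
    by (induction k) (use z inv in \<open>auto simp: mult.assoc\<close>)
  have pow: "?\<zeta> ^ k = pt (e * n) (int n * int k)" for k
    by (induction k) (simp_all add: pt_add distrib_left)
  have ne: "?\<zeta> \<noteq> 1"
  proof
    assume "?\<zeta> = 1"
    then have "int n mod int (e * n) = 0"
      using pt_eq_iff[of "e * n" "int n" 0] e by simp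
    moreover have "int n mod int (e * n) = int n"
      using e by (intro mod_pos_pos_trivial) auto
    ultimately show False using e by simp
  qed
  have "?\<zeta> ^ e = 1" unfolding pow using pt_self[of "e * n"] by (simp add: mult.commute)
  then have "(\<Sum>k<e. ?\<zeta> ^ k) = 0" using geometric_sum[OF ne, of e] by simp
  then have "(\<Sum>k<e. (1 / real e) *\<^sub>R (?\<zeta> ^ k * z)) = 0"
    by (simp add: scaleR_sum_right[symmetric] sum_distrib_right[symmetric])
  moreover have "(\<Sum>k<e. (1 / real e) *\<^sub>R (?\<zeta> ^ k * z)) \<in> convex hull p"
    by (rule convex_sum) (use e orb in \<open>auto intro: hull_inc\<close>)
  ultimately show ?thesis by simp
qed

text \<open>An arc of fewer than n steps out of e n \<ge> 2 n is shorter than a half circle, so its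
  chord has positive distance from the origin. The origin is thus strictly on the side away from the
  arc.\<close>

lemma half_acute:
  assumes e: "e \<ge> 2" "n > 0" and "a \<le> c" "c - a < int n"
  shows "0 < cos (half (e * n) a c)"
proof (rule cos_gt_zero_pi)
  have n: "real n > 0" using e by simp
  have "pi * of_int (c - a) < pi * real n" using assms by (intro mult_strict_left_mono pi_gt_zero) linarith
  also have "\<dots> \<le> pi * (real e / 2 * real n)"
    using e n by (intro mult_left_mono) auto
  finally have "pi * (of_int c - of_int a) < pi / 2 * real (e * n)" by simp
  then show "half (e * n) a c < pi / 2"
    using e by (simp add: half_def divide_simps)
  have "0 \<le> half (e * n) a c" using assms by (simp add: half_def)
  then show "- (pi / 2) < half (e * n) a c" using pi_gt_zero by linarith
qed

lemma short_arc:
  assumes "e \<ge> 2" "n > 0" "c - a < int n" shows "c \<le> a + int (e * n)"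
proof -
  have "int n \<le> int (e * n)" using assms by (simp only: of_nat_le_iff) simp
  then show ?thesis using assms by linarith
qed

lemma inner_mid_inside_le:
  assumes "N > 0" "a \<le> j" "j \<le> c" "c \<le> a + int N"
  shows "cos (half N a c) \<le> inner (mid N a c) (pt N j)"
proof -
  consider "j = a" | "j = c" | "a < j" "j < c" using assms by linarith
  then show ?thesis
  proof cases
    case 1
    have "2 * real_of_int j - of_int a - of_int c = - (of_int c - of_int a)" using 1 by simp
    then have "pi * (2 * of_int j - of_int a - of_int c) / of_nat N = - half N a c" by (simp only: half_def)
    then show ?thesis unfolding inner_mid by (simp only: cos_minus)
  next
    case 2
    then show ?thesis unfolding inner_mid half_def by simp
  qed (use inner_mid_inside assms in \<open>auto intro: less_imp_le\<close>)
qed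

lemma zero_notin_hull_short:
  assumes e: "e \<ge> 2" "n > 0" and ac: "a \<le> c" "c - a < int n" and p: "p \<subseteq> pt (e * n) ` {a..c}"
  shows "0 \<notin> convex hull p"
proof -
  have N: "e * n > 0" "c \<le> a + int (e * n)" using short_arc[OF e ac(2)] e by auto
  have "convex hull {0} \<inter> convex hull p = {}"
  proof (rule hull_disjoint[of _ "mid (e * n) a c" 0])
    fix z assume "z \<in> p"
    then obtain j where "j \<in> {a..c}" and z: "z = pt (e * n) j" using p by blast
    then have "a \<le> j" "j \<le> c" by auto
    then show "0 < inner (mid (e * n) a c) z"
      unfolding z using inner_mid_inside_le[OF N(1) _ _ N(2), of j] half_acute[OF e ac] by linarith
  qed simp
  then show ?thesis by simp
qed

text \<open>The chord spanned by the ends of q separates q from the origin and from the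
  complementary arc.\<close>

lemma insert_0_hull_disjoint_beside:
  assumes e: "e \<ge> 2" "n > 0" and ac: "a \<le> c" "c - a < int n"
    and q: "q \<subseteq> pt (e * n) ` {a..c}" and p: "p \<subseteq> pt (e * n) ` {c<..<a + int (e * n)}"
  shows "convex hull (insert 0 p) \<inter> convex hull q = {}"
proof -
  have N: "e * n > 0" "c \<le> a + int (e * n)" using short_arc[OF e ac(2)] e by auto
  let ?w = "mid (e * n) a c" and ?t = "cos (half (e * n) a c)"
  \<comment> \<open>Normal and threshold are negated because the strict inequality holds on the side
    of p, while q contains points on the chord.\<close>
  have "convex hull q \<inter> convex hull (insert 0 p) = {}"
  proof (rule hull_disjoint[of _ "- ?w" "- ?t"])
    fix z assume "z \<in> q"
    then obtain j where "j \<in> {a..c}" and z: "z = pt (e * n) j" using q by blast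
    then have "a \<le> j" "j \<le> c" by auto
    then show "inner (- ?w) z \<le> - ?t" unfolding z using inner_mid_inside_le[OF N(1) _ _ N(2)] by simp
  next
    fix z assume z: "z \<in> insert 0 p"
    show "- ?t < inner (- ?w) z"
    proof (cases "z = 0")
      case True
      then show ?thesis using half_acute[OF e ac] by simp
    next
      case False
      then obtain j where "j \<in> {c<..<a + int (e * n)}" and z: "z = pt (e * n) j" using p z by blast
      then have "c < j" "j < a + int (e * n)" by auto
      then show ?thesis unfolding z using inner_mid_outside(2)[OF N(1) ac(1)] by simp
    qed
  qed
  then show ?thesis by blast
qed

text \<open>Here a and c are to be consecutive points of p, with q strictly inside the arc between
  them; their chord shields q from the origin.\<close>

lemma insert_0_hull_disjoint_inside:
  assumes e: "e \<ge> 2" "n > 0" and ac: "a \<le> c" "c - a < int n"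
    and q: "q \<subseteq> pt (e * n) ` {a<..<c}" and p: "p \<subseteq> pt (e * n) ` {c..a + int (e * n)}"
  shows "convex hull (insert 0 p) \<inter> convex hull q = {}"
proof -
  have N: "e * n > 0" "c \<le> a + int (e * n)" using short_arc[OF e ac(2)] e by auto
  let ?w = "mid (e * n) a c" and ?t = "cos (half (e * n) a c)"
  show ?thesis
  proof (rule hull_disjoint[of _ ?w ?t])
    fix z assume "z \<in> q"
    then obtain j where "j \<in> {a<..<c}" and z: "z = pt (e * n) j" using q by blast
    then have "a < j" "j < c" by auto
    then show "?t < inner ?w z" unfolding z using inner_mid_inside[OF N(1) _ _ N(2)] by simp
  next
    fix z assume z: "z \<in> insert 0 p"
    show "inner ?w z \<le> ?t"
    proof (cases "z = 0")
      case True
      then show ?thesis using half_acute[OF e ac] by simp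
    next
      case False
      then obtain j where "j \<in> {c..a + int (e * n)}" and z: "z = pt (e * n) j" using p z by blast
      then have "c \<le> j" "j \<le> a + int (e * n)" by auto
      then show ?thesis unfolding z using inner_mid_outside(1)[OF N(1) ac(1)] by simp
    qed
  qed
qed

text \<open>A part under the short arc of another one cannot be joined to the origin: the segment
  from 0 to b crosses the chord from a to c.\<close>

lemma insert_0_hull_meets:
  assumes e: "e \<ge> 2" "n > 0" and ac: "a < b" "b < c" "c - a < int n"
    and q: "pt (e * n) a \<in> q" "pt (e * n) c \<in> q" and p: "pt (e * n) b \<in> p"
  shows "convex hull (insert 0 p) \<inter> convex hull q \<noteq> {}"
proof -
  have N: "e * n > 0" "c \<le> a + int (e * n)" using short_arc[OF e ac(3)] e by auto
  have "closed_segment (pt (e * n) a) (pt (e * n) c) \<inter> closed_segment 0 (pt (e * n) b) \<noteq> {}"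
  proof (rule chord_meets[OF N(1) _ N(2)])
    show "inner (mid (e * n) a c) 0 \<le> cos (half (e * n) a c)" using half_acute[OF e, of a c] ac by simp
    show "cos (half (e * n) a c) \<le> inner (mid (e * n) a c) (pt (e * n) b)"
      using inner_mid_inside[OF N(1) ac(1,2) N(2)] by simp
  qed (use ac in auto)
  then show ?thesis
    using segment_in_hull[of 0 "insert 0 p" "pt (e * n) b"] segment_in_hull[of "pt (e * n) a" q "pt (e * n) c"] p q by blast
qed

section \<open>Noncrossing partitions as periodic relations\<close>

lemma abs_mult_less_self: "\<bar>int n * m\<bar> < int n \<Longrightarrow> m = 0"
proof (rule ccontr)
  assume "\<bar>int n * m\<bar> < int n" "m \<noteq> 0"
  then have "int n * 1 \<le> int n * \<bar>m\<bar>" by (intro mult_left_mono) auto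
  then show False using \<open>\<bar>int n * m\<bar> < int n\<close> by (simp add: abs_mult)
qed

lemma two_periods: "e \<ge> 2 \<Longrightarrow> 2 * int n \<le> int (e * n)"
  using mult_right_mono[of 2 "int e" "int n"] by simp

definition parts_of :: "nat \<Rightarrow> (int \<Rightarrow> int \<Rightarrow> bool) \<Rightarrow> complex set set" where
  "parts_of N R = range (\<lambda>i. pt N ` {j. R i j})"

lemma pt_in_image_iff: "N > 0 \<Longrightarrow> pt N j \<in> pt N ` A \<longleftrightarrow> (\<exists>c. j + int N * c \<in> A)"
proof
  assume N: "N > 0" and "pt N j \<in> pt N ` A"
  then obtain k where k: "k \<in> A" "pt N j = pt N k" by blast
  then obtain c where "k = j + int N * c" using pt_eq_iff[OF N] by (metis mod_eqE)
  then show "\<exists>c. j + int N * c \<in> A" using k by blast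
next
  assume "\<exists>c. j + int N * c \<in> A"
  then obtain c where "j + int N * c \<in> A" by blast
  then have "pt N (j + int N * c) \<in> pt N ` A" by (rule imageI)
  then show "pt N j \<in> pt N ` A" by simp
qed

context noncrossing
begin

abbreviation cls :: "nat \<Rightarrow> int \<Rightarrow> complex set" where
  "cls e i \<equiv> pt (e * n) ` {j. R i j}"

lemma cls_cong: "R i j \<Longrightarrow> cls e i = cls e j"
  using sym trans by (intro arg_cong[of _ _ "image (pt (e * n))"]) blast

lemma cls_shift: "cls e (i + int (e * n) * c) = cls e i"
proof -
  have "{j. R (i + int (e * n) * c) j} = (\<lambda>j. j + int (e * n) * c) ` {j. R i j}"
  proof safe
    fix j assume "R (i + int (e * n) * c) j"
    then have "R (i + int n * (int e * c)) ((j - int n * (int e * c)) + int n * (int e * c))" by (simp add: mult_ac)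
    then have "R i (j - int (e * n) * c)" unfolding shift by (simp add: mult_ac)
    then show "j \<in> (\<lambda>j. j + int (e * n) * c) ` {j. R i j}" by force
  next
    fix j assume "R i j"
    then show "R (i + int (e * n) * c) (j + int (e * n) * c)"
      using shift[of i "int e * c" j] by (simp add: mult_ac)
  qed
  then show ?thesis by (simp only: image_image pt_period)
qed

lemma pt_in_cls_iff: "e > 0 \<Longrightarrow> pt (e * n) j \<in> cls e i \<longleftrightarrow> (\<exists>c. R i (j + int (e * n) * c))"
  using pt_in_image_iff[of "e * n" j "{j. R i j}"] n by simp

lemma cls_eq_iff: "e > 0 \<Longrightarrow> cls e i = cls e j \<longleftrightarrow> (\<exists>c. R i (j + int (e * n) * c))"
proof
  assume "e > 0" "cls e i = cls e j"
  moreover have "pt (e * n) j \<in> cls e j" using refl by blast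
  ultimately show "\<exists>c. R i (j + int (e * n) * c)" using pt_in_cls_iff by blast
next
  assume "\<exists>c. R i (j + int (e * n) * c)"
  then obtain c where "R i (j + int (e * n) * c)" by blast
  then show "cls e i = cls e j" using cls_cong cls_shift by metis
qed

lemma partition_part:
  assumes e: "e > 0" shows "partition_on (mu (e * n)) (parts_of (e * n) R)"
proof (rule partition_onI)
  have N: "e * n > 0" using n e by simp
  show "\<Union> (parts_of (e * n) R) = mu (e * n)"
  proof safe
    fix z p assume "z \<in> p" "p \<in> parts_of (e * n) R"
    then show "z \<in> mu (e * n)" using pt_in_mu[OF N] by (auto simp: parts_of_def)
  next
    fix z assume "z \<in> mu (e * n)"
    then obtain j where j: "z = pt (e * n) j" using mu_obtain[OF N] by metis
    then have "z \<in> cls e j" using refl by blast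
    then show "z \<in> \<Union> (parts_of (e * n) R)" unfolding parts_of_def by blast
  qed
  show "{} \<notin> parts_of (e * n) R" using refl by (auto simp: parts_of_def)
  fix p q assume "p \<in> parts_of (e * n) R" "q \<in> parts_of (e * n) R" "p \<noteq> q"
  then obtain i j where ij: "p = cls e i" "q = cls e j" by (auto simp: parts_of_def)
  show "disjnt p q"
  proof (rule ccontr)
    assume "\<not> disjnt p q"
    then obtain z where z: "z \<in> cls e i" "z \<in> cls e j" by (auto simp: disjnt_def ij)
    then obtain k where k: "z = pt (e * n) k" by blast
    have "\<exists>c. R i (k + int (e * n) * c)" "\<exists>c. R j (k + int (e * n) * c)"
      using z unfolding k pt_in_cls_iff[OF e] by blast+
    then have "cls e i = cls e k" "cls e j = cls e k" using cls_eq_iff[OF e] by blast+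
    then show False using \<open>p \<noteq> q\<close> ij by simp
  qed
qed

text \<open>The value -1 of k or l means that the relation wraps around the circle. In each of the
  four cases a cyclic rotation of the quadruple brings the related representatives into crossing
  position on the line.\<close>

lemma cls_cross:
  assumes e: "e > 0" and abcd: "a < b" "b < c" "c < d" "d < a + int (e * n)"
    and k: "R a (c + int (e * n) * k)" "k = 0 \<or> k = - 1"
    and l: "R b (d + int (e * n) * l)" "l = 0 \<or> l = - 1"
  shows "cls e a = cls e b"
proof -
  define N where "N = int (e * n)"
  have sh: "R (i - N) (j - N) \<longleftrightarrow> R i j" for i j
    using shift[of "i - N" "int e" "j - N"] by (simp add: N_def mult.commute)
  note * = abcd[folded N_def] k[folded N_def] l[folded N_def]
  have "\<exists>h. R a (b + N * h)"
  proof -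
    consider "k = 0" "l = 0" | "k = 0" "l = - 1" | "k = - 1" "l = 0" | "k = - 1" "l = - 1" using k l by blast
    then show ?thesis
    proof cases
      case 1
      then have "R a b" using cross[of a b c d] * by simp
      then show ?thesis by (intro exI[of _ 0]) simp
    next
      case 2
      then have "R (d - N) a" using cross[of "d - N" a b c] * sym by simp
      moreover have "R b (d - N)" using 2 * by simp
      ultimately have "R a b" using sym trans by blast
      then show ?thesis by (intro exI[of _ 0]) simp
    next
      case 3
      then have "R (b - N) (c - N)" using cross[of "b - N" "c - N" "d - N" a] * sym sh[of b d] by simp
      moreover have "R a (c - N)" using 3 * by simp
      ultimately have "R a (b - N)" using sym trans by blast
      then show ?thesis by (intro exI[of _ "- 1"]) simp
    next
      case 4
      then have "R (c - N) (d - N)" using cross[of "c - N" "d - N" a b] * sym by simp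
      moreover have "R a (c - N)" "R b (d - N)" using 4 * by simp_all
      ultimately have "R a b" using sym trans by blast
      then show ?thesis by (intro exI[of _ 0]) simp
    qed
  qed
  then show ?thesis using cls_eq_iff[OF e] by (simp add: N_def)
qed

lemma part_in_NCP:
  assumes e: "e > 0"
    and cr: "\<And>a b c d. a < b \<Longrightarrow> b < c \<Longrightarrow> c < d \<Longrightarrow> d < a + int (e * n) \<Longrightarrow> cls e a = cls e c \<Longrightarrow>
      cls e b = cls e d \<Longrightarrow> cls e a = cls e b"
  shows "parts_of (e * n) R \<in> NCP (mu (e * n))"
proof -
  have N: "e * n > 0" using e n by simp
  note P = partition_part[OF e]
  have "p = q" if pq: "p \<in> parts_of (e * n) R" "q \<in> parts_of (e * n) R" "convex hull p \<inter> convex hull q \<noteq> {}" for p q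
  proof (rule ccontr)
    assume "p \<noteq> q"
    then have dis: "p \<inter> q = {}" using partition_onD2[OF P] pq by (auto simp: disjoint_def)
    have "p \<subseteq> mu (e * n)" "q \<subseteq> mu (e * n)" using partition_onD1[OF P] pq by auto
    then have "crossing (e * n) p q" using hull_disjoint_iff[OF N _ _ dis] pq(3) by blast
    then obtain a b c d where abcd: "a < b" "b < c" "c < d" "d < a + int (e * n)"
      "pt (e * n) a \<in> p" "pt (e * n) b \<in> q" "pt (e * n) c \<in> p" "pt (e * n) d \<in> q"
      by (auto simp: crossing_def)
    obtain i j where ij: "p = cls e i" "q = cls e j" using pq by (auto simp: parts_of_def)
    have "p = cls e a" "p = cls e c" "q = cls e b" "q = cls e d"
      using abcd(5-8) pt_in_cls_iff[OF e] cls_eq_iff[OF e] unfolding ij by metis+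
    then show False using cr[OF abcd(1-4)] \<open>p \<noteq> q\<close> by simp
  qed
  then show ?thesis using P by (auto simp: NCP_def)
qed

text \<open>Noncentral classes span less than n \<le> e n / 2, so related representatives differ
  from the given ones by at most one turn and \<open>cls_cross\<close> applies. A central class is
  treated directly, as all its translates are related.\<close>

lemma cls_cross_invariant:
  assumes e: "e \<ge> 2" and abcd: "a < b" "b < c" "c < d" "d < a + int (e * n)"
    and eq: "cls e a = cls e c" "cls e b = cls e d"
  shows "cls e a = cls e b"
proof -
  have e0: "e > 0" using e by simp
  define N where "N = int (e * n)"
  have N: "2 * int n \<le> N" using two_periods[OF e] by (simp add: N_def)
  have cenN: "R i (i + N * c)" if "cen i" for i c
    using cen_shift[OF that, of "int e * c"] by (simp add: N_def mult_ac)
  have shN: "R (i + N * c) (j + N * c) \<longleftrightarrow> R i j" for i j c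
    using shift[of i "int e * c" j] by (simp add: N_def mult_ac)
  note * = abcd[folded N_def]
  \<comment> \<open>With a central, a and c are related without any translation. According to the
    position of d + N l, the relation of b crosses that of a with c or that of a with a + N.\<close>
  have main: "cls e a = cls e b" if *: "a < b" "b < c" "c < d" "d < a + N" and eq: "cls e a = cls e c" "cls e b = cls e d" and cen: "cen a" for a b c d
  proof -
    obtain k where "R a (c + N * k)" using eq(1) unfolding cls_eq_iff[OF e0] N_def by blast
    then have "cen (c + N * k)" using cen cen_cong by blast
    then have "cen c" using shN[of c k "c + int n"] by (simp add: add_ac)
    then have ac: "R a c" using cen cen_cen by blast
    obtain l where l: "R b (d + N * l)" using eq(2) unfolding cls_eq_iff[OF e0] N_def by blast
    have "R a b"
    proof -
      consider "l = 0" | "l \<le> - 1" | "1 \<le> l" by linarith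
      then show ?thesis
      proof cases
        case 1
        then show ?thesis using cross[of a b c d] * ac l by simp
      next
        case 2
        then have "N * l \<le> N * (- 1)" using N by (intro mult_left_mono) auto
        then have "d + N * l < a" using * by simp
        then have "R (d + N * l) a" using cross[of "d + N * l" a b c] * ac l sym by simp
        then show ?thesis using l sym trans by blast
      next
        case 3
        then have "N * 1 \<le> N * l" using N by (intro mult_left_mono) auto
        then have "a + N < d + N * l" using * by linarith
        then show ?thesis using cross[of a b "a + N" "d + N * l"] * cenN[OF cen, of 1] l by simp
      qed
    qed
    then show ?thesis by (rule cls_cong)
  qed
  \<comment> \<open>The representatives are less than n apart, c - a is between 0 and N, and 2 n
    \<le> N.\<close>
  have kk: "k = 0 \<or> k = - 1" if k: "R a (c + N * k)" "\<not> cen a" "a < c" "c < a + N" for a c k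
  proof -
    have d: "\<bar>a - (c + N * k)\<bar> < int n" using noncen_dist[OF k(2,1)] .
    have "k < 1"
    proof (rule ccontr)
      assume "\<not> k < 1"
      then have "N * 1 \<le> N * k" using N by (intro mult_left_mono) auto
      then show False using d k N by linarith
    qed
    moreover have "- 2 < k"
    proof (rule ccontr)
      assume "\<not> - 2 < k"
      then have "N * k \<le> N * (- 2)" using N by (intro mult_left_mono) auto
      then show False using d k N by linarith
    qed
    ultimately show ?thesis by linarith
  qed
  show ?thesis
  proof (cases "cen a")
    case True
    then show ?thesis using main * eq by blast
  next
    case na: False
    show ?thesis
    proof (cases "cen b")
      case True
      have "cls e (a + N) = cls e a" using cls_shift[of e a 1] by (simp add: N_def)
      then have "cls e b = cls e c" using main[of b c d "a + N"] * eq True by simp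
      then show ?thesis using eq by simp
    next
      case nb: False
      obtain k where k: "R a (c + N * k)" using eq(1) unfolding cls_eq_iff[OF e0] N_def by blast
      obtain l where l: "R b (d + N * l)" using eq(2) unfolding cls_eq_iff[OF e0] N_def by blast
      have "k = 0 \<or> k = - 1" using kk[OF k na] * by simp
      moreover have "l = 0 \<or> l = - 1" using kk[OF l nb] * by simp
      ultimately show ?thesis using cls_cross[OF e0 abcd] k l by (simp add: N_def)
    qed
  qed
qed

lemma pt_mult_cls: "pt (e * n) (int n * k) * z \<in> cls e (i + int n * k) \<longleftrightarrow> z \<in> cls e i" if e: "e > 0"
proof -
  have *: "(\<lambda>z. pt (e * n) (int n * k) * z) ` cls e i \<subseteq> cls e (i + int n * k)" for i k
  proof safe
    fix j assume "R i j"
    then have "R (i + int n * k) (j + int n * k)" by (simp add: shift)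
    moreover have "pt (e * n) (int n * k) * pt (e * n) j = pt (e * n) (j + int n * k)" by (simp add: pt_add)
    ultimately show "pt (e * n) (int n * k) * pt (e * n) j \<in> cls e (i + int n * k)" by (metis imageI mem_Collect_eq)
  qed
  have inv: "pt (e * n) (int n * (- k)) * pt (e * n) (int n * k) = 1"
    by (simp add: pt_add[symmetric])
  show ?thesis
  proof
    assume a: "pt (e * n) (int n * k) * z \<in> cls e (i + int n * k)"
    then have "pt (e * n) (int n * (- k)) * (pt (e * n) (int n * k) * z) \<in> cls e (i + int n * k + int n * (- k))"
      using *[of "- k" "i + int n * k"] by blast
    then show "z \<in> cls e i" unfolding mult.assoc[symmetric] inv by simp
  qed (use * in blast)
qed

lemma pt_mult_image: "(\<lambda>z. pt (e * n) (int n * k) * z) ` cls e i = cls e (i + int n * k)" if e: "e > 0"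
proof
  show "(\<lambda>z. pt (e * n) (int n * k) * z) ` cls e i \<subseteq> cls e (i + int n * k)"
    using pt_mult_cls[OF e] by blast
  have inv: "pt (e * n) (int n * k) * pt (e * n) (int n * (- k)) = 1"
    by (simp add: pt_add[symmetric])
  show "cls e (i + int n * k) \<subseteq> (\<lambda>z. pt (e * n) (int n * k) * z) ` cls e i"
  proof
    fix w assume "w \<in> cls e (i + int n * k)"
    moreover have w: "w = pt (e * n) (int n * k) * (pt (e * n) (int n * (- k)) * w)"
      unfolding mult.assoc[symmetric] inv by simp
    ultimately have "pt (e * n) (int n * (- k)) * w \<in> cls e i" using pt_mult_cls[OF e] by metis
    then show "w \<in> (\<lambda>z. pt (e * n) (int n * k) * z) ` cls e i" using w by blast
  qed
qed

lemma pt_reduce: "pt (e * n) (int n * k) = pt e k"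
  using n by (simp add: pt_def mult.assoc)

lemma part_in_NCP_e_1:
  assumes e: "e \<ge> 2" shows "parts_of (e * n) R \<in> NCP_e_1 e n"
proof -
  have e0: "e > 0" using e by simp
  have "(\<lambda>p. (\<lambda>z. \<zeta> * z) ` p) ` parts_of (e * n) R = parts_of (e * n) R" if z: "\<zeta> \<in> mu e" for \<zeta>
  proof -
    obtain k where k: "\<zeta> = pt (e * n) (int n * k)" using mu_obtain[OF e0 z] pt_reduce by metis
    have "(\<lambda>p. (\<lambda>z. \<zeta> * z) ` p) ` parts_of (e * n) R = range (\<lambda>i. cls e (i + int n * k))"
      unfolding parts_of_def k image_image[of _ "\<lambda>i. cls e i"] by (simp add: pt_mult_image[OF e0])
    also have "\<dots> = range (\<lambda>i. cls e i)"
    proof safe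
      fix i
      have "cls e ((i - int n * k) + int n * k) \<in> range (\<lambda>i. cls e (i + int n * k))" by (rule rangeI)
      then show "cls e i \<in> range (\<lambda>i. cls e (i + int n * k))" by (simp only: diff_add_cancel)
    qed auto
    finally show ?thesis by (simp only: parts_of_def)
  qed
  moreover have "parts_of (e * n) R \<in> NCP (mu (e * n))"
    by (rule part_in_NCP[OF e0], rule cls_cross_invariant[OF e])
  ultimately show ?thesis by (simp add: NCP_e_1_def)
qed

end

text \<open>Inclusion of parts determines related indices only up to multiples of e n; the
  assumption \<open>short\<close> removes this ambiguity.\<close>

lemma part_le_iff:
  assumes n: "n > 0" and R: "ncrel n R" and R': "ncrel n R'" and e: "e > 0"
    and short: "\<And>i j d. R i j \<Longrightarrow> pt (e * n) ` {j. R i j} \<subseteq> pt (e * n) ` {j. R' i j} \<Longrightarrow> R' i (j + int (e * n) * d) \<Longrightarrow> R' i j"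
  shows "parts_of (e * n) R \<preceq> parts_of (e * n) R' \<longleftrightarrow> R \<le> R'"
proof
  interpret A: noncrossing n R using n R by unfold_locales
  interpret B: noncrossing n R' using n R' by unfold_locales
  show "parts_of (e * n) R \<preceq> parts_of (e * n) R'" if "R \<le> R'"
    unfolding refines_def parts_of_def using that by (auto simp: le_fun_def)
  assume le: "parts_of (e * n) R \<preceq> parts_of (e * n) R'"
  show "R \<le> R'"
  proof (intro le_funI le_boolI)
    fix i j assume Rij: "R i j"
    have "\<exists>k. A.cls e i \<subseteq> B.cls e k" using le by (simp add: refines_def parts_of_def)
    then obtain k where k: "A.cls e i \<subseteq> B.cls e k" by blast
    have "pt (e * n) i \<in> B.cls e k" using k A.refl by blast
    then have "B.cls e k = B.cls e i" using B.pt_in_cls_iff[OF e] B.cls_eq_iff[OF e] by blast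
    then have sub: "A.cls e i \<subseteq> B.cls e i" using k by simp
    then have "pt (e * n) j \<in> B.cls e i" using Rij by blast
    then show "R' i j" using short[OF Rij sub] B.pt_in_cls_iff[OF e] by blast
  qed
qed

lemma part_le_iff_invariant:
  assumes n: "n > 0" and R: "ncrel n R" and R': "ncrel n R'" and e: "e \<ge> 2"
  shows "parts_of (e * n) R \<preceq> parts_of (e * n) R' \<longleftrightarrow> R \<le> R'"
proof (rule part_le_iff[OF n R R'])
  interpret A: noncrossing n R using n R by unfold_locales
  interpret B: noncrossing n R' using n R' by unfold_locales
  show e0: "e > 0" using e by simp
  note N = two_periods[OF e, of n]
  fix i j d assume Rij: "R i j" and sub: "A.cls e i \<subseteq> B.cls e i" and d: "R' i (j + int (e * n) * d)"
  show "R' i j"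
  proof (cases "B.cen i")
    case True
    then have "B.cen (j + int (e * n) * d)" using B.cen_cong[OF d] by simp
    then have "B.cen j" using B.shift[of j "int e * d" "j + int n"] by (simp add: algebra_simps)
    then show ?thesis using True B.cen_cen by blast
  next
    case False
    \<comment> \<open>Otherwise the noncentral class of i under R' would contain i + n (1 + e c) for
      some c. Its distance from i is a multiple of n below n, so 1 + e c = 0, which is impossible
      for e \<ge> 2.\<close>
    have "\<not> A.cen i"
    proof
      assume "A.cen i"
      then have "pt (e * n) (i + int n) \<in> B.cls e i" using sub by blast
      then obtain c where c: "R' i (i + int n + int (e * n) * c)" using B.pt_in_cls_iff[OF e0] by blast
      have "\<bar>i - (i + int n + int (e * n) * c)\<bar> < int n" using B.noncen_dist[OF False c] .
      moreover have "int n + int (e * n) * c = int n * (1 + int e * c)" by (simp add: distrib_left mult_ac)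
      ultimately have "\<bar>int n * (1 + int e * c)\<bar> < int n" by linarith
      then have "1 + int e * c = 0" by (rule abs_mult_less_self)
      then have "int e * c = - 1" by linarith
      then have "int e dvd 1" by (metis dvd_minus_iff dvd_triv_left)
      then show False using e by simp
    qed
    then have 1: "\<bar>i - j\<bar> < int n" using A.noncen_dist Rij by blast
    have 2: "\<bar>i - (j + int (e * n) * d)\<bar> < int n" using B.noncen_dist[OF False d] .
    \<comment> \<open>Two distances below n add up to less than 2 n \<le> e n.\<close>
    have "\<bar>int (e * n) * d\<bar> < int (e * n)" using 1 2 N by linarith
    then have "d = 0" by (rule abs_mult_less_self)
    then show ?thesis using d by simp
  qed
qed

section \<open>From partitions of the roots of unity to periodic relations\<close>

definition same_part :: "nat \<Rightarrow> complex set set \<Rightarrow> int \<Rightarrow> int \<Rightarrow> bool" where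
  "same_part N u i j \<longleftrightarrow> (\<exists>p\<in>u. pt N i \<in> p \<and> pt N j \<in> p)"

lemma same_part_props:
  assumes N: "N > 0" and u: "u \<in> NCP (mu N)"
  shows "same_part N u i i" "same_part N u i j \<Longrightarrow> same_part N u j i"
    "same_part N u i j \<Longrightarrow> same_part N u j k \<Longrightarrow> same_part N u i k"
    "same_part N u i (j + int N * c) \<longleftrightarrow> same_part N u i j"
    "a < b \<Longrightarrow> b < c' \<Longrightarrow> c' < d \<Longrightarrow> d < a + int N \<Longrightarrow> same_part N u a c' \<Longrightarrow> same_part N u b d \<Longrightarrow> same_part N u a b"
proof -
  have P: "partition_on (mu N) u" using u by (simp add: NCP_def)
  have uniq: "p = q" if "p \<in> u" "q \<in> u" "z \<in> p" "z \<in> q" for p q z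
    using partition_onD2[OF P] that by (auto simp: disjoint_def)
  show "same_part N u i i"
    using partition_onD1[OF P] pt_in_mu[OF N, of i] by (auto simp: same_part_def)
  show "same_part N u i j \<Longrightarrow> same_part N u j i" by (auto simp: same_part_def)
  show "same_part N u i j \<Longrightarrow> same_part N u j k \<Longrightarrow> same_part N u i k"
    using uniq unfolding same_part_def by metis
  show "same_part N u i (j + int N * c) \<longleftrightarrow> same_part N u i j" by (simp add: same_part_def)
  assume abcd: "a < b" "b < c'" "c' < d" "d < a + int N" "same_part N u a c'" "same_part N u b d"
  then obtain p q where pq: "p \<in> u" "q \<in> u" "pt N a \<in> p" "pt N c' \<in> p" "pt N b \<in> q" "pt N d \<in> q"
    by (auto simp: same_part_def)
  have "p = q"
  proof (rule ccontr)
    assume "p \<noteq> q"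
    then have "p \<inter> q = {}" using uniq pq by blast
    moreover have "p \<subseteq> mu N" "q \<subseteq> mu N" using partition_onD1[OF P] pq by auto
    moreover have "crossing N p q" using pq abcd unfolding crossing_def by blast
    ultimately have "convex hull p \<inter> convex hull q \<noteq> {}" using hull_disjoint_iff[OF N] by blast
    then show False using u pq \<open>p \<noteq> q\<close> by (auto simp: NCP_def)
  qed
  then show "same_part N u a b" using pq by (auto simp: same_part_def)
qed

lemma part_eq:
  assumes N: "N > 0" and u: "partition_on (mu N) u"
    and R: "\<And>i j. same_part N u i j \<longleftrightarrow> (\<exists>c. R i (j + int N * c))"
  shows "parts_of N R = u"
proof -
  have uniq: "p = q" if "p \<in> u" "q \<in> u" "z \<in> p" "z \<in> q" for p q z
    using partition_onD2[OF u] that by (auto simp: disjoint_def)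
  have cl: "pt N ` {j. R i j} = p" if p: "p \<in> u" "pt N i \<in> p" for p i
  proof safe
    fix j assume "R i j"
    then have "same_part N u i j" using R[of i j] by (auto intro: exI[of _ 0])
    then show "pt N j \<in> p" using uniq p unfolding same_part_def by blast
  next
    fix z assume z: "z \<in> p"
    then have "z \<in> mu N" using partition_onD1[OF u] p by auto
    then obtain j where j: "z = pt N j" using mu_obtain[OF N] by metis
    then have "same_part N u i j" using p z by (auto simp: same_part_def)
    then obtain c where "R i (j + int N * c)" using R by blast
    then have "pt N (j + int N * c) \<in> pt N ` {j. R i j}" by blast
    then show "z \<in> pt N ` {j. R i j}" using j by simp
  qed
  show ?thesis
  proof safe
    fix p assume "p \<in> parts_of N R"
    then obtain i where i: "p = pt N ` {j. R i j}" by (auto simp: parts_of_def)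
    have "pt N i \<in> \<Union> u" using partition_onD1[OF u] pt_in_mu[OF N] by simp
    then obtain q where "q \<in> u" "pt N i \<in> q" by blast
    then show "p \<in> u" using cl i by simp
  next
    fix p assume p: "p \<in> u"
    then obtain z where z: "z \<in> p" using partition_onD3[OF u] by fastforce
    then have "z \<in> mu N" using partition_onD1[OF u] p by auto
    then obtain i where "z = pt N i" using mu_obtain[OF N] by metis
    then show "p \<in> parts_of N R" using cl[OF p] z by (auto simp: parts_of_def)
  qed
qed

lemma decompose_period:
  assumes "n > 0" obtains c where "i \<le> j + int n * c" "j + int n * c < i + int n"
proof -
  have "(j - i) = int n * ((j - i) div int n) + (j - i) mod int n" by simp
  then have "j + int n * (- ((j - i) div int n)) = i + (j - i) mod int n" by (simp add: algebra_simps)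
  then show ?thesis using that[of "- ((j - i) div int n)"] assms by simp
qed

text \<open>The \<open>n\<close>-periodic relation on indices attached to an invariant noncrossing partition: the
  central part stays in one piece, any other part is split into its translates by \<open>e * n\<close>,
  each of which fits in a window of length \<open>n\<close>.\<close>

locale invariant_relation =
  fixes n :: nat and N :: int and S :: "int \<Rightarrow> int \<Rightarrow> bool"
  assumes n: "n > 0" and N: "2 * int n \<le> N"
    and S_refl: "S i i" and S_sym: "S i j \<Longrightarrow> S j i" and S_trans: "S i j \<Longrightarrow> S j k \<Longrightarrow> S i k"
    and S_period: "S i (j + N * c) \<longleftrightarrow> S i j"
    and S_shift: "S (i + int n) (j + int n) \<longleftrightarrow> S i j"
    and S_cross: "a < b \<Longrightarrow> b < c' \<Longrightarrow> c' < d \<Longrightarrow> d < a + N \<Longrightarrow> S a c' \<Longrightarrow> S b d \<Longrightarrow> S a b"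
begin

abbreviation cenS where "cenS i \<equiv> S i (i + int n)"

lemma cenS_cong:
  assumes "S i j" shows "cenS i \<longleftrightarrow> cenS j"
proof -
  have *: "S (i + int n) (j + int n)" using assms S_shift by simp
  show ?thesis
  proof
    assume "cenS i"
    then have "S i (j + int n)" using * by (rule S_trans)
    then show "cenS j" by (rule S_trans[OF S_sym[OF assms]])
  next
    assume "cenS j"
    then have "S i (j + int n)" by (rule S_trans[OF assms])
    then show "cenS i" using S_sym[OF *] by (rule S_trans)
  qed
qed

lemma S_shift_mult: "S (i + int n * k) (j + int n * k) \<longleftrightarrow> S i j"
proof (induction k rule: int_induct[of _ 0])
  case (step1 k)
  then show ?case using S_shift[of "i + int n * k" "j + int n * k"] by (simp add: algebra_simps)
next
  case (step2 k)
  then show ?case using S_shift[of "i + int n * (k - 1)" "j + int n * (k - 1)"] by (simp add: algebra_simps)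
qed simp

lemma cenS_shift: "cenS i \<Longrightarrow> S i (i + int n * k)"
proof (induction k rule: int_induct[of _ 0])
  case base show ?case by (simp add: S_refl)
next
  case (step1 k)
  then show ?case using S_shift_mult[of i k "i + int n"] S_trans[of i "i + int n * k" "i + int n * (k + 1)"]
    by (simp add: algebra_simps)
next
  case (step2 k)
  then show ?case using S_shift_mult[of i "k - 1" "i + int n"] S_trans[of i "i + int n * k" "i + int n * (k - 1)"] S_sym
    by (simp add: algebra_simps)
qed

lemma cenS_cenS: assumes "cenS i" "cenS j" shows "S i j"
proof -
  obtain c where c: "j - int n + 1 \<le> i + int n * c" "i + int n * c < j - int n + 1 + int n"
    using decompose_period[OF n, of "j - int n + 1" i] .
  define i' where "i' = i + int n * c"
  have i': "i' \<le> j" "j < i' + int n" using c by (simp_all add: i'_def)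
  have "S i' (i' + int n)" using S_shift_mult[of i c "i + int n"] assms(1) by (simp add: i'_def algebra_simps)
  then have "S i' j"
    using S_cross[of i' j "i' + int n" "j + int n"] i' N assms(2) S_refl by (cases "i' = j") auto
  moreover have "S i i'" using cenS_shift[OF assms(1)] by (simp add: i'_def)
  ultimately show ?thesis using S_trans by blast
qed

text \<open>The needed step for transitivity of \<open>lift\<close>: if two short steps add up to at
  least n, then the pair (j, k) crosses the translate (i + n, j + n) or ends at i + n, so i is
  related to i + n.\<close>

lemma three_cen:
  assumes "i < j" "j < k" "S i j" "S j k" "j - i < int n" "k - j < int n" "int n \<le> k - i" shows "cenS i"
proof (cases "k = i + int n")
  case True
  then show ?thesis using assms S_trans by blast
next
  case False
  have "S j (i + int n)"
    by (rule S_cross[of j "i + int n" k "j + int n"]) (use assms False N n S_shift[of i j] in auto)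
  then show ?thesis using assms S_trans by blast
qed

definition lift :: "int \<Rightarrow> int \<Rightarrow> bool" where
  "lift i j \<longleftrightarrow> S i j \<and> (\<bar>i - j\<bar> < int n \<or> cenS i)"

lemma ncrel_lift: "ncrel n lift"
  unfolding ncrel_def
proof (intro conjI allI impI)
  show "equivp lift"
  proof (rule equivpI)
    show "reflp lift" using S_refl n by (auto simp: lift_def reflp_def)
    show "symp lift" using S_sym cenS_cong by (auto simp: lift_def symp_def abs_minus_commute)
    show "transp lift"
    proof (rule transpI)
      fix i j k assume l: "lift i j" "lift j k"
      then have S: "S i j" "S j k" "S i k" using S_trans by (auto simp: lift_def)
      show "lift i k"
      proof (cases "cenS i")
        case False
        then have d: "\<bar>i - j\<bar> < int n" "\<bar>j - k\<bar> < int n" using l cenS_cong[OF S(1)] by (auto simp: lift_def)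
        have "\<bar>i - k\<bar> < int n"
        proof (rule ccontr)
          assume "\<not> \<bar>i - k\<bar> < int n"
          then consider "i < j" "j < k" "int n \<le> k - i" | "k < j" "j < i" "int n \<le> i - k" using d by linarith
          then show False
          proof cases
            case 1
            then show ?thesis using three_cen[of i j k] S d False by auto
          next
            case 2
            then have "cenS k" using three_cen[of k j i] S S_sym d by auto
            then show ?thesis using cenS_cong[OF S(3)] False by simp
          qed
        qed
        then show ?thesis using S by (simp add: lift_def)
      qed (use S in \<open>simp add: lift_def\<close>)
    qed
  qed
  show "lift (i + int n) (j + int n) \<longleftrightarrow> lift i j" for i j
    using S_shift[of i j] S_shift[of i "i + int n"] by (simp add: lift_def)
next
  fix i j k l assume *: "i < j" "j < k" "k < l" and "lift i k" "lift j l"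
  then have S: "S i k" "S j l" and d: "\<bar>i - k\<bar> < int n \<or> cenS i" "\<bar>j - l\<bar> < int n \<or> cenS j"
    by (auto simp: lift_def)
  show "lift i j"
  proof (cases "cenS i")
    case ci: True
    then have ck: "cenS k" using cenS_cong[OF S(1)] by simp
    show ?thesis
    proof (cases "cenS j")
      case True
      then show ?thesis using ci cenS_cenS by (simp add: lift_def)
    next
      case False
      then have lj: "l < j + int n" using d * by auto
      \<comment> \<open>The central point k has the translate k - n before j, and k - n < j < k < l
        crosses within one turn, so j would be central too.\<close>
      then have "k - int n < j" using * by simp
      moreover have "S (k - int n) k" using S_shift[of "k - int n" k] ck by simp
      ultimately have "S (k - int n) j" using S_cross[of "k - int n" j k l] * lj N S by auto
      moreover have "cenS (k - int n)" using \<open>S (k - int n) k\<close> by simp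
      ultimately show ?thesis using cenS_cong False by blast
    qed
  next
    case ci: False
    then have ki: "k < i + int n" using d * by auto
    show ?thesis
    proof (cases "cenS j")
      case True
      then have "S i j" using S_cross[of i j k "j + int n"] * ki N S by auto
      then show ?thesis using cenS_cong True ci by blast
    next
      case False
      then have "l < j + int n" using d * by auto
      then have "S i j" using S_cross[of i j k l] * ki N S by auto
      then show ?thesis using * ki by (simp add: lift_def)
    qed
  qed
qed

lemma S_iff_lift: "S i j \<longleftrightarrow> (\<exists>c. lift i (j + N * c))"
proof
  assume "\<exists>c. lift i (j + N * c)"
  then show "S i j" using S_period by (auto simp: lift_def)
next
  assume S: "S i j"
  show "\<exists>c. lift i (j + N * c)"
  proof (cases "cenS i")
    case True
    then show ?thesis using S by (intro exI[of _ 0]) (simp add: lift_def)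
  next
    case False
    have "nat N > 0" using N n by simp
    then obtain c where c: "i \<le> j + int (nat N) * c" "j + int (nat N) * c < i + int (nat N)" by (rule decompose_period)
    define j' where "j' = j + N * c"
    have j': "i \<le> j'" "j' < i + N" using c N n by (simp_all add: j'_def)
    have S': "S i j'" using S S_period by (simp add: j'_def)
    \<comment> \<open>Up to full turns j is close to i from above, close to it from below, or far
      away on the circle. In the last case the pair (i, j') crosses or touches its translate by n,
      and i is central.\<close>
    consider "j' < i + int n" | "i + N - int n < j'" | "i + int n \<le> j'" "j' \<le> i + N - int n" by linarith
    then show ?thesis
    proof cases
      case 1
      then have "lift i (j + N * c)" using S' j' by (simp add: lift_def j'_def)
      then show ?thesis by blast
    next
      case 2
      have eq: "j + N * (c - 1) = j' - N" by (simp add: j'_def algebra_simps)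
      have "S i (j + N * (c - 1))" using S S_period by simp
      then have "lift i (j + N * (c - 1))" unfolding eq using 2 j' by (simp add: lift_def)
      then show ?thesis by blast
    next
      case 3
      have "cenS i"
      proof (cases "j' = i + int n \<or> j' = i + N - int n")
        case True
        then show ?thesis
        proof
          assume "j' = i + N - int n"
          then have "j' = i - int n + N * 1" by simp
          then have "S i (i - int n + N * 1)" using S' by metis
          then have "S i (i - int n)" unfolding S_period .
          then have "S (i + int n) i" using S_shift[of i "i - int n"] by simp
          then show ?thesis by (rule S_sym)
        qed (use S' in simp)
      next
        case F: False
        show ?thesis
          by (rule S_cross[of i "i + int n" j' "j' + int n"]) (use F 3 n S' S_shift in auto)
      qed
      then show ?thesis using False by simp
    qed
  qed
qed

end

lemma part_surj_invariant:
  assumes e: "e \<ge> 2" "n > 0" and u: "u \<in> NCP_e_1 e n"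
  obtains R where "ncrel n R" "parts_of (e * n) R = u"
proof -
  have N: "e * n > 0" using e by simp
  have u': "u \<in> NCP (mu (e * n))" using u by (simp add: NCP_e_1_def)
  then have P: "partition_on (mu (e * n)) u" by (simp add: NCP_def)
  note S = same_part_props[OF N u']
  have z: "pt (e * n) (int n) \<in> mu e" "pt (e * n) (- int n) \<in> mu e"
  proof -
    have "pt (e * n) (int n * k) = pt e k" for k using e(2) by (simp add: pt_def mult.assoc)
    then show "pt (e * n) (int n) \<in> mu e" "pt (e * n) (- int n) \<in> mu e"
      using pt_in_mu[of e] e by (metis mult_1_right not_numeral_le_zero zero_less_iff_neq_zero, metis mult_minus1_right not_numeral_le_zero zero_less_iff_neq_zero)
  qed
  have inv: "same_part (e * n) u (i + k) (j + k)" if "same_part (e * n) u i j" "pt (e * n) k \<in> mu e" for i j k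
  proof -
    obtain p where p: "p \<in> u" "pt (e * n) i \<in> p" "pt (e * n) j \<in> p" using \<open>same_part (e * n) u i j\<close> by (auto simp: same_part_def)
    have "(\<lambda>z. pt (e * n) k * z) ` p \<in> u" using u that(2) p(1) by (force simp: NCP_e_1_def)
    moreover have "pt (e * n) (i + k) \<in> (\<lambda>z. pt (e * n) k * z) ` p" "pt (e * n) (j + k) \<in> (\<lambda>z. pt (e * n) k * z) ` p"
      using p by (auto simp: pt_add)
    ultimately show ?thesis
      unfolding same_part_def by (intro bexI[of _ "(\<lambda>z. pt (e * n) k * z) ` p"] conjI)
  qed
  interpret I: invariant_relation n "int (e * n)" "same_part (e * n) u"
  proof
    show "2 * int n \<le> int (e * n)" by (rule two_periods[OF e(1)])
    show "same_part (e * n) u (i + int n) (j + int n) \<longleftrightarrow> same_part (e * n) u i j" for i j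
    proof
      assume "same_part (e * n) u (i + int n) (j + int n)"
      from inv[OF this z(2)] show "same_part (e * n) u i j" by simp
    qed (rule inv[OF _ z(1)])
  qed (use S e in blast)+
  have "parts_of (e * n) I.lift = u"
    by (rule part_eq[OF N P]) (rule I.S_iff_lift)
  then show ?thesis using that I.ncrel_lift by blast
qed

text \<open>For type (1,1) the circle is cut open between the indices n - 1 and n. The parts become
  classes inside the windows, so that no class is central and NCP(1,1,n) is the set of codes below
  this relation.\<close>

definition window :: "nat \<Rightarrow> int \<Rightarrow> int \<Rightarrow> bool" where
  "window n i j \<longleftrightarrow> i div int n = j div int n"

lemma div_add_period: "n > 0 \<Longrightarrow> (i + int n * c) div int n = i div int n + c"
  by simp

lemma div_less_period:
  assumes "n > 0" "i \<le> j" "j < i + int n" shows "j div int n = i div int n \<or> j div int n = i div int n + 1"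
proof -
  have "i div int n \<le> j div int n" using assms by (intro zdiv_mono1) auto
  moreover have "j div int n \<le> (i + int n * 1) div int n" using assms by (intro zdiv_mono1) auto
  ultimately show ?thesis using div_add_period[OF assms(1), of i 1] by linarith
qed

lemma part_surj_window:
  assumes n: "n > 0" and u: "u \<in> NCP (mu n)"
  obtains R where "ncrel n R" "R \<le> window n" "parts_of n R = u"
proof -
  have P: "partition_on (mu n) u" using u by (simp add: NCP_def)
  note S = same_part_props[OF n u]
  define R where "R i j \<longleftrightarrow> same_part n u i j \<and> window n i j" for i j
  have eqv: "equivp R"
  proof (rule equivpI)
    show "reflp R" using S(1) by (simp add: reflp_def R_def window_def)
    show "symp R" using S(2) by (simp add: symp_def R_def window_def)
    show "transp R" by (rule transpI) (metis R_def S(3) window_def)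
  qed
  have sh: "R (i + int n) (j + int n) \<longleftrightarrow> R i j" for i j
  proof -
    have p1: "pt n (i + int n) = pt n i" for i using pt_period[of n i 1] by simp
    have "window n (i + int n) (j + int n) \<longleftrightarrow> window n i j"
      using div_add_period[OF n, of i 1] div_add_period[OF n, of j 1] by (simp add: window_def)
    then show ?thesis by (simp add: R_def same_part_def p1)
  qed
  have cr: "R i j" if *: "i < j" "j < k" "k < l" "R i k" "R j l" for i j k l
  proof -
    have d: "i div int n \<le> j div int n" "j div int n \<le> k div int n" using * n by (auto intro: zdiv_mono1)
    then have w: "window n i j" "window n i l" using * by (auto simp: R_def window_def)
    have "l < i + int n"
    proof (rule ccontr)
      assume "\<not> l < i + int n"
      then have "(i + int n * 1) div int n \<le> l div int n" using n by (intro zdiv_mono1) auto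
      then show False using w n by (simp add: window_def)
    qed
    then have "same_part n u i j" using S(5)[of i j k l] * by (auto simp: R_def)
    then show ?thesis using w by (simp add: R_def)
  qed
  have "ncrel n R" unfolding ncrel_def using eqv sh cr by blast
  moreover have "same_part n u i j \<longleftrightarrow> (\<exists>c. R i (j + int n * c))" for i j
  proof
    assume "same_part n u i j"
    moreover have "window n i (j + int n * (i div int n - j div int n))"
      unfolding window_def div_add_period[OF n] by simp
    ultimately show "\<exists>c. R i (j + int n * c)" using S(4) by (auto simp: R_def)
  qed (use S(4) in \<open>auto simp: R_def\<close>)
  then have "parts_of n R = u" by (rule part_eq[OF n P])
  moreover have "R \<le> window n" by (auto simp: R_def)
  ultimately show ?thesis using that by blast
qed

lemma part_in_NCP_window:
  assumes n: "n > 0" and R: "ncrel n R" and w: "R \<le> window n"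
  shows "parts_of n R \<in> NCP (mu n)"
proof -
  interpret noncrossing n R using n R by unfold_locales
  have "parts_of (1 * n) R \<in> NCP (mu (1 * n))"
  proof (rule part_in_NCP)
    fix a b c d assume abcd: "a < b" "b < c" "c < d" "d < a + int (1 * n)"
      and eq: "cls 1 a = cls 1 c" "cls 1 b = cls 1 d"
    have kk: "k = 0 \<or> k = - 1" if "R a (c + int (1 * n) * k)" "a < c" "c < a + int n" for a c k
    proof -
      have "window n a (c + int n * k)" using w that by auto
      then have "a div int n = c div int n + k" using div_add_period[OF n, of c k] by (simp add: window_def)
      then show ?thesis using div_less_period[OF n, of a c] that by auto
    qed
    obtain k where k: "R a (c + int (1 * n) * k)" using eq(1) unfolding cls_eq_iff[OF zero_less_one] by blast
    obtain l where l: "R b (d + int (1 * n) * l)" using eq(2) unfolding cls_eq_iff[OF zero_less_one] by blast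
    show "cls 1 a = cls 1 b"
      by (rule cls_cross[OF _ abcd k _ l]) (use kk[OF k] kk[OF l] abcd in auto)
  qed simp
  then show ?thesis by simp
qed

lemma part_le_iff_window:
  assumes n: "n > 0" and R: "ncrel n R" "R \<le> window n" and R': "ncrel n R'" "R' \<le> window n"
  shows "parts_of n R \<preceq> parts_of n R' \<longleftrightarrow> R \<le> R'"
proof -
  have "parts_of (1 * n) R \<preceq> parts_of (1 * n) R' \<longleftrightarrow> R \<le> R'"
  proof (rule part_le_iff[OF n R(1) R'(1)])
    fix i j d assume "R i j" "R' i (j + int (1 * n) * d)"
    moreover from this have "window n i j" "window n i (j + int n * d)" using R R' by auto
    then have "d = 0" using n by (simp add: window_def)
    ultimately show "R' i j" by simp
  qed simp
  then show ?thesis by simp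
qed

section \<open>Codes as names for partitions of the roots of unity\<close>

lemma codes_bij_invariant:
  assumes e: "e \<ge> 2" "n > 0"
  shows "bij_betw (\<lambda>b. parts_of (e * n) (rel b)) (codes n) (NCP_e_1 e n)"
  unfolding bij_betw_def
proof
  have nc: "ncrel n (rel b)" if "b \<in> codes n" for b by (rule ncrel_rel[OF codes_periodic[OF that]])
  show "inj_on (\<lambda>b. parts_of (e * n) (rel b)) (codes n)"
  proof (rule inj_onI)
    fix b b' assume b: "b \<in> codes n" "b' \<in> codes n" and eq: "parts_of (e * n) (rel b) = parts_of (e * n) (rel b')"
    have "parts_of (e * n) (rel b) \<preceq> parts_of (e * n) (rel b)" by (auto simp: refines_def)
    then have "rel b \<le> rel b'" "rel b' \<le> rel b"
      using part_le_iff_invariant[OF e(2) nc nc e(1)] b eq by metis+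
    then have "rel b = rel b'" by simp
    then show "b = b'" using code_rel[OF _ e(2)] b by metis
  qed
  show "(\<lambda>b. parts_of (e * n) (rel b)) ` codes n = NCP_e_1 e n"
  proof safe
    fix b assume b: "b \<in> codes n"
    interpret noncrossing n "rel b" using e nc[OF b] by unfold_locales
    show "parts_of (e * n) (rel b) \<in> NCP_e_1 e n" by (rule part_in_NCP_e_1[OF e(1)])
  next
    fix u assume "u \<in> NCP_e_1 e n"
    then obtain R where R: "ncrel n R" "parts_of (e * n) R = u" by (rule part_surj_invariant[OF e])
    interpret noncrossing n R using e R by unfold_locales
    show "u \<in> (\<lambda>b. parts_of (e * n) (rel b)) ` codes n"
      using rel_code code_in_codes R by (intro image_eqI[of _ _ "code n R"]) auto
  qed
qed

lemma codes_bij_window: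
  assumes n: "n > 0"
  shows "bij_betw (\<lambda>b. parts_of n (rel b)) {b\<in>codes n. rel b \<le> window n} (NCP_1_1 n)"
  unfolding bij_betw_def
proof
  have nc: "ncrel n (rel b)" if "b \<in> codes n" for b by (rule ncrel_rel[OF codes_periodic[OF that]])
  show "inj_on (\<lambda>b. parts_of n (rel b)) {b\<in>codes n. rel b \<le> window n}"
  proof (rule inj_onI)
    fix b b' assume b: "b \<in> {b\<in>codes n. rel b \<le> window n}" "b' \<in> {b\<in>codes n. rel b \<le> window n}"
      and eq: "parts_of n (rel b) = parts_of n (rel b')"
    have "parts_of n (rel b) \<preceq> parts_of n (rel b)" by (auto simp: refines_def)
    moreover have "parts_of n (rel b) \<preceq> parts_of n (rel b') \<longleftrightarrow> rel b \<le> rel b'"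
      "parts_of n (rel b') \<preceq> parts_of n (rel b) \<longleftrightarrow> rel b' \<le> rel b"
      by (rule part_le_iff_window[OF n nc _ nc]; use b in simp)+
    ultimately have "rel b = rel b'" using eq by simp
    then have "code n (rel b) = code n (rel b')" by (rule arg_cong)
    moreover have "code n (rel b) = b" "code n (rel b') = b'" using b n by (auto intro: code_rel)
    ultimately show "b = b'" by simp
  qed
  show "(\<lambda>b. parts_of n (rel b)) ` {b\<in>codes n. rel b \<le> window n} = NCP_1_1 n"
  proof (intro equalityI subsetI)
    fix u assume "u \<in> (\<lambda>b. parts_of n (rel b)) ` {b\<in>codes n. rel b \<le> window n}"
    then obtain b where "b \<in> {b\<in>codes n. rel b \<le> window n}" and u: "u = parts_of n (rel b)" by (rule imageE)
    then have b: "b \<in> codes n" "rel b \<le> window n" by (simp_all only: mem_Collect_eq)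
    show "u \<in> NCP_1_1 n"
      unfolding NCP_1_1_def u by (rule part_in_NCP_window[OF n nc[OF b(1)] b(2)])
  next
    fix u assume "u \<in> NCP_1_1 n"
    then obtain R where R: "ncrel n R" "R \<le> window n" "parts_of n R = u"
      unfolding NCP_1_1_def by (rule part_surj_window[OF n])
    interpret noncrossing n R using n R by unfold_locales
    show "u \<in> (\<lambda>b. parts_of n (rel b)) ` {b\<in>codes n. rel b \<le> window n}"
    proof (rule image_eqI)
      show "u = parts_of n (rel (code n R))" by (simp only: rel_code R(3))
      show "code n R \<in> {b\<in>codes n. rel b \<le> window n}"
        by (simp only: mem_Collect_eq rel_code R(2) code_in_codes)
    qed
  qed
qed

section \<open>Zeta functions\<close>

lemma chains_iso:
  assumes bij: "bij_betw \<Phi> Q P" and le: "\<And>x y. x \<in> Q \<Longrightarrow> y \<in> Q \<Longrightarrow> le (\<Phi> x) (\<Phi> y) \<longleftrightarrow> le' x y"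
  shows "zeta P le X = zeta Q le' X"
proof -
  have im: "\<Phi> ` Q = P" and inj: "inj_on \<Phi> Q" using bij by (auto simp: bij_betw_def)
  have sw: "sorted_wrt le (map \<Phi> ps) \<longleftrightarrow> sorted_wrt le' ps" if "set ps \<subseteq> Q" for ps
    using that by (induction ps) (auto simp: le subset_iff)
  have "bij_betw (map \<Phi>) (chains Q le' m) (chains P le m)" for m
    unfolding bij_betw_def
  proof
    show "inj_on (map \<Phi>) (chains Q le' m)"
      by (rule inj_onI) (use inj in \<open>auto simp: chains_def intro!: map_inj_on[of \<Phi>] elim: inj_on_subset\<close>)
    show "map \<Phi> ` chains Q le' m = chains P le m"
    proof (intro equalityI subsetI)
      fix ps assume "ps \<in> map \<Phi> ` chains Q le' m"
      then show "ps \<in> chains P le m" using sw im by (fastforce simp: chains_def)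
    next
      fix ps assume ps: "ps \<in> chains P le m"
      define qs where "qs = map (inv_into Q \<Phi>) ps"
      have "set ps \<subseteq> \<Phi> ` Q" using ps im by (simp add: chains_def)
      then have q: "set qs \<subseteq> Q" "map \<Phi> qs = ps"
        by (auto simp: qs_def inv_into_into f_inv_into_f subset_iff intro!: map_idI)
      then have "qs \<in> chains Q le' m" using ps sw[of qs] by (auto simp: chains_def)
      then show "ps \<in> map \<Phi> ` chains Q le' m" using q by blast
    qed
  qed
  then show ?thesis unfolding zeta_def by (intro bij_betw_same_card[symmetric])
qed

text \<open>\<open>val m u\<close> is the number of chains of length m with all elements below u;
  the recursion removes the last, largest element v, and the greatest element mx imposes no
  bound.\<close>

lemma zeta_by_weight:
  assumes fin: "finite P" and trans: "\<And>x y z. x \<in> P \<Longrightarrow> y \<in> P \<Longrightarrow> z \<in> P \<Longrightarrow> le x y \<Longrightarrow> le y z \<Longrightarrow> le x z"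
    and mx: "mx \<in> P" "\<And>x. x \<in> P \<Longrightarrow> le x mx"
    and val_0: "\<And>u. u \<in> P \<Longrightarrow> val 0 u = 1"
    and val_Suc: "\<And>m u. u \<in> P \<Longrightarrow> val (Suc m) u = (\<Sum>v\<in>{v\<in>P. le v u}. val m v)"
  shows "zeta P le (Suc m) = val m mx"
proof -
  let ?C = "\<lambda>m u. {ps\<in>chains P le m. \<forall>p\<in>set ps. le p u}"
  have finC: "finite (?C m u)" for m u
    by (rule finite_subset[of _ "{ps. set ps \<subseteq> P \<and> length ps = m}"])
       (auto simp: chains_def finite_lists_length_eq[OF fin])
  have card: "card (?C m u) = val m u" if "u \<in> P" for u
    using that
  proof (induction m arbitrary: u)
    case 0
    have "?C 0 u = {[]}" by (auto simp: chains_def)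
    then show ?case using val_0 0 by simp
  next
    case (Suc m)
    have "?C (Suc m) u = (\<Union>v\<in>{v\<in>P. le v u}. (\<lambda>ps. ps @ [v]) ` ?C m v)"
    proof (intro equalityI subsetI)
      fix ps assume "ps \<in> ?C (Suc m) u"
      then have ps: "length ps = Suc m" "set ps \<subseteq> P" "sorted_wrt le ps" "\<forall>p\<in>set ps. le p u"
        by (auto simp: chains_def)
      obtain qs v where qv: "ps = qs @ [v]" "length qs = m" using ps(1) by (auto simp: length_Suc_conv_rev)
      then have "v \<in> {v\<in>P. le v u}" "qs \<in> ?C m v" using ps by (auto simp: chains_def sorted_wrt_append)
      then show "ps \<in> (\<Union>v\<in>{v\<in>P. le v u}. (\<lambda>ps. ps @ [v]) ` ?C m v)" using qv by blast
    next
      fix ps assume "ps \<in> (\<Union>v\<in>{v\<in>P. le v u}. (\<lambda>ps. ps @ [v]) ` ?C m v)"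
      then obtain v qs where v: "v \<in> P" "le v u" "qs \<in> ?C m v" "ps = qs @ [v]" by blast
      then have "\<forall>p\<in>set qs. le p u" using trans[OF _ v(1) Suc.prems] by (auto simp: chains_def)
      then show "ps \<in> ?C (Suc m) u" using v by (auto simp: chains_def sorted_wrt_append)
    qed
    then have "card (?C (Suc m) u) = (\<Sum>v\<in>{v\<in>P. le v u}. card ((\<lambda>ps. ps @ [v]) ` ?C m v))"
      using fin finC by (simp only:) (rule card_UN_disjoint, auto)
    also have "\<dots> = (\<Sum>v\<in>{v\<in>P. le v u}. val m v)"
      by (rule sum.cong) (auto simp: card_image inj_on_def Suc.IH)
    finally show ?case using val_Suc Suc.prems by simp
  qed
  have "?C m mx = chains P le m" using mx(2) by (auto simp: chains_def)
  then show ?thesis using card[OF mx(1)] by (simp only: zeta_def diff_Suc_1)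
qed

text \<open>Without openers there is only the central class: this is the greatest element.\<close>

definition zero_code :: "int \<Rightarrow> nat" where "zero_code = (\<lambda>_. 0)"

lemma zero_code: "zero_code \<in> codes n" "mass n zero_code = 0" "rel zero_code x y" "central zero_code x"
proof -
  show "zero_code \<in> codes n" "mass n zero_code = 0" by (simp_all add: zero_code_def codes_def periodic_def mass_def)
  show c: "central zero_code x" for x
    using matched_start[of zero_code _ x] by (auto simp: central_def matched_refl_iff zero_code_def)
  show "rel zero_code x y" using c rel_central by blast
qed

lemma finite_codes: "n > 0 \<Longrightarrow> finite (codes n)"
  using below_weight(2)[OF zero_code(1)] zero_code(3) by (simp add: le_fun_def)

text \<open>At level 1 the series B = 1 + x B is the geometric series; this is the start of the
  recursion, where only the empty chain is counted.\<close>

lemma fuss_0_1: "fuss (Suc 0) k = 1"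
  using fuss_closed_form[of 0 k] by simp

lemma pweight_0: "pweight n (fuss (Suc 0)) b = 1"
  by (simp add: pweight_def fuss_0_1)

lemma pweight_zero_code: "pweight n (fuss t) zero_code = 1"
  by (simp add: pweight_def zero_code_def)

text \<open>The chain count below u is a binomial factor for the central class of size k = n -
  \<open>mass n u\<close> times the Fuss-Catalan factors of the blocks. \<open>below_weight\<close>
  and \<open>raney_binomial_convolution\<close> raise both from m to m + 1.\<close>

lemma zeta_invariant:
  assumes e: "e \<ge> 2" "n > 0"
  shows "zeta (NCP_e_1 e n) (\<preceq>) (Suc m) = (Suc m * n choose n)"
proof -
  have nc: "ncrel n (rel b)" if "b \<in> codes n" for b by (rule ncrel_rel[OF codes_periodic[OF that]])
  have "zeta (NCP_e_1 e n) (\<preceq>) (Suc m) = zeta (codes n) (\<lambda>b u. rel b \<le> rel u) (Suc m)"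
    by (rule chains_iso[OF codes_bij_invariant[OF e]]) (use part_le_iff_invariant[OF e(2) nc nc e(1)] in auto)
  also have "\<dots> = (Suc m * (n - mass n zero_code) choose (n - mass n zero_code)) * pweight n (fuss (Suc m)) zero_code"
  proof (rule zeta_by_weight[where val = "\<lambda>m u. (Suc m * (n - mass n u) choose (n - mass n u)) * pweight n (fuss (Suc m)) u"])
    fix m u assume u: "u \<in> codes n"
    let ?k = "n - mass n u"
    have "(\<Sum>v\<in>{v\<in>codes n. rel v \<le> rel u}. (Suc m * (n - mass n v) choose (n - mass n v)) * pweight n (fuss (Suc m)) v)
        = (\<Sum>j\<le>?k. raney (Suc m) j ?k * (Suc m * (?k - j) choose (?k - j))) * pweight n (fuss (Suc (Suc m))) u"
      by (rule below_weight(1)[OF u e(2)])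
    also have "(\<Sum>j\<le>?k. raney (Suc m) j ?k * (Suc m * (?k - j) choose (?k - j))) = (Suc (Suc m) * ?k choose ?k)"
      unfolding raney_binomial_convolution by (simp only: mult_Suc add.commute)
    finally show "(Suc (Suc m) * ?k choose ?k) * pweight n (fuss (Suc (Suc m))) u
      = (\<Sum>v\<in>{v\<in>codes n. rel v \<le> rel u}. (Suc m * (n - mass n v) choose (n - mass n v)) * pweight n (fuss (Suc m)) v)" ..
  next
    show "finite (codes n)" by (rule finite_codes[OF e(2)])
    show "rel b \<le> rel zero_code" for b using zero_code(3) by (auto simp: le_fun_def)
  qed (use zero_code(1) pweight_0 in \<open>auto\<close>)
  finally show ?thesis by (simp add: zero_code(2) pweight_zero_code)
qed

lemma window_ncrel: "n > 0 \<Longrightarrow> ncrel n (window n)"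
  unfolding ncrel_def
proof (intro conjI allI impI)
  assume n: "n > 0"
  show "equivp (window n)" by (rule equivpI) (auto simp: window_def reflp_def symp_def transp_def)
  show "window n (i + int n) (j + int n) \<longleftrightarrow> window n i j" for i j
    using div_add_period[OF n, of i 1] div_add_period[OF n, of j 1] by (simp add: window_def)
  fix i j k l assume "i < j" "j < k" "window n i k"
  moreover have "i div int n \<le> j div int n" "j div int n \<le> k div int n"
    using \<open>i < j\<close> \<open>j < k\<close> n by (auto intro: zdiv_mono1)
  ultimately show "window n i j" by (simp add: window_def)
qed

lemma window_code:
  assumes n: "n > 0"
  defines "w \<equiv> code n (window n)"
  shows "w \<in> codes n" "rel w = window n" "mass n w = n" "pweight n (fuss t) w = fuss t n"
proof -
  interpret noncrossing n "window n" using n window_ncrel[OF n] by unfold_locales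
  show "w \<in> codes n" "rel w = window n" unfolding w_def by (rule code_in_codes, rule rel_code)
  have st: "startof n (window n) i \<longleftrightarrow> i = 0" if i: "i \<in> {0..<int n}" for i
  proof
    assume "startof n (window n) i"
    moreover have "window n i 0" using i by (simp add: window_def)
    ultimately have "i \<le> 0" by (simp add: startof_def)
    then show "i = 0" using i by simp
  next
    assume "i = 0"
    moreover have "0 \<le> j" if "j div int n = 0" for j
      using that n by (metis div_mult_mod_eq add_0 mult_zero_left pos_mod_sign of_nat_0_less_iff)
    ultimately show "startof n (window n) i" using n by (auto simp: startof_def window_def)
  qed
  have "{i. window n 0 i} = {0..<int n}"
  proof (intro equalityI subsetI)
    fix i assume "i \<in> {i. window n 0 i}"
    then have "i = i mod int n" using div_mult_mod_eq[of i "int n"] by (simp add: window_def)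
    moreover have "0 \<le> i mod int n" "i mod int n < int n" using n by auto
    ultimately show "i \<in> {0..<int n}" by simp
  qed (simp add: window_def)
  then have w: "w i = (if i = 0 then n else 0)" if "i \<in> {0..<int n}" for i
    using st[OF that] by (simp add: w_def code_def)
  have "mass n w = (\<Sum>i\<in>{0..<int n}. if i = 0 then n else 0)"
    unfolding mass_def by (rule sum.cong) (use w in auto)
  then show "mass n w = n" using n by simp
  have "pweight n (fuss t) w = (\<Prod>i\<in>{0..<int n}. if i = 0 then fuss t n else 1)"
    unfolding pweight_def by (rule prod.cong) (use w in auto)
  then show "pweight n (fuss t) w = fuss t n" using n by simp
qed

text \<open>No code below the window relation has a central class, so only the blocks contribute;
  the greatest element has a single block, of size n, per period.\<close>

lemma zeta_window:
  assumes n: "n > 0"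
  shows "zeta (NCP_1_1 n) (\<preceq>) (Suc m) = fuss (Suc m) n"
proof -
  let ?w = "code n (window n)"
  let ?Q = "{b\<in>codes n. rel b \<le> window n}"
  note w = window_code[OF n]
  have nc: "ncrel n (rel b)" if "b \<in> codes n" for b by (rule ncrel_rel[OF codes_periodic[OF that]])
  have "zeta (NCP_1_1 n) (\<preceq>) (Suc m) = zeta ?Q (\<lambda>b u. rel b \<le> rel u) (Suc m)"
    by (rule chains_iso[OF codes_bij_window[OF n]]) (rule part_le_iff_window[OF n nc _ nc]; simp)
  also have "\<dots> = pweight n (fuss (Suc m)) ?w"
  proof (rule zeta_by_weight[where val = "\<lambda>m. pweight n (fuss (Suc m))"])
    fix m u assume u: "u \<in> ?Q"
    then have uc: "u \<in> codes n" by simp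
    have full: "mass n b = n" if b: "b \<in> codes n" "rel b \<le> window n" for b
    proof -
      have "\<not> central b x" for x
      proof
        assume "central b x"
        then have "window n x (x + int n)" using central_iff[OF b(1) n] b(2) by blast
        then show False using div_add_period[OF n, of x 1] by (simp add: window_def)
      qed
      then have "cell n b (- 1) = {}" by (simp add: cell_def)
      then show ?thesis using card_center[OF b(1) n] by simp
    qed
    have "{v\<in>?Q. rel v \<le> rel u} = {v\<in>codes n. rel v \<le> rel u}"
      using u order_trans by blast
    then have "(\<Sum>v\<in>{v\<in>?Q. rel v \<le> rel u}. pweight n (fuss (Suc m)) v)
        = (\<Sum>v\<in>{v\<in>codes n. rel v \<le> rel u}. 1 * pweight n (fuss (Suc m)) v)" by simp
    also have "\<dots> = pweight n (fuss (Suc (Suc m))) u"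
      using below_weight(1)[OF uc n, of "\<lambda>_. 1"] full[OF uc] u by simp
    finally show "pweight n (fuss (Suc (Suc m))) u = (\<Sum>v\<in>{v\<in>?Q. rel v \<le> rel u}. pweight n (fuss (Suc m)) v)" ..
  next
    show "finite ?Q" using finite_codes[OF n] by simp
  qed (use w pweight_0 in auto)
  finally show ?thesis by (simp add: w)
qed

section \<open>The centre\<close>

text \<open>The value p = {} encodes an isolated origin.\<close>

definition attach :: "complex set \<Rightarrow> complex set set \<Rightarrow> complex set set" where
  "attach p v = insert (insert 0 p) (v - {p})"

lemma attach_le_iff:
  assumes v: "partition_on A v" and v': "partition_on A v'" and A: "0 \<notin> A"
    and p: "p = {} \<or> p \<in> v" and p': "p' = {} \<or> p' \<in> v'"
  shows "attach p v \<preceq> attach p' v' \<longleftrightarrow> v \<preceq> v' \<and> p \<subseteq> p'"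
proof
  have z: "0 \<notin> q" if "q \<in> v \<or> q \<in> v'" for q
    using that A partition_onD1[OF v] partition_onD1[OF v'] by auto
  have zp: "0 \<notin> p" "0 \<notin> p'" using z p p' by auto
  assume le: "attach p v \<preceq> attach p' v'"
  have "insert 0 p \<in> attach p v" by (simp add: attach_def)
  then obtain q where q: "q \<in> attach p' v'" "insert 0 p \<subseteq> q" using le unfolding refines_def by blast
  then have q0: "q = insert 0 p'" using z unfolding attach_def by blast
  have pp: "p \<subseteq> p'" using q(2) zp unfolding q0 by blast
  have "\<exists>q\<in>v'. r \<subseteq> q" if r: "r \<in> v" for r
  proof (cases "r = p")
    case True
    have "r \<noteq> {}" using r partition_onD3[OF v] by metis
    then have "p' \<in> v'" using True pp p' by auto
    then show ?thesis using True pp by blast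
  next
    case False
    then have "r \<in> attach p v" using r by (simp add: attach_def)
    then obtain q where q: "q \<in> attach p' v'" "r \<subseteq> q" using le by (auto simp: refines_def)
    show ?thesis
    proof (cases "q = insert 0 p'")
      case True
      then have "r \<subseteq> p'" using q z r by auto
      moreover have "r \<noteq> {}" using r partition_onD3[OF v] by metis
      ultimately show ?thesis using p' by auto
    next
      case False
      then show ?thesis using q by (auto simp: attach_def)
    qed
  qed
  then show "v \<preceq> v' \<and> p \<subseteq> p'" using pp by (simp add: refines_def)
next
  assume le: "v \<preceq> v' \<and> p \<subseteq> p'"
  show "attach p v \<preceq> attach p' v'"
    unfolding refines_def
  proof
    fix r assume "r \<in> attach p v"
    then consider "r = insert 0 p" | "r \<in> v" by (auto simp: attach_def)
    then show "\<exists>q\<in>attach p' v'. r \<subseteq> q"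
    proof cases
      case 1
      then show ?thesis using le by (auto simp: attach_def)
    next
      case 2
      then obtain q where "q \<in> v'" "r \<subseteq> q" using le by (auto simp: refines_def)
      then show ?thesis unfolding attach_def by (cases "q = p'") auto
    qed
  qed
qed

lemma partition_attach:
  assumes v: "partition_on A v" and A: "0 \<notin> A" and p: "p = {} \<or> p \<in> v"
  shows "partition_on (A \<union> {0}) (attach p v)"
proof (rule partition_onI)
  note v' = partition_onD1[OF v] partition_onD2[OF v] partition_onD3[OF v]
  show "\<Union> (attach p v) = A \<union> {0}" using v' p by (auto simp: attach_def)
  show "{} \<notin> attach p v" using v' by (auto simp: attach_def)
  fix q r assume qr: "q \<in> attach p v" "r \<in> attach p v" "q \<noteq> r"
  have d: "disjnt q r" if "q \<in> v" "r \<in> v" "q \<noteq> r" for q r using v'(2) that by (auto simp: disjoint_def disjnt_def)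
  have d0: "disjnt (insert 0 p) r" if "r \<in> v" "r \<noteq> p" for r
    using d[of p r] that p A v'(1) by auto
  consider "q \<in> v - {p}" "r \<in> v - {p}" | "q = insert 0 p" "r \<in> v - {p}" | "q \<in> v - {p}" "r = insert 0 p"
    using qr by (auto simp: attach_def)
  then show "disjnt q r" using d d0 qr by cases (auto simp: disjnt_sym)
qed

lemma restrict_attach:
  assumes v: "partition_on A v" and A: "0 \<notin> A" and p: "p = {} \<or> p \<in> v"
  shows "restrict_partition (attach p v) A = v"
proof -
  have sub: "q \<inter> A = q" if "q \<in> v" for q using that partition_onD1[OF v] by auto
  have "insert 0 p \<inter> A = p" using sub p A by auto
  moreover have "(\<lambda>q. q \<inter> A) ` (v - {p}) = v - {p}" using sub by (auto simp: image_iff)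
  moreover have "restrict_partition (attach p v) A = insert (insert 0 p \<inter> A) ((\<lambda>q. q \<inter> A) ` (v - {p})) - {{}}"
    unfolding restrict_partition_def attach_def by blast
  ultimately show ?thesis using p partition_onD3[OF v] by auto
qed

lemma attach_decompose:
  assumes w: "partition_on (A \<union> {0}) w" and A: "0 \<notin> A"
  obtains p where "p = {} \<or> p \<in> restrict_partition w A" "w = attach p (restrict_partition w A)"
proof -
  obtain P0 where P0: "P0 \<in> w" "0 \<in> P0" using partition_onD1[OF w] by auto
  have dis: "q \<inter> P0 = {}" if "q \<in> w" "q \<noteq> P0" for q
    using partition_onD2[OF w] that P0 by (auto simp: disjoint_def)
  have sub: "q \<subseteq> A \<union> {0}" if "q \<in> w" for q using partition_onD1[OF w] that by auto
  have ne: "q \<noteq> {}" if "q \<in> w" for q using partition_onD3[OF w] that by auto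
  have oth: "q \<inter> A = q" if "q \<in> w" "q \<noteq> P0" for q using sub[OF that(1)] dis[OF that] P0 by auto
  define p where "p = P0 \<inter> A"
  have ins: "insert 0 p = P0" using sub[OF P0(1)] P0 by (auto simp: p_def)
  have pnot: "p \<noteq> q" if "q \<in> w" "q \<noteq> P0" for q
    using dis[OF that] ne[OF that(1)] by (auto simp: p_def)
  have "restrict_partition w A = (\<lambda>q. q \<inter> A) ` w - {{}}" unfolding restrict_partition_def by blast
  also have "(\<lambda>q. q \<inter> A) ` w = insert p ((\<lambda>q. q \<inter> A) ` (w - {P0}))"
    using P0 by (auto simp: p_def)
  also have "(\<lambda>q. q \<inter> A) ` (w - {P0}) = w - {P0}" using oth by (auto simp: image_iff)
  finally have res: "restrict_partition w A = insert p (w - {P0}) - {{}}" .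
  have "restrict_partition w A - {p} = w - {P0}"
    unfolding res using pnot ne by blast
  then have "w = attach p (restrict_partition w A)"
    using ins P0 by (auto simp: attach_def)
  moreover have "p = {} \<or> p \<in> restrict_partition w A" unfolding res by auto
  ultimately show ?thesis using that by blast
qed

lemma attach_in_NCP_iff:
  assumes v: "v \<in> NCP A" and A: "0 \<notin> A" and p: "p = {} \<or> p \<in> v"
  shows "attach p v \<in> NCP (A \<union> {0}) \<longleftrightarrow>
    (\<forall>q\<in>v. q \<noteq> p \<longrightarrow> convex hull (insert 0 p) \<inter> convex hull q = {})"
proof -
  have P: "partition_on A v" using v by (simp add: NCP_def)
  have z: "insert 0 p \<noteq> q" if "q \<in> v" for q using that A partition_onD1[OF P] by auto
  have disv: "convex hull q \<inter> convex hull r = {}" if "q \<in> v" "r \<in> v" "q \<noteq> r" for q r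
    using v that by (auto simp: NCP_def)
  show ?thesis
    using partition_attach[OF P A p] z disv unfolding NCP_def attach_def by (auto simp: Int_commute)
qed

section \<open>Visible classes and the convex hull of a class with the origin\<close>

lemma mass_full_iff:
  assumes b: "b \<in> codes n" "n > 0" shows "mass n b = n \<longleftrightarrow> (\<forall>i. \<not> central b i)"
proof -
  have "mass n b = n \<longleftrightarrow> cell n b (- 1) = {}"
    using card_center[OF b] finite_cell[OF b, of "- 1"] by auto
  also have "\<dots> \<longleftrightarrow> (\<forall>i. \<not> central b i)"
  proof
    assume c: "cell n b (- 1) = {}"
    show "\<forall>i. \<not> central b i"
    proof (intro allI notI)
      fix i assume "central b i"
      then have "central b (i mod int n)"
        using central_shift[OF codes_periodic[OF b(1)], of "i mod int n" "i div int n"] by simp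
      then have "i mod int n \<in> cell n b (- 1)" using b(2) by (simp add: cell_def)
      then show False using c by simp
    qed
  qed (simp add: cell_def)
  finally show ?thesis .
qed

text \<open>The closer y at which the walk from s first drops below its starting level is matched,
  as there is no central class. Its opener must come before s, because from s up to y the walk stays
  nonnegative.\<close>

lemma not_vis_nested:
  assumes b: "b \<in> codes n" "n > 0" "mass n b = n" and s: "matched b s s" "\<not> vis b s"
  obtains j y where "j < s" "s < y" "matched b j y"
proof -
  have bs: "1 \<le> b s" using s by (simp add: matched_refl_iff)
  then obtain t where t: "s \<le> t" "drift b s t < 0" using s by (auto simp: vis_def not_le)
  then have ex: "drift b s (s + int (nat (t - s))) < 0" by simp
  \<comment> \<open>Since \<open>b s\<close> is positive, the first drop takes at least two
    positions; hence y = s + k - 1 is greater than s.\<close>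
  define k where "k = (LEAST k. drift b s (s + int k) < 0)"
  have k: "drift b s (s + int k) < 0" unfolding k_def by (rule LeastI[of _ "nat (t - s)"]) (rule ex)
  have least: "0 \<le> drift b s (s + int l)" if "l < k" for l
    using not_less_Least[of l] that unfolding k_def by (force simp: not_less)
  have "k \<noteq> 0" using k by (intro notI) simp
  moreover have "k \<noteq> 1" using k bs by (intro notI) simp
  ultimately have k2: "2 \<le> k" by simp
  define y where "y = s + int k - 1"
  have y: "s < y" "drift b s (y + 1) < 0" using k k2 by (simp_all add: y_def)
  have "\<not> central b y" using mass_full_iff[OF b(1,2)] b(3) by simp
  then obtain j where j: "matched b j y" by (auto simp: central_def)
  have "j < s"
  proof (rule ccontr)
    assume "\<not> j < s"
    moreover have "j \<le> y" using j by (rule matched_le)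
    ultimately have "drift b s (y + 1) = drift b s j + drift b j (y + 1)" "0 \<le> drift b s (s + int (nat (j - s)))"
      using drift_add[of s j "y + 1" b] least[of "nat (j - s)"] by (auto simp: y_def)
    then show False using j y \<open>\<not> j < s\<close> by (simp add: matched_def)
  qed
  then show ?thesis using that y j by blast
qed

context
  fixes e n :: nat and b :: "int \<Rightarrow> nat"
  assumes e: "e \<ge> 2" "n > 0" and b: "b \<in> codes n"
begin

interpretation noncrossing n "rel b"
  using e ncrel_rel[OF codes_periodic[OF b]] by unfold_locales

lemma zero_in_central_hull:
  assumes "central b i" shows "0 \<in> convex hull (cls e i)"
proof (rule zero_in_hull_invariant[OF e])
  show "pt (e * n) i \<in> cls e i" using refl by blast
  have "cls e (i + int n) = cls e i" using assms central_iff[OF b e(2)] cls_cong by metis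
  then show "pt (e * n) (int n) * w \<in> cls e i" if "w \<in> cls e i" for w
    using pt_mult_cls[of e 1 w i] that e by simp
qed

lemma rel_eq_block: "matched b s i \<Longrightarrow> {j. rel b i j} = block b s"
  by (auto simp: rel_matched block_def)

lemma block_window: "x \<in> block b s \<Longrightarrow> s \<le> x \<and> x < s + int n"
  using matched_less[OF b e(2)] matched_le by (auto simp: block_def)

lemma zero_notin_noncentral_hull:
  assumes "\<not> central b i" shows "0 \<notin> convex hull (cls e i)"
proof -
  obtain s where s: "matched b s i" using assms by (auto simp: central_def)
  show ?thesis
  proof (rule zero_notin_hull_short[OF e, of s "s + int n - 1"])
    show "cls e i \<subseteq> pt (e * n) ` {s..s + int n - 1}"
      unfolding rel_eq_block[OF s] using block_window[of _ s] by (intro image_mono) auto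
  qed (use e in auto)
qed

text \<open>Up to full turns the other block starts at some t in the turn following s. It lies
  either between two consecutive elements of the block of s, whose chord separates, or after that
  block and, by visibility, before its next translate by e n; then the chord of the other block
  separates.\<close>

lemma vis_hull_disjoint:
  assumes m: "mass n b = n" and v: "vis b s" and ne: "cls e i \<noteq> cls e s"
  shows "convex hull (insert 0 (cls e s)) \<inter> convex hull (cls e i) = {}"
proof -
  have e0: "e > 0" using e by simp
  define N where "N = int (e * n)"
  have nN: "2 * int n \<le> N" unfolding N_def by (rule two_periods[OF e(1)])
  have ptN: "pt (e * n) (k + N) = pt (e * n) k" for k using pt_period[of "e * n" k 1] by (simp add: N_def)
  note per = codes_periodic[OF b]
  have ss: "matched b s s" using v by (simp add: vis_def matched_refl_iff)
  obtain t0 where t0: "matched b t0 i" using m mass_full_iff[OF b e(2)] by (auto simp: central_def)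
  have "e * n > 0" using e by simp
  then obtain c0 where c0: "s \<le> t0 + int (e * n) * c0" "t0 + int (e * n) * c0 < s + int (e * n)" by (rule decompose_period)
  define t where "t = t0 + N * c0"
  have t: "s \<le> t" "t < s + N" using c0 by (simp_all add: t_def N_def)
  have "cls e t = cls e t0" unfolding t_def N_def by (rule cls_shift)
  also have "\<dots> = cls e i" using rel_matched[OF matched_start[OF t0]] t0 by (intro cls_cong) simp
  finally have ti: "cls e t = cls e i" .
  have tt: "matched b t t"
    using matched_shift[OF per, of t0 "int e * c0" t0] matched_start[OF t0] by (simp add: t_def N_def mult_ac)
  have ts: "t \<noteq> s" using ti ne by auto
  have tB: "t \<notin> block b s" using tt ts matched_unique by (auto simp: block_def)
  have cs: "cls e s = pt (e * n) ` block b s" and ct: "cls e i = pt (e * n) ` block b t"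
    unfolding ti[symmetric] rel_eq_block[OF ss] rel_eq_block[OF tt] by (rule HOL.refl)+
  have fin: "finite (block b x)" for x using finite_block[OF b e(2)] .
  have sB: "s \<in> block b s" "t \<in> block b t" using ss tt by (simp_all add: block_def)
  show ?thesis
  proof (cases "\<exists>l\<in>block b s. t < l")
    case True
    let ?L = "{k\<in>block b s. k < t}" and ?R = "{k\<in>block b s. t < k}"
    have LR: "finite ?L" "finite ?R" "?L \<noteq> {}" "?R \<noteq> {}" using fin sB t ts True by auto
    define a where "a = Max ?L"
    define c where "c = Min ?R"
    have a: "a \<in> block b s" "a < t" and c: "c \<in> block b s" "t < c"
      using Max_in[OF LR(1,3)] Min_in[OF LR(2,4)] by (auto simp: a_def c_def)
    have aw: "s \<le> a" "c < s + int n" using block_window a c by auto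
    show ?thesis
    proof (rule insert_0_hull_disjoint_inside[OF e, of a c])
      show "a \<le> c" "c - a < int n" using a c aw by auto
      show "cls e i \<subseteq> pt (e * n) ` {a<..<c}"
        unfolding ct
      proof (intro image_mono subsetI)
        fix y assume y: "y \<in> block b t"
        have "y \<noteq> c" using y c ts matched_unique by (auto simp: block_def)
        moreover have "\<not> c < y"
          using matched_nested[of b t y s c] y c t ts by (auto simp: block_def)
        ultimately show "y \<in> {a<..<c}" using block_window[OF y] a by auto
      qed
      show "cls e s \<subseteq> pt (e * n) ` {c..a + int (e * n)}"
        unfolding cs
      proof
        fix z assume "z \<in> pt (e * n) ` block b s"
        then obtain k where k: "k \<in> block b s" "z = pt (e * n) k" by blast
        have kw: "s \<le> k" "k < s + int n" using block_window[OF k(1)] by auto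
        have "k \<noteq> t" using k tB by auto
        show "z \<in> pt (e * n) ` {c..a + int (e * n)}"
        proof (cases "k < t")
          case True
          then have "k \<le> a" unfolding a_def using LR k by (intro Max_ge) auto
          then have "k + N \<in> {c..a + N}" using aw kw nN by simp
          then have "k + N \<in> {c..a + int (e * n)}" by (simp only: N_def)
          then have "pt (e * n) (k + N) \<in> pt (e * n) ` {c..a + int (e * n)}" by (rule imageI)
          then show ?thesis using k ptN by simp
        next
          case False
          then have "c \<le> k" unfolding c_def using LR k \<open>k \<noteq> t\<close> by (intro Min_le) auto
          then have "k \<in> {c..a + N}" using aw kw nN by simp
          then have "k \<in> {c..a + int (e * n)}" by (simp only: N_def)
          then show ?thesis using k by blast
        qed
      qed
    qed
  next
    case False
    then have below: "k < t" if "k \<in> block b s" for k using that tB by (metis linorder_neqE)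
    define c where "c = Max (block b t)"
    have ne: "block b t \<noteq> {}" using sB by blast
    have c: "c \<in> block b t" unfolding c_def using Max_in[OF fin ne] .
    have tc: "t \<le> c" "c < t + int n" using block_window[OF c] by auto
    have "vis b (s + N)" using v vis_shift[OF per, of s "int e"] by (simp add: N_def mult.commute)
    then have cN: "c < s + N" using vis_not_nested[of b "s + N" t c] c t by (simp add: block_def)
    show ?thesis
    proof (rule insert_0_hull_disjoint_beside[OF e, of t c])
      show "t \<le> c" "c - t < int n" using tc by auto
      show "cls e i \<subseteq> pt (e * n) ` {t..c}"
        unfolding ct using block_window[of _ t] Max_ge[OF fin, of _ t] by (intro image_mono) (auto simp: c_def)
      show "cls e s \<subseteq> pt (e * n) ` {c<..<t + int (e * n)}"
        unfolding cs
      proof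
        fix z assume "z \<in> pt (e * n) ` block b s"
        then obtain k where k: "k \<in> block b s" "z = pt (e * n) k" by blast
        have "s \<le> k" "k < t" using block_window[OF k(1)] below[OF k(1)] by auto
        then have "k + N \<in> {c<..<t + N}" using cN by simp
        then have "k + N \<in> {c<..<t + int (e * n)}" by (simp only: N_def)
        then have "pt (e * n) (k + N) \<in> pt (e * n) ` {c<..<t + int (e * n)}" by (rule imageI)
        then show "z \<in> pt (e * n) ` {c<..<t + int (e * n)}" using k ptN by simp
      qed
    qed
  qed
qed

text \<open>An invisible start s lies under the chord of an enclosing class, which the segment from
  the origin to s must cross.\<close>

lemma not_vis_hull_meets:
  assumes m: "mass n b = n" and s: "matched b s s" "\<not> vis b s"
  obtains i where "cls e i \<noteq> cls e s" "convex hull (insert 0 (cls e s)) \<inter> convex hull (cls e i) \<noteq> {}"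
proof -
  have e0: "e > 0" using e by simp
  obtain j y where jy: "j < s" "s < y" "matched b j y" using not_vis_nested[OF b e(2) m s] .
  have yn: "y < j + int n" by (rule matched_less[OF b e(2) jy(3)])
  have jj: "matched b j j" by (rule matched_start[OF jy(3)])
  have "cls e j \<noteq> cls e s"
  proof
    assume "cls e j = cls e s"
    then obtain c where "rel b j (s + int (e * n) * c)" using cls_eq_iff[OF e0] by blast
    then have "matched b j (s + int (e * n) * c)" using rel_matched[OF jj] by simp
    moreover have "matched b (s + int (e * n) * c) (s + int (e * n) * c)"
      using matched_shift[OF codes_periodic[OF b], of s "int e * c" s] s by (simp add: mult_ac)
    ultimately have j: "j = s + int (e * n) * c" using matched_unique by blast
    have "\<bar>int (e * n) * c\<bar> < int (e * n)"
      using j jy yn two_periods[OF e(1), of n] by linarith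
    then have "c = 0" by (rule abs_mult_less_self)
    then show False using j jy by simp
  qed
  moreover have "convex hull (insert 0 (cls e s)) \<inter> convex hull (cls e j) \<noteq> {}"
  proof (rule insert_0_hull_meets[OF e jy(1,2)])
    show "y - j < int n" using yn by simp
    show "pt (e * n) j \<in> cls e j" "pt (e * n) s \<in> cls e s" using refl by blast+
    show "pt (e * n) y \<in> cls e j" using jy(3) rel_matched[OF jj] by blast
  qed
  ultimately show ?thesis using that by blast
qed

end

section \<open>Partitions of type (e,e) as codes with a marked class\<close>

definition center_part :: "nat \<Rightarrow> nat \<Rightarrow> (int \<Rightarrow> nat) \<Rightarrow> int \<Rightarrow> complex set" where
  "center_part e n b s = pt (e * n) ` (if s = - 1 then {j. central b j} else {j. rel b s j})"

text \<open>The pair \<open>(b, s)\<close> stands for the partition in which the origin is joined to the part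
  starting at \<open>s\<close>; for \<open>s = - 1\<close> it is joined to the central part, or isolated if there is none.\<close>

definition D_codes :: "nat \<Rightarrow> nat \<Rightarrow> ((int \<Rightarrow> nat) \<times> int) set" where
  "D_codes e n = {(b, s). b \<in> codes n \<and> (s = - 1 \<or> 0 \<le> s \<and> s < int (e * n) \<and> mass n b = n \<and> vis b s)}"

text \<open>The second condition says that the part joined to the origin in x lies in the one of y:
  it is absorbed by the central part, or y is itself joined to a class containing it up to full
  turns. The range e n of s, rather than n, tells the translates of a class apart, since only one of
  them is joined.\<close>

definition D_le :: "nat \<Rightarrow> nat \<Rightarrow> (int \<Rightarrow> nat) \<times> int \<Rightarrow> (int \<Rightarrow> nat) \<times> int \<Rightarrow> bool" where
  "D_le e n x y \<longleftrightarrow> rel (fst x) \<le> rel (fst y) \<and> (snd x = - 1 \<or> central (fst y) (snd x) \<or>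
     snd y \<noteq> - 1 \<and> (\<exists>c. rel (fst y) (snd y) (snd x + int (e * n) * c)))"

definition D_part :: "nat \<Rightarrow> nat \<Rightarrow> (int \<Rightarrow> nat) \<times> int \<Rightarrow> complex set set" where
  "D_part e n x = attach (center_part e n (fst x) (snd x)) (parts_of (e * n) (rel (fst x)))"

lemma zero_notin_mu: "N > 0 \<Longrightarrow> 0 \<notin> mu N"
  by (simp add: mu_def power_0_left)

context
  fixes e n :: nat
  assumes e: "e \<ge> 2" "n > 0"
begin

lemma nc_code: "b \<in> codes n \<Longrightarrow> noncrossing n (rel b)"
  using e ncrel_rel[OF codes_periodic] by unfold_locales

lemma central_mod: "b \<in> codes n \<Longrightarrow> central b (i + int (e * n) * c) \<longleftrightarrow> central b i"
  using central_shift[OF codes_periodic, of b n i "int e * c"] by (simp add: mult_ac)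

lemma code_partition: "b \<in> codes n \<Longrightarrow> partition_on (mu (e * n)) (parts_of (e * n) (rel b))"
  using noncrossing.partition_part[OF nc_code] e by simp

lemma zero_notin: "0 \<notin> mu (e * n)"
  using zero_notin_mu e by simp

lemma center_part_cases: "center_part e n b s = {} \<or> center_part e n b s \<in> parts_of (e * n) (rel b)"
proof (cases "s = - 1")
  case True
  show ?thesis
  proof (cases "\<exists>i. central b i")
    case False
    then show ?thesis using True by (simp add: center_part_def)
  next
    case c: True
    then obtain i where "central b i" by blast
    then have "{j. central b j} = {j. rel b i j}" using rel_central by blast
    then show ?thesis using True by (auto simp: center_part_def parts_of_def)
  qed
qed (auto simp: center_part_def parts_of_def)

lemma pt_in_central_iff:
  assumes b: "b \<in> codes n" shows "pt (e * n) i \<in> pt (e * n) ` {j. central b j} \<longleftrightarrow> central b i"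
  using pt_in_image_iff[of "e * n" i "{j. central b j}"] central_mod[OF b] e by simp

lemma D_le_iff:
  assumes x: "x \<in> D_codes e n" and y: "y \<in> D_codes e n"
  shows "D_part e n x \<preceq> D_part e n y \<longleftrightarrow> D_le e n x y"
proof -
  obtain b s where bs: "x = (b, s)" by force
  obtain u t where ut: "y = (u, t)" by force
  have b: "b \<in> codes n" and s: "s = - 1 \<or> 0 \<le> s \<and> mass n b = n" using x bs by (auto simp: D_codes_def)
  have u: "u \<in> codes n" and t: "t = - 1 \<or> 0 \<le> t \<and> mass n u = n" using y ut by (auto simp: D_codes_def)
  interpret B: noncrossing n "rel b" by (rule nc_code[OF b])
  interpret U: noncrossing n "rel u" by (rule nc_code[OF u])
  have e0: "e > 0" using e by simp
  have "D_part e n x \<preceq> D_part e n y \<longleftrightarrow>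
     rel b \<le> rel u \<and> center_part e n b s \<subseteq> center_part e n u t"
    unfolding D_part_def bs ut fst_conv snd_conv
    using attach_le_iff[OF code_partition[OF b] code_partition[OF u] zero_notin center_part_cases center_part_cases]
      part_le_iff_invariant[OF e(2) B.nc U.nc e(1)] by simp
  moreover have "center_part e n b s \<subseteq> center_part e n u t \<longleftrightarrow>
      s = - 1 \<or> central u s \<or> t \<noteq> - 1 \<and> (\<exists>c. rel u t (s + int (e * n) * c))" if le: "rel b \<le> rel u"
  proof (cases "s = - 1")
    case True
    have cen: "central u i" if "central b i" for i
      using that le central_iff[OF b e(2)] central_iff[OF u e(2)] by blast
    \<comment> \<open>If the origin of y is joined to a visible class, then u has mass n and no
      central class, hence neither has its refinement b.\<close>
    have "{j. central b j} = {}" if "t \<noteq> - 1"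
      using that t mass_full_iff[OF u e(2)] cen by auto
    then have "center_part e n b s \<subseteq> center_part e n u t"
      using True cen by (cases "t = - 1") (auto simp: center_part_def)
    then show ?thesis using True by simp
  next
    case False
    have cb: "center_part e n b s = B.cls e s" using False by (simp add: center_part_def)
    have sub: "B.cls e s \<subseteq> U.cls e s" using le by auto
    have ss: "pt (e * n) s \<in> B.cls e s" using B.refl by blast
    show ?thesis
    proof (cases "t = - 1")
      case True
      have "center_part e n b s \<subseteq> center_part e n u t \<longleftrightarrow> central u s"
      proof
        assume "center_part e n b s \<subseteq> center_part e n u t"
        moreover have "center_part e n u t = pt (e * n) ` {j. central u j}" using True by (simp add: center_part_def)
        ultimately have "pt (e * n) s \<in> pt (e * n) ` {j. central u j}" using ss cb by blast
        then show "central u s" using pt_in_central_iff[OF u] by simp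
      next
        assume "central u s"
        then have "{j. central u j} = {j. rel u s j}" using rel_central by blast
        then have "center_part e n u t = U.cls e s" using True by (simp add: center_part_def)
        then show "center_part e n b s \<subseteq> center_part e n u t" by (simp only: cb sub)
      qed
      then show ?thesis using False True by simp
    next
      case tn: False
      have ct: "center_part e n u t = U.cls e t" using tn by (simp add: center_part_def)
      have nocen: "\<not> central u s" using t tn mass_full_iff[OF u e(2)] by simp
      have "B.cls e s \<subseteq> U.cls e t \<longleftrightarrow> (\<exists>c. rel u t (s + int (e * n) * c))"
      proof
        assume "B.cls e s \<subseteq> U.cls e t"
        then show "\<exists>c. rel u t (s + int (e * n) * c)" using ss U.pt_in_cls_iff[OF e0] by blast
      next
        assume "\<exists>c. rel u t (s + int (e * n) * c)"
        then have "U.cls e t = U.cls e s" using U.cls_eq_iff[OF e0] by blast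
        then show "B.cls e s \<subseteq> U.cls e t" using sub by simp
      qed
      then show ?thesis using False tn nocen cb ct by simp
    qed
  qed
  ultimately show ?thesis unfolding D_le_def bs ut fst_conv snd_conv by blast
qed

lemma D_part_in_NCP:
  assumes x: "x \<in> D_codes e n" shows "D_part e n x \<in> NCP_e_e e n"
proof -
  obtain b s where bs: "x = (b, s)" by force
  have b: "b \<in> codes n" and s: "s = - 1 \<or> 0 \<le> s \<and> mass n b = n \<and> vis b s" using x bs by (auto simp: D_codes_def)
  interpret B: noncrossing n "rel b" by (rule nc_code[OF b])
  let ?v = "parts_of (e * n) (rel b)" and ?p = "center_part e n b s"
  have v: "?v \<in> NCP_e_1 e n" by (rule B.part_in_NCP_e_1[OF e(1)])
  then have vN: "?v \<in> NCP (mu (e * n))" by (simp add: NCP_e_1_def)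
  have "convex hull (insert 0 ?p) \<inter> convex hull q = {}" if q: "q \<in> ?v" "q \<noteq> ?p" for q
  proof -
    obtain i where i: "q = B.cls e i" using q by (auto simp: parts_of_def)
    show ?thesis
    proof (cases "s = - 1")
      case True
      show ?thesis
      proof (cases "\<exists>k. central b k")
        case False
        then have "?p = {}" using True by (simp add: center_part_def)
        moreover have "0 \<notin> convex hull q" unfolding i using zero_notin_noncentral_hull[OF e b] False by blast
        ultimately show ?thesis by simp
      next
        case c: True
        then obtain k where k: "central b k" by blast
        then have p: "?p = B.cls e k" using True rel_central[OF k] by (simp add: center_part_def)
        then have "0 \<in> convex hull ?p" using zero_in_central_hull[OF e b k] by simp
        then have "convex hull (insert 0 ?p) = convex hull ?p" by (rule hull_redundant)
        moreover have "?p \<in> ?v" using p by (auto simp: parts_of_def)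
        ultimately show ?thesis using vN q by (auto simp: NCP_def)
      qed
    next
      case False
      then have p: "?p = B.cls e s" by (simp add: center_part_def)
      show ?thesis unfolding p i
        by (rule vis_hull_disjoint[OF e b]) (use s False q p i in auto)
    qed
  qed
  then have "D_part e n x \<in> NCP (mu (e * n) \<union> {0})"
    unfolding D_part_def bs fst_conv snd_conv attach_in_NCP_iff[OF vN zero_notin center_part_cases] by blast
  moreover have "restrict_partition (D_part e n x) (mu (e * n)) = ?v"
    unfolding D_part_def bs fst_conv snd_conv by (rule restrict_attach[OF code_partition[OF b] zero_notin center_part_cases])
  ultimately show ?thesis using v by (simp add: NCP_e_e_def)
qed

lemma D_part_surj:
  assumes w: "w \<in> NCP_e_e e n" obtains x where "x \<in> D_codes e n" "D_part e n x = w"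
proof -
  let ?v = "restrict_partition w (mu (e * n))"
  have v: "?v \<in> NCP_e_1 e n" and wN: "w \<in> NCP (mu (e * n) \<union> {0})" using w by (auto simp: NCP_e_e_def)
  have "?v \<in> (\<lambda>b. parts_of (e * n) (rel b)) ` codes n"
    using codes_bij_invariant[OF e] v by (simp add: bij_betw_def)
  then obtain b where b: "b \<in> codes n" and vb: "?v = parts_of (e * n) (rel b)" by blast
  interpret B: noncrossing n "rel b" by (rule nc_code[OF b])
  have e0: "e > 0" using e by simp
  have "partition_on (mu (e * n) \<union> {0}) w" using wN by (simp add: NCP_def)
  then obtain p where p: "p = {} \<or> p \<in> ?v" "w = attach p ?v" using attach_decompose[OF _ zero_notin] by blast
  have vN: "?v \<in> NCP (mu (e * n))" using v by (simp add: NCP_e_1_def)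
  have H: "convex hull (insert 0 p) \<inter> convex hull q = {}" if "q \<in> ?v" "q \<noteq> p" for q
    using attach_in_NCP_iff[OF vN zero_notin p(1)] wN p(2) that by auto
  \<comment> \<open>The hull of a central part contains the origin, so the origin has to belong to
    that part.\<close>
  have cenp: "p = B.cls e i" if c: "central b i" for i
  proof (rule ccontr)
    assume "p \<noteq> B.cls e i"
    moreover have "B.cls e i \<in> ?v" unfolding vb parts_of_def by blast
    ultimately have "convex hull (insert 0 p) \<inter> convex hull (B.cls e i) = {}" using H by blast
    moreover have "0 \<in> convex hull (insert 0 p)" by (simp add: hull_inc)
    ultimately show False using zero_in_central_hull[OF e b c] by blast
  qed
  show ?thesis
  proof (cases "p = center_part e n b (- 1)")
    case True
    then have "D_part e n (b, - 1) = w" using p vb by (simp add: D_part_def)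
    then show ?thesis using that[of "(b, - 1)"] b by (simp add: D_codes_def)
  next
    case False
    have nocen: "\<not> central b i" for i
    proof
      assume c: "central b i"
      then have "{j. central b j} = {j. rel b i j}" using rel_central by blast
      then show False using cenp[OF c] False by (simp add: center_part_def)
    qed
    then have m: "mass n b = n" using mass_full_iff[OF b e(2)] by simp
    have "{j. central b j} = {}" using nocen by blast
    then have "center_part e n b (- 1) = {}" unfolding center_part_def by (simp only: refl if_True image_empty)
    then have "p \<noteq> {}" using False by simp
    then obtain i where i: "p = B.cls e i" using p vb by (auto simp: parts_of_def)
    obtain s0 where s0: "matched b s0 i" using nocen by (auto simp: central_def)
    \<comment> \<open>The start is moved into the first turn, so that each part has only one
      name.\<close>
    define s where "s = s0 mod int (e * n)"
    have s: "0 \<le> s" "s < int (e * n)" using e by (simp_all add: s_def)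
    have s_eq: "s0 = s + int (e * n) * (s0 div int (e * n))" by (simp add: s_def)
    have "B.cls e s = B.cls e s0" using B.cls_shift[of e s "s0 div int (e * n)"] s_eq by simp
    also have "\<dots> = p" unfolding i using rel_matched[OF matched_start[OF s0]] s0 by (intro B.cls_cong) simp
    finally have ps: "p = B.cls e s" ..
    have "matched b s s"
      using matched_shift[OF codes_periodic[OF b], of s "int e * (s0 div int (e * n))" s] matched_start[OF s0] s_eq
      by (simp add: mult_ac)
    have "vis b s"
    proof (rule ccontr)
      assume "\<not> vis b s"
      then obtain k where "B.cls e k \<noteq> B.cls e s" "convex hull (insert 0 (B.cls e s)) \<inter> convex hull (B.cls e k) \<noteq> {}"
        using not_vis_hull_meets[OF e b m \<open>matched b s s\<close>] by blast
      moreover have "B.cls e k \<in> ?v" unfolding vb parts_of_def by blast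
      ultimately show False using H ps by blast
    qed
    then have "(b, s) \<in> D_codes e n" using b s m by (simp add: D_codes_def)
    moreover have "D_part e n (b, s) = w" using p vb ps s by (simp add: D_part_def center_part_def)
    ultimately show ?thesis using that by blast
  qed
qed

text \<open>Together with \<open>D_le_iff\<close> this gives the injectivity of
  \<open>D_part\<close>.\<close>

lemma D_le_antisym:
  assumes x: "x \<in> D_codes e n" and y: "y \<in> D_codes e n" and le: "D_le e n x y" "D_le e n y x"
  shows "x = y"
proof -
  obtain b s where bs: "x = (b, s)" by force
  obtain u t where ut: "y = (u, t)" by force
  have "rel b = rel u" using le by (auto simp: D_le_def bs ut)
  then have bu: "u = b" using x y code_rel[OF _ e(2)] unfolding bs ut D_codes_def by (metis (mono_tags, lifting) case_prodD mem_Collect_eq)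
  have b: "b \<in> codes n" using x bs by (simp add: D_codes_def)
  have nocen: "\<not> central b i" if "s \<noteq> - 1 \<or> t \<noteq> - 1" for i
    using that x y mass_full_iff[OF b e(2)] by (auto simp: D_codes_def bs ut bu)
  have "s = t"
  proof (cases "s = - 1 \<or> t = - 1")
    case True
    then show ?thesis using le nocen by (auto simp: D_le_def bs ut bu)
  next
    case False
    then have st: "0 \<le> s" "s < int (e * n)" "vis b s" "0 \<le> t" "t < int (e * n)" "vis b t"
      using x y by (auto simp: D_codes_def bs ut bu)
    obtain c where c: "rel b t (s + int (e * n) * c)" using le False nocen by (auto simp: D_le_def bs ut bu)
    have tt: "matched b t t" "matched b s s" using st by (simp_all add: vis_def matched_refl_iff)
    have "matched b t (s + int (e * n) * c)" using c rel_matched[OF tt(1)] by simp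
    moreover have "matched b (s + int (e * n) * c) (s + int (e * n) * c)"
      using matched_shift[OF codes_periodic[OF b], of s "int e * c" s] tt by (simp add: mult_ac)
    ultimately have "t = s + int (e * n) * c" using matched_unique by blast
    then have "t mod int (e * n) = s mod int (e * n)" by simp
    then show ?thesis using st by simp
  qed
  then show ?thesis using bs ut bu by simp
qed

lemma D_bij: "bij_betw (D_part e n) (D_codes e n) (NCP_e_e e n)"
  unfolding bij_betw_def
proof
  show "inj_on (D_part e n) (D_codes e n)"
  proof (rule inj_onI)
    fix x y assume x: "x \<in> D_codes e n" and y: "y \<in> D_codes e n" and eq: "D_part e n x = D_part e n y"
    have "D_part e n x \<preceq> D_part e n x" by (auto simp: refines_def)
    then have "D_le e n x y" "D_le e n y x"
      using D_le_iff[OF x y] D_le_iff[OF y x] eq by simp_all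
    then show "x = y" by (rule D_le_antisym[OF x y])
  qed
  show "D_part e n ` D_codes e n = NCP_e_e e n"
    using D_part_in_NCP D_part_surj by blast
qed

text \<open>The factor for a central class of size k: the first binomial coefficient counts the
  chains all of whose elements have s = -1, the second one those in which some class is joined to
  the origin.\<close>

definition D_choose :: "nat \<Rightarrow> nat \<Rightarrow> nat" where
  "D_choose m k = (Suc m * k choose k) + e * (Suc m * k choose Suc k)"

text \<open>Number of chains of length m below x. For a marked class the additional opener enlarges
  its Fuss-Catalan factor by one element.\<close>

definition D_val :: "nat \<Rightarrow> (int \<Rightarrow> nat) \<times> int \<Rightarrow> nat" where
  "D_val m x = (if snd x = - 1 then D_choose m (n - mass n (fst x)) * pweight n (fuss (Suc m)) (fst x)
     else pweight n (fuss (Suc m)) (bump n (fst x) (snd x)))"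

lemma bump_shift: "bump n b (s + int n * k) = bump n b s"
proof
  fix i
  have "i - (s + int n * k) = (i - s) + int n * (- k)" by simp
  then have "int n dvd i - (s + int n * k) \<longleftrightarrow> int n dvd i - s"
    by (simp only: dvd_add_left_iff dvd_triv_left)
  then show "bump n b (s + int n * k) i = bump n b s i" by (simp add: bump_def)
qed

definition attached_below :: "(int \<Rightarrow> nat) \<Rightarrow> int \<Rightarrow> ((int \<Rightarrow> nat) \<times> int) set" where
  "attached_below u t = {(b, s). b \<in> codes n \<and> mass n b = n \<and> rel b \<le> rel u \<and> 0 \<le> s \<and> s < int (e * n) \<and> vis b s \<and>
     (central u s \<or> t \<noteq> - 1 \<and> (\<exists>c. rel u t (s + int (e * n) * c)))}"

lemma D_below:
  assumes "(u, t) \<in> D_codes e n"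
  shows "{x\<in>D_codes e n. D_le e n x (u, t)} = (\<lambda>b. (b, - 1)) ` {b\<in>codes n. rel b \<le> rel u} \<union> attached_below u t"
  by (auto simp: D_codes_def D_le_def attached_below_def)

text \<open>A start s in the first turn is a residue r of the central cell together with one of e
  quotients. The weight depends on r only, whence the factor e.\<close>

lemma attached_below_center:
  assumes u: "u \<in> codes n"
  shows "(\<Sum>x\<in>attached_below u (- 1). D_val m x)
    = e * (raney (Suc m) (Suc (n - mass n u)) (n - mass n u) * pweight n (fuss (Suc (Suc m))) u)"
    and "finite (attached_below u (- 1))"
proof -
  let ?S = "attached n u (cell n u (- 1))"
  let ?g = "\<lambda>((b, r), q). (b, r + int n * q) :: (int \<Rightarrow> nat) \<times> int"
  have bij: "bij_betw ?g (?S \<times> {0..<int e}) (attached_below u (- 1))"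
    unfolding bij_betw_def
  proof
    show "inj_on ?g (?S \<times> {0..<int e})"
    proof (rule inj_onI)
      fix x x' assume x: "x \<in> ?S \<times> {0..<int e}" "x' \<in> ?S \<times> {0..<int e}" and g: "?g x = ?g x'"
      obtain b r q b' r' q' where xx: "x = ((b, r), q)" "x' = ((b', r'), q')" by (metis prod.exhaust)
      then have r: "r \<in> cell n u (- 1)" "r' \<in> cell n u (- 1)" and eq: "r + int n * q = r' + int n * q'" and "b = b'"
        using x g by auto
      have "0 \<le> r" "r < int n" "0 \<le> r'" "r' < int n" using r by (auto simp: cell_def)
      moreover have "(r + int n * q) mod int n = (r' + int n * q') mod int n" using eq by simp
      ultimately have "r = r'" by simp
      then show "x = x'" using eq e xx \<open>b = b'\<close> by simp
    qed
    show "?g ` (?S \<times> {0..<int e}) = attached_below u (- 1)"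
    proof (intro equalityI subsetI)
      fix x assume "x \<in> ?g ` (?S \<times> {0..<int e})"
      then obtain b r q where x: "x = (b, r + int n * q)" "b \<in> codes n" "mass n b = n" "rel b \<le> rel u"
        "0 \<le> r" "r < int n" "central u r" "vis b r" "0 \<le> q" "q < int e" by (auto simp: cell_def)
      have "int n * q \<le> int n * (int e - 1)" using x by (intro mult_left_mono) auto
      then have "r + int n * q < int (e * n)" using x by (simp add: algebra_simps)
      moreover have "0 \<le> r + int n * q" using x by simp
      moreover have "central u (r + int n * q)" using central_shift[OF codes_periodic[OF u]] x by simp
      moreover have "vis b (r + int n * q)" using vis_shift[OF codes_periodic[OF x(2)]] x by simp
      ultimately show "x \<in> attached_below u (- 1)" using x by (simp add: attached_below_def)
    next
      fix x assume "x \<in> attached_below u (- 1)"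
      then obtain b s where x: "x = (b, s)" "b \<in> codes n" "mass n b = n" "rel b \<le> rel u"
        "0 \<le> s" "s < int (e * n)" "vis b s" "central u s" by (auto simp: attached_below_def)
      have s: "s = s mod int n + int n * (s div int n)" by simp
      have "central u (s mod int n)" using central_shift[OF codes_periodic[OF u], of "s mod int n" "s div int n"] x by simp
      moreover have "vis b (s mod int n)" using vis_shift[OF codes_periodic[OF x(2)], of "s mod int n" "s div int n"] x by simp
      ultimately have "(b, s mod int n) \<in> ?S" using x e by (simp add: cell_def)
      moreover have "s div int n \<in> {0..<int e}"
      proof -
        have "int n * (s div int n) \<le> s" using s x e pos_mod_sign[of "int n" s] by linarith
        also have "\<dots> < int n * int e" using x by (simp add: mult.commute)
        finally have "s div int n < int e" using e by (simp only: mult_less_cancel_left_pos of_nat_0_less_iff)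
        then show ?thesis using x e by (simp add: pos_imp_zdiv_nonneg_iff)
      qed
      ultimately show "x \<in> ?g ` (?S \<times> {0..<int e})"
        using x(1) s by (intro image_eqI[of _ _ "((b, s mod int n), s div int n)"]) auto
    qed
  qed
  have finS: "finite ?S" by (rule attached_weight_aux(2)[OF u e(2)]) simp
  then show "finite (attached_below u (- 1))" using bij_betw_finite[OF bij] by simp
  have "(\<Sum>x\<in>attached_below u (- 1). D_val m x) = (\<Sum>x\<in>attached_below u (- 1). pweight n (fuss (Suc m)) (bump n (fst x) (snd x)))"
    by (rule sum.cong) (auto simp: D_val_def attached_below_def)
  also have "\<dots> = (\<Sum>y\<in>?S \<times> {0..<int e}. pweight n (fuss (Suc m)) (bump n (fst (?g y)) (snd (?g y))))"
    by (rule sum.reindex_bij_betw[OF bij, symmetric])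
  also have "\<dots> = (\<Sum>(x, q)\<in>?S \<times> {0..<int e}. (case x of (b, r) \<Rightarrow> pweight n (fuss (Suc m)) (bump n b r)))"
    by (rule sum.cong) (auto simp: bump_shift)
  also have "\<dots> = (\<Sum>x\<in>?S. \<Sum>q\<in>{0..<int e}. (case x of (b, r) \<Rightarrow> pweight n (fuss (Suc m)) (bump n b r)))"
    by (rule sum.cartesian_product[symmetric])
  also have "\<dots> = e * (\<Sum>(b, r)\<in>?S. pweight n (fuss (Suc m)) (bump n b r))"
    by (simp add: sum_distrib_left case_prod_unfold)
  also have "\<dots> = e * (raney (Suc m) (Suc (n - mass n u)) (n - mass n u) * pweight n (fuss (Suc (Suc m))) u)"
    by (simp only: attached_center_weight[OF u e(2)])
  finally show "(\<Sum>x\<in>attached_below u (- 1). D_val m x)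
    = e * (raney (Suc m) (Suc (n - mass n u)) (n - mass n u) * pweight n (fuss (Suc (Suc m))) u)" .
qed

text \<open>Here the part of t is fixed, including its translate, so each element y of the block has
  exactly one representative in the first turn that lies in this part. There is no factor e.\<close>

lemma attached_below_block:
  assumes u: "u \<in> codes n" and t: "0 \<le> t" "mass n u = n" "vis u t"
  shows "(\<Sum>x\<in>attached_below u t. D_val m x) + pweight n (fuss (Suc (Suc m))) u = pweight n (fuss (Suc (Suc m))) (bump n u t)"
    and "finite (attached_below u t)"
proof -
  define j0 where "j0 = t mod int n"
  define q where "q = t div int n"
  define N where "N = int (e * n)"
  have N: "N > 0" using e by (simp add: N_def)
  have tq: "t = j0 + int n * q" by (simp add: j0_def q_def)
  note per = codes_periodic[OF u]
  have j0: "j0 \<in> {0..<int n}" using e by (simp add: j0_def)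
  have vj: "vis u j0" using t vis_shift[OF per, of j0 q] by (simp add: tq)
  let ?S = "attached n u (block u j0)"
  \<comment> \<open>Adding n q carries the block of j0 to that of t; reduction modulo N then moves
    the start into the first turn.\<close>
  let ?g = "\<lambda>(b, y). (b, (y + int n * q) mod N) :: (int \<Rightarrow> nat) \<times> int"
  have NM: "(y + int n * q) mod N = y + int n * (q - int e * ((y + int n * q) div N))" for y
    using minus_mult_div_eq_mod[of "y + int n * q" N, symmetric] by (simp add: N_def algebra_simps)
  have tt: "matched u t t" using t by (simp add: vis_def matched_refl_iff)
  have relt: "rel u t y \<longleftrightarrow> y - int n * q \<in> block u j0" for y
    using rel_matched[OF tt] matched_shift[OF per, of j0 q "y - int n * q"] by (simp add: block_def tq)
  have nocen: "\<not> central u i" for i using mass_full_iff[OF u e(2)] t by simp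
  have cellj: "cell n u j0 = block u j0" using j0 by (simp add: cell_def)
  have t1: "t \<noteq> - 1" using t by simp
  have bij: "bij_betw ?g ?S (attached_below u t)"
    unfolding bij_betw_def
  proof
    show "inj_on ?g ?S"
    proof (rule inj_onI)
      fix x x' assume x: "x \<in> ?S" "x' \<in> ?S" and g: "?g x = ?g x'"
      obtain b y b' y' where xx: "x = (b, y)" "x' = (b', y')" by (metis prod.exhaust)
      then have y: "y \<in> block u j0" "y' \<in> block u j0" and eq: "(y + int n * q) mod N = (y' + int n * q) mod N" and "b = b'"
        using x g by auto
      have "y mod int n = ((y + int n * q) mod N) mod int n" unfolding NM by simp
      also have "\<dots> = ((y' + int n * q) mod N) mod int n" unfolding eq ..
      also have "\<dots> = y' mod int n" unfolding NM by simp
      finally have "y mod int n = y' mod int n" .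
      then have "y = y'" using cell_mod_inj(2)[OF u e(2), of j0 j0 y y'] y j0 cellj by simp
      then show "x = x'" using xx \<open>b = b'\<close> by simp
    qed
    show "?g ` ?S = attached_below u t"
    proof (intro equalityI subsetI)
      fix x assume "x \<in> ?g ` ?S"
      then obtain b y where x: "x = (b, (y + int n * q) mod N)" "b \<in> codes n" "mass n b = n" "rel b \<le> rel u"
        "y \<in> block u j0" "vis b y" by auto
      let ?s = "(y + int n * q) mod N"
      have "vis b ?s" unfolding NM using vis_shift[OF codes_periodic[OF x(2)]] x by simp
      moreover have "0 \<le> ?s" "?s < int (e * n)" unfolding N_def[symmetric] using N by simp_all
      moreover have "rel u t (?s + int (e * n) * ((y + int n * q) div N))"
        unfolding relt N_def[symmetric] using x by simp
      ultimately show "x \<in> attached_below u t" using x t1 unfolding attached_below_def by blast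
    next
      fix x assume "x \<in> attached_below u t"
      then obtain b s where bs: "x = (b, s)" "b \<in> codes n" "mass n b = n" "rel b \<le> rel u"
        "0 \<le> s" "s < N" "vis b s" "central u s \<or> t \<noteq> - 1 \<and> (\<exists>c. rel u t (s + N * c))"
        unfolding attached_below_def N_def by blast
      then obtain c where "rel u t (s + N * c)" using nocen by blast
      note x = bs(1-7) this
      define y where "y = s + N * c - int n * q"
      have y: "y \<in> block u j0" using x relt by (simp add: y_def)
      have "y = s + int n * (int e * c - q)" by (simp add: y_def N_def algebra_simps)
      then have "vis b y" using vis_shift[OF codes_periodic[OF x(2)]] x by simp
      moreover have "(y + int n * q) mod N = s" using x by (simp add: y_def)
      ultimately show "x \<in> ?g ` ?S" using x y by (intro image_eqI[of _ _ "(b, y)"]) auto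
    qed
  qed
  have aux: "j0 = - 1 \<or> j0 \<in> {0..<int n} \<and> mass n u = n \<and> vis u j0" using j0 t vj by simp
  have finS: "finite ?S" using attached_weight_aux(2)[OF u e(2) aux] by (simp add: cellj)
  then show "finite (attached_below u t)" using bij_betw_finite[OF bij] by simp
  have "(\<Sum>x\<in>attached_below u t. D_val m x) = (\<Sum>x\<in>attached_below u t. pweight n (fuss (Suc m)) (bump n (fst x) (snd x)))"
    by (rule sum.cong) (auto simp: D_val_def attached_below_def)
  also have "\<dots> = (\<Sum>y\<in>?S. pweight n (fuss (Suc m)) (bump n (fst (?g y)) (snd (?g y))))"
    by (rule sum.reindex_bij_betw[OF bij, symmetric])
  also have "\<dots> = (\<Sum>(b, y)\<in>?S. pweight n (fuss (Suc m)) (bump n b y))"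
    by (rule sum.cong) (auto simp: NM bump_shift)
  finally show "(\<Sum>x\<in>attached_below u t. D_val m x) + pweight n (fuss (Suc (Suc m))) u = pweight n (fuss (Suc (Suc m))) (bump n u t)"
    using attached_block_weight[OF u e(2) j0 t(2) vj, of "Suc m"] by (simp only: tq bump_shift)
qed

text \<open>The elements below x either have s = -1, and are summed by \<open>below_weight\<close>,
  or have a marked class.\<close>

lemma D_val_Suc:
  assumes x: "x \<in> D_codes e n"
  shows "D_val (Suc m) x = (\<Sum>y\<in>{y\<in>D_codes e n. D_le e n y x}. D_val m y)"
    and "finite {y\<in>D_codes e n. D_le e n y x}"
proof -
  obtain u t where ut: "x = (u, t)" by force
  have u: "u \<in> codes n" and t: "t = - 1 \<or> 0 \<le> t \<and> mass n u = n \<and> vis u t" using x ut by (auto simp: D_codes_def)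
  let ?A = "(\<lambda>b. (b, - 1) :: (int \<Rightarrow> nat) \<times> int) ` {b\<in>codes n. rel b \<le> rel u}"
  have below: "{y\<in>D_codes e n. D_le e n y x} = ?A \<union> attached_below u t"
    unfolding ut by (rule D_below) (use x ut in simp)
  have finA: "finite ?A" using below_weight(2)[OF u e(2)] by simp
  have finB: "finite (attached_below u t)" using attached_below_center(2)[OF u] attached_below_block(2)[OF u] t by blast
  show "finite {y\<in>D_codes e n. D_le e n y x}" unfolding below using finA finB by simp
  let ?k = "n - mass n u"
  have "(\<Sum>y\<in>?A. D_val m y) = (\<Sum>b\<in>{b\<in>codes n. rel b \<le> rel u}. D_choose m (n - mass n b) * pweight n (fuss (Suc m)) b)"
    by (subst sum.reindex) (auto simp: inj_on_def D_val_def)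
  also have "\<dots> = (\<Sum>j\<le>?k. raney (Suc m) j ?k * D_choose m (?k - j)) * pweight n (fuss (Suc (Suc m))) u"
    by (rule below_weight(1)[OF u e(2)])
  finally have A: "(\<Sum>y\<in>?A. D_val m y) = (\<Sum>j\<le>?k. raney (Suc m) j ?k * D_choose m (?k - j)) * pweight n (fuss (Suc (Suc m))) u" .
  have "?A \<inter> attached_below u t = {}" by (auto simp: attached_below_def)
  then have "(\<Sum>y\<in>{y\<in>D_codes e n. D_le e n y x}. D_val m y) = (\<Sum>y\<in>?A. D_val m y) + (\<Sum>y\<in>attached_below u t. D_val m y)"
    unfolding below by (rule sum.union_disjoint[OF finA finB])
  also have "\<dots> = D_val (Suc m) x"
  proof (cases "t = - 1")
    case True
    \<comment> \<open>The elements with s = -1 provide both convolution sums; the boundary term that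
      \<open>raney_binomial_convolution'\<close> still asks for is the contribution of the marked
      elements.\<close>
    have split: "(\<Sum>j\<le>?k. raney (Suc m) j ?k * D_choose m (?k - j))
      = (\<Sum>j\<le>?k. raney (Suc m) j ?k * (Suc m * (?k - j) choose (?k - j)))
      + e * (\<Sum>j\<le>?k. raney (Suc m) j ?k * (Suc m * (?k - j) choose Suc (?k - j)))"
      unfolding D_choose_def by (simp only: distrib_left sum.distrib sum_distrib_left mult.left_commute)
    have k: "Suc (Suc m) * ?k = Suc m * ?k + ?k" by simp
    have "D_choose (Suc m) ?k = (\<Sum>j\<le>?k. raney (Suc m) j ?k * (Suc m * (?k - j) choose (?k - j)))
      + e * ((\<Sum>j\<le>?k. raney (Suc m) j ?k * (Suc m * (?k - j) choose Suc (?k - j))) + raney (Suc m) (Suc ?k) ?k)"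
      unfolding raney_binomial_convolution raney_binomial_convolution' D_choose_def k ..
    then have "(\<Sum>j\<le>?k. raney (Suc m) j ?k * D_choose m (?k - j)) + e * raney (Suc m) (Suc ?k) ?k = D_choose (Suc m) ?k"
      unfolding split by (simp only: distrib_left add.assoc)
    then show ?thesis
      unfolding A True attached_below_center(1)[OF u]
      by (simp only: ut True refl D_val_def fst_conv snd_conv if_True distrib_right[symmetric] mult.assoc[symmetric])
  next
    case False
    then have t': "0 \<le> t" "mass n u = n" "vis u t" using t by auto
    \<comment> \<open>There is no central class, so the convolution reduces to the term 1. This
      product is the summand that \<open>attached_below_block\<close> adds.\<close>
    have "(\<Sum>y\<in>?A. D_val m y) = pweight n (fuss (Suc (Suc m))) u"
      unfolding A using t'(2) by (simp add: D_choose_def)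
    then show ?thesis
      using attached_below_block(1)[OF u t', of m] False by (simp add: ut D_val_def)
  qed
  finally show "D_val (Suc m) x = (\<Sum>y\<in>{y\<in>D_codes e n. D_le e n y x}. D_val m y)" ..
qed

lemma zeta_center: "zeta (NCP_e_e e n) (\<preceq>) (Suc m) = (Suc m * n choose n) + e * (Suc m * n choose Suc n)"
proof -
  let ?mx = "(zero_code, - 1) :: (int \<Rightarrow> nat) \<times> int"
  have mx: "?mx \<in> D_codes e n" "D_le e n x ?mx" for x
    using zero_code by (auto simp: D_codes_def D_le_def le_fun_def)
  have "zeta (NCP_e_e e n) (\<preceq>) (Suc m) = zeta (D_codes e n) (D_le e n) (Suc m)"
    by (rule chains_iso[where le = "(\<preceq>)" and le' = "D_le e n", OF D_bij D_le_iff])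
  also have "\<dots> = D_val m ?mx"
  proof (rule zeta_by_weight[where val = D_val])
    show "finite (D_codes e n)" using D_val_Suc(2)[OF mx(1)] mx(2) by simp
    show "D_le e n x z" if xyz: "x \<in> D_codes e n" "y \<in> D_codes e n" "z \<in> D_codes e n" and le: "D_le e n x y" "D_le e n y z" for x y z
    proof -
      have "D_part e n x \<preceq> D_part e n y" "D_part e n y \<preceq> D_part e n z" using xyz le D_le_iff by blast+
      then have "D_part e n x \<preceq> D_part e n z" unfolding refines_def by (meson order_trans)
      then show ?thesis using xyz D_le_iff by blast
    qed
    show "D_val 0 u = 1" for u by (simp add: D_val_def D_choose_def pweight_0)
  qed (use mx D_val_Suc(1) in auto)
  also have "\<dots> = (Suc m * n choose n) + e * (Suc m * n choose Suc n)"
    by (simp add: D_val_def D_choose_def zero_code(2) pweight_zero_code)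
  finally show ?thesis .
qed

end

section \<open>Product forms of the counts\<close>

lemma prod_binomial: "(\<Prod>k=1..n. (real k + real a) / real k) = real (a + n choose n)"
proof (induction n)
  case (Suc n)
  have "real (Suc n) * real (a + Suc n choose Suc n) = real (a + Suc n) * real (a + n choose n)"
    using Suc_times_binomial_eq[of "a + n" n] by (simp only: of_nat_mult[symmetric] add_Suc_right mult.commute)
  then have "real (a + Suc n choose Suc n) = real (a + n choose n) * ((real (Suc n) + real a) / real (Suc n))"
    by (simp add: field_simps)
  then show ?case using Suc by simp
qed simp

theorem theorem8p1:
  fixes e n X :: nat
  assumes "e \<ge> 2" and "n \<ge> 1" and "X \<ge> 1"
  shows "real (zeta (NCP_1_1 n) (\<preceq>) X) =
           (\<Prod>k=2..n. (real k + real n * (real X - 1)) / real k)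
       \<and> real (zeta (NCP_e_1 e n) (\<preceq>) X) =
           (\<Prod>k=1..n. (real k + real n * (real X - 1)) / real k)
       \<and> real (zeta (NCP_e_e e n) (\<preceq>) X) =
           (real n + 1 + real e * real n * (real X - 1)) / (real n + 1) *
           (\<Prod>k=1..n. (real k + real n * (real X - 1)) / real k)"
proof -
  obtain m where X: "X = Suc m" using assms(3) by (cases X) auto
  have n: "n > 0" using assms(2) by simp
  have a: "real n * (real X - 1) = real (m * n)" by (simp add: X)
  let ?C = "Suc m * n choose n"
  have P: "(\<Prod>k=1..n. (real k + real n * (real X - 1)) / real k) = real ?C"
    unfolding a prod_binomial by (simp add: add.commute)
  \<comment> \<open>The factor for k = 1 is 1 + m n, the same as in \<open>fuss_closed_form\<close>;
    cancelling it leaves the product from k = 2.\<close>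
  have "(\<Prod>k=1..n. (real k + real (m * n)) / real k) = (1 + real (m * n)) * (\<Prod>k=2..n. (real k + real (m * n)) / real k)"
    using n by (simp add: prod.atLeast_Suc_atMost numeral_2_eq_2)
  moreover have "(1 + real (m * n)) * real (fuss (Suc m) n) = real ?C"
  proof -
    have "real ((m * n + 1) * fuss (Suc m) n) = real ?C" by (simp only: fuss_closed_form)
    then show ?thesis by (simp only: of_nat_mult of_nat_add of_nat_1 add.commute)
  qed
  ultimately have "(1 + real (m * n)) * (\<Prod>k=2..n. (real k + real (m * n)) / real k) = (1 + real (m * n)) * real (fuss (Suc m) n)"
    using P unfolding a by (simp only:)
  moreover have "1 + real (m * n) \<noteq> 0" by linarith
  ultimately have "(\<Prod>k=2..n. (real k + real (m * n)) / real k) = real (fuss (Suc m) n)"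
    by (simp only: mult_cancel_left simp_thms)
  then have 1: "real (zeta (NCP_1_1 n) (\<preceq>) X) = (\<Prod>k=2..n. (real k + real n * (real X - 1)) / real k)"
  proof -
    have "zeta (NCP_1_1 n) (\<preceq>) X = fuss (Suc m) n" unfolding X by (rule zeta_window[OF n])
    then show ?thesis using \<open>(\<Prod>k=2..n. (real k + real (m * n)) / real k) = real (fuss (Suc m) n)\<close>
      unfolding a by simp
  qed
  have 2: "real (zeta (NCP_e_1 e n) (\<preceq>) X) = real ?C"
    unfolding X zeta_invariant[OF assms(1) n] ..
  \<comment> \<open>Absorption expresses the second binomial coefficient of
    \<open>zeta_center\<close> by the first, with ratio m n / (n + 1).\<close>
  have "Suc n * (Suc m * n choose Suc n) = (Suc m * n - n) * ?C"
    unfolding binomial_absorption binomial_absorb_comp ..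
  then have "Suc n * (Suc m * n choose Suc n) = m * n * ?C" by simp
  then have "real (Suc n) * real (Suc m * n choose Suc n) = real (m * n) * real ?C"
    by (simp only: of_nat_mult[symmetric])
  then have c: "real (Suc m * n choose Suc n) = real (m * n) * real ?C / (real n + 1)"
    by (simp add: field_simps)
  have "real (zeta (NCP_e_e e n) (\<preceq>) X) = real ?C + real e * real (Suc m * n choose Suc n)"
    unfolding X zeta_center[OF assms(1) n] by simp
  also have "\<dots> = (real n + 1 + real e * real n * (real X - 1)) / (real n + 1) * real ?C"
    unfolding c mult.assoc[of "real e"] a by (simp add: field_simps)
  finally show ?thesis using 1 2 P by simp
qed

end
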